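(* Let $d>1$ be an integer and let $\mathcal{P}\subset Gr_d$ be a property that is monotone (closed under taking subgraphs), hyperfinite, and closed under taking disjoint unions. Then $\mathcal{P}$ can be verified by an approximate proof labeling scheme in constant-time. In particular, the class of planar graphs of maximum degree at most $d$ can be verified by an approximate proof labeling scheme in constant-time.
   Context: $Gr_d$ is the set of all finite simple graphs of maximum degree at most $d$; a property is a subset of $Gr_d$. For a graph $G$ and $x\in V(G)$, $B_s(x,G)$ is the subgraph induced on vertices at shortest-path distance at most $s$ from $x$, viewed as a rooted ball centered at $x$. For a finite set $Q$, a $Q$-proof on $G$ is a map $T:V(G)\to Q$. $B^{Q}_{r,d}$ denotes the set of (isomorphism classes of) rooted $Q$-vertex-labeled balls of radius at most $r$ and maximum degree at most $d$. A $Q$-verifier of local horizon $r$ is a subset $\mathcal{V}\subset B^{Q}_{r,d}$; it accepts a $Q$-proof $T$ on $G\in Gr_d$ if for every $x\in V(G)$ the labeled neighbourhood $B_r(x,G,T)$ (the ball $B_r(x,G)$ with labels induced by $T$) lies in $\mathcal{V}$, and rejects $T$ otherwise. Edit distance: for $H\in Gr_d$, $e(H,\mathcal{P})=\inf\{|E(G)\triangle E(H)|/|V(H)| : G\in\mathcal{P},\ V(G)=V(H)\}$. $\mathcal{P}$ can be verified by an approximate proof labeling scheme in constant-time if for every $\varepsilon>0$ there exist a finite set $Q_\varepsilon$, a positive integer $r_\varepsilon$ and a verifier $\mathcal{V}_\varepsilon\subset B^{Q_\varepsilon}_{r_\varepsilon,d}$ such that every $G\in\mathcal{P}$ has a $Q_\varepsilon$-proof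 accepted by $\mathcal{V}_\varepsilon$, and for every $H\in Gr_d$ with $e(H,\mathcal{P})>\varepsilon$ all $Q_\varepsilon$-proofs on $H$ are rejected by $\mathcal{V}_\varepsilon$. Hyperfiniteness: for $\varepsilon>0$, $K\ge 1$, $G$ is $(\varepsilon,K)$-hyperfinite if there is $W\subset E(G)$ with $|W|\le\varepsilon|E(G)|$ such that after removing $W$ every connected component has at most $K$ vertices; $\mathcal{P}$ is hyperfinite if for every $\varepsilon>0$ there is $K\ge1$ such that every $G\in\mathcal{P}$ is $(\varepsilon,K)$-hyperfinite. *)

theory Defs
  imports "HOL-Analysis.Analysis"
begin

record 'v ugraph =
  verts :: "'v set"
  edges :: "'v set set"

(* Graphs have at least one vertex: on the empty graph every verifier accepts vacuously, and
   the normalisation by the number of vertices in the edit distance is meaningless. *)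
definition simple_graph :: "'v ugraph \<Rightarrow> bool" where
  "simple_graph G \<longleftrightarrow>
     finite (verts G) \<and> verts G \<noteq> {} \<and> edges G \<subseteq> {e. e \<subseteq> verts G \<and> card e = 2}"

definition vdegree :: "'v ugraph \<Rightarrow> 'v \<Rightarrow> nat" where
  "vdegree G v = card {e \<in> edges G. v \<in> e}"

definition Gr :: "nat \<Rightarrow> 'v ugraph set" where
  "Gr d = {G. simple_graph G \<and> (\<forall>v\<in>verts G. vdegree G v \<le> d)}"

definition graph_iso :: "('v \<Rightarrow> 'w) \<Rightarrow> 'v ugraph \<Rightarrow> 'w ugraph \<Rightarrow> bool" where
  "graph_iso f G H \<longleftrightarrow>
     bij_betw f (verts G) (verts H) \<and> edges H = (\<lambda>e. f ` e) ` edges G"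

definition subgraph :: "'v ugraph \<Rightarrow> 'v ugraph \<Rightarrow> bool" where
  "subgraph H G \<longleftrightarrow> simple_graph H \<and> verts H \<subseteq> verts G \<and> edges H \<subseteq> edges G"

definition induced :: "'v ugraph \<Rightarrow> 'v set \<Rightarrow> 'v ugraph" where
  "induced G S = \<lparr>verts = S, edges = {e \<in> edges G. e \<subseteq> S}\<rparr>"

definition graph_union :: "'v ugraph \<Rightarrow> 'v ugraph \<Rightarrow> 'v ugraph" where
  "graph_union G H = \<lparr>verts = verts G \<union> verts H, edges = edges G \<union> edges H\<rparr>"

definition adj_rel :: "'v ugraph \<Rightarrow> 'v rel" where
  "adj_rel G = {(x, y). {x, y} \<in> edges G}"

(* The length of a shortest path, infinity if there is none. *)
definition gdist :: "'v ugraph \<Rightarrow> 'v \<Rightarrow> 'v \<Rightarrow> enat" where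
  "gdist G x y = (INF n \<in> {n. (x, y) \<in> adj_rel G ^^ n}. enat n)"

definition component_of :: "'v ugraph \<Rightarrow> 'v \<Rightarrow> 'v set" where
  "component_of G x = {y \<in> verts G. (x, y) \<in> (adj_rel G)\<^sup>*}"

(* Graphs are considered up to isomorphism, so a property is an isomorphism-invariant set of
   concrete graphs. *)
definition graph_property :: "nat \<Rightarrow> 'v ugraph set \<Rightarrow> bool" where
  "graph_property d P \<longleftrightarrow>
     P \<subseteq> Gr d \<and> (\<forall>G\<in>P. \<forall>H f. simple_graph H \<and> graph_iso f G H \<longrightarrow> H \<in> P)"

definition monotone_property :: "'v ugraph set \<Rightarrow> bool" where
  "monotone_property P \<longleftrightarrow> (\<forall>G\<in>P. \<forall>H. subgraph H G \<longrightarrow> H \<in> P)"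

definition closed_under_disjoint_unions :: "'v ugraph set \<Rightarrow> bool" where
  "closed_under_disjoint_unions P \<longleftrightarrow>
     (\<forall>G\<in>P. \<forall>H\<in>P. verts G \<inter> verts H = {} \<longrightarrow> graph_union G H \<in> P)"

definition hyperfinite_graph :: "real \<Rightarrow> nat \<Rightarrow> 'v ugraph \<Rightarrow> bool" where
  "hyperfinite_graph \<epsilon> K G \<longleftrightarrow>
     (\<exists>W \<subseteq> edges G. real (card W) \<le> \<epsilon> * real (card (edges G)) \<and>
        (\<forall>x\<in>verts G. card (component_of (G\<lparr>edges := edges G - W\<rparr>) x) \<le> K))"

definition hyperfinite :: "'v ugraph set \<Rightarrow> bool" where
  "hyperfinite P \<longleftrightarrow> (\<forall>\<epsilon>>0. \<exists>K\<ge>1. \<forall>G\<in>P. hyperfinite_graph \<epsilon> K G)"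

(* Extended-real valued: the distance is infinite if P contains no graph on the vertex set of H. *)
definition edit_dist :: "'v ugraph \<Rightarrow> 'v ugraph set \<Rightarrow> ereal" where
  "edit_dist H P =
     (INF G \<in> {G \<in> P. verts G = verts H}.
        ereal (real (card (sym_diff (edges G) (edges H))) / real (card (verts H))))"

type_synonym ('v, 'q) rooted_labeled = "'v ugraph \<times> 'v \<times> ('v \<Rightarrow> 'q)"

definition concrete_balls :: "'q set \<Rightarrow> nat \<Rightarrow> nat \<Rightarrow> ('v, 'q) rooted_labeled set" where
  "concrete_balls Q r d =
     {(B, x, T). B \<in> Gr d \<and> x \<in> verts B \<and> (\<forall>y\<in>verts B. gdist B x y \<le> enat r) \<and>
                 T \<in> verts B \<rightarrow> Q}"

definition ball_iso :: "'q set \<Rightarrow> nat \<Rightarrow> nat \<Rightarrow> ('v, 'q) rooted_labeled rel" where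
  "ball_iso Q r d =
     {((B, x, T), (B', x', T')).
        (B, x, T) \<in> concrete_balls Q r d \<and> (B', x', T') \<in> concrete_balls Q r d \<and>
        (\<exists>f. graph_iso f B B' \<and> f x = x' \<and> (\<forall>y\<in>verts B. T' (f y) = T y))}"

definition ball_classes :: "'q set \<Rightarrow> nat \<Rightarrow> nat \<Rightarrow> ('v, 'q) rooted_labeled set set" where
  "ball_classes Q r d = concrete_balls Q r d // ball_iso Q r d"

definition nbhd :: "nat \<Rightarrow> 'v \<Rightarrow> 'v ugraph \<Rightarrow> ('v \<Rightarrow> 'q) \<Rightarrow> ('v, 'q) rooted_labeled" where
  "nbhd r x G T =
     (let S = {y \<in> verts G. gdist G x y \<le> enat r} in (induced G S, x, restrict T S))"

definition nbhd_class ::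
    "'q set \<Rightarrow> nat \<Rightarrow> nat \<Rightarrow> 'v \<Rightarrow> 'v ugraph \<Rightarrow> ('v \<Rightarrow> 'q) \<Rightarrow> ('v, 'q) rooted_labeled set" where
  "nbhd_class Q r d x G T = ball_iso Q r d `` {nbhd r x G T}"

definition accepts ::
    "'q set \<Rightarrow> nat \<Rightarrow> nat \<Rightarrow> ('v, 'q) rooted_labeled set set \<Rightarrow> 'v ugraph \<Rightarrow> ('v \<Rightarrow> 'q) \<Rightarrow> bool" where
  "accepts Q r d \<V> G T \<longleftrightarrow> (\<forall>x\<in>verts G. nbhd_class Q r d x G T \<in> \<V>)"

(* Labels are drawn from a finite set of natural numbers; only the cardinality of Q matters. *)
definition approx_verifiable :: "nat \<Rightarrow> 'v ugraph set \<Rightarrow> bool" where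
  "approx_verifiable d P \<longleftrightarrow>
     (\<forall>\<epsilon>::real. \<epsilon> > 0 \<longrightarrow>
        (\<exists>(Q :: nat set) (r :: nat) \<V>.
           finite Q \<and> r > 0 \<and> \<V> \<subseteq> ball_classes Q r d \<and>
           (\<forall>G\<in>P. \<exists>T \<in> verts G \<rightarrow> Q. accepts Q r d \<V> G T) \<and>
           (\<forall>H\<in>Gr d. edit_dist H P > ereal \<epsilon> \<longrightarrow>
              (\<forall>T \<in> verts H \<rightarrow> Q. \<not> accepts Q r d \<V> H T))))"

(* A crossing-free drawing in the Euclidean plane (the type complex): vertices are distinct
   points, edges are arcs joining their ends, and arcs meet vertices and each other only in
   common endpoints. *)
definition planar :: "'v ugraph \<Rightarrow> bool" where
  "planar G \<longleftrightarrow>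
     (\<exists>(p :: 'v \<Rightarrow> complex) (\<gamma> :: 'v set \<Rightarrow> real \<Rightarrow> complex).
        inj_on p (verts G) \<and>
        (\<forall>e\<in>edges G. arc (\<gamma> e) \<and> {pathstart (\<gamma> e), pathfinish (\<gamma> e)} = p ` e) \<and>
        (\<forall>e\<in>edges G. \<forall>v\<in>verts G. p v \<in> path_image (\<gamma> e) \<longrightarrow> v \<in> e) \<and>
        (\<forall>e\<in>edges G. \<forall>e'\<in>edges G. e \<noteq> e' \<longrightarrow>
           path_image (\<gamma> e) \<inter> path_image (\<gamma> e') \<subseteq> p ` (e \<inter> e')))"

end

theory Submission
  imports Defs "HOL-Library.Nat_Bijection" "HOL-Real_Asymp.Real_Asymp"
begin

text \<open>
  A graph in a hyperfinite monotone property has a minimum set of edges whose removal leaves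
  components of bounded size. Minimality forces the endpoints of the cut edges to be locally
  sparse: by Hall's theorem every such endpoint can be given its own \<open>m\<close> vertices within bounded
  distance. A label names these local data through a colouring that is injective on balls, and
  conversely labels that look locally right certify that few edges have to be removed to obtain a
  disjoint union of graphs of the property.

  Planar graphs of bounded degree are hyperfinite because they have no \<open>K\<^sub>6\<close> minor: otherwise three
  branch sets would join two others to a theta curve whose three arcs are all accessible from the
  sixth, which Janiszewski's theorem excludes. Graphs without \<open>K\<^sub>6\<close> minor have sublinear separators,
  and cutting recursively costs a geometric series.
\<close>

section \<open>Balls and degrees\<close>

text \<open>The obstacle is that a verifier never sees a global count: that few edges are cut has to
  be visible vertex by vertex. The private vertices supply this. If every endpoint of a cut edge
  owns \<open>m\<close> vertices and no vertex has two owners, the endpoints make up at most a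
  fraction \<open>1 / m\<close> of all vertices, so \<open>m\<close> of order
  \<open>d / \<epsilon>\<close> pays for the edit distance. Hall's condition may fail for an
  arbitrary cut, whose edges can crowd in one region. Minimality excludes that, and monotonicity
  enters because the ball around a crowded region must itself be hyperfinite before it can be recut.
  Finitely many labels cannot name vertices, but colours that are distinct on balls name them
  unambiguously within the distance at which ownership acts; this makes ownership checkable for
  adversarial labels as well. On the planar side, the bound on complete minors is all that is taken
  from the drawing for hyperfiniteness; separators and recursion are purely combinatorial.\<close>

definition gball :: "'v ugraph \<Rightarrow> nat \<Rightarrow> 'v \<Rightarrow> 'v set" where
  "gball G n x = {y \<in> verts G. gdist G x y \<le> enat n}"

definition neighbors :: "'v ugraph \<Rightarrow> 'v \<Rightarrow> 'v set" where
  "neighbors G x = {y. {x, y} \<in> edges G}"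

text \<open>\<open>gdist\<close> is an infimum over a possibly empty set, and a strict bound on an
  infimum is what yields a witness; hence the detour through \<open>enat (Suc n)\<close>.\<close>

lemma gdist_le_iff: "gdist G x y \<le> enat n \<longleftrightarrow> (\<exists>k\<le>n. (x, y) \<in> adj_rel G ^^ k)"
proof -
  have "gdist G x y \<le> enat n \<longleftrightarrow> gdist G x y < enat (Suc n)"
    by (metis Suc_ile_eq eSuc_enat ileI1 iless_Suc_eq linorder_not_le order_le_less_trans order_less_le)
  also have "\<dots> \<longleftrightarrow> (\<exists>k\<le>n. (x, y) \<in> adj_rel G ^^ k)"
    unfolding gdist_def by (auto simp: INF_less_iff less_Suc_eq_le)
  finally show ?thesis .
qed

lemma mem_gball_iff: "y \<in> gball G n x \<longleftrightarrow> y \<in> verts G \<and> (\<exists>k\<le>n. (x, y) \<in> adj_rel G ^^ k)"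
  by (simp add: gball_def gdist_le_iff)

lemma simple_graph_edgeD:
  assumes "simple_graph G" "{x, y} \<in> edges G"
  shows "x \<in> verts G" "y \<in> verts G" "x \<noteq> y"
  using assms by (auto simp: simple_graph_def card_2_iff doubleton_eq_iff)

lemma simple_graph_edgeE:
  assumes "simple_graph G" "e \<in> edges G"
  obtains x y where "e = {x, y}" "x \<noteq> y" "x \<in> verts G" "y \<in> verts G"
proof -
  have "card e = 2" "e \<subseteq> verts G" using assms by (auto simp: simple_graph_def)
  then show ?thesis using that by (auto simp: card_2_iff)
qed

lemma finite_edges: "simple_graph G \<Longrightarrow> finite (edges G)"
  by (rule finite_subset[of _ "Pow (verts G)"]) (auto simp: simple_graph_def)

lemma finite_verts: "simple_graph G \<Longrightarrow> finite (verts G)"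
  by (simp add: simple_graph_def)

lemma GrD: "G \<in> Gr d \<Longrightarrow> simple_graph G" "G \<in> Gr d \<Longrightarrow> v \<in> verts G \<Longrightarrow> vdegree G v \<le> d"
  by (auto simp: Gr_def)

lemma adj_rel_sym: "(x, y) \<in> adj_rel G \<longleftrightarrow> (y, x) \<in> adj_rel G"
  by (simp add: adj_rel_def insert_commute)

lemma adj_rel_pow_sym: "(x, y) \<in> adj_rel G ^^ k \<Longrightarrow> (y, x) \<in> adj_rel G ^^ k"
proof (induction k arbitrary: y)
  case (Suc k)
  then show ?case by (meson adj_rel_sym relpow_Suc_E relpow_Suc_I2)
qed auto

lemma finite_gball: "simple_graph G \<Longrightarrow> finite (gball G n x)"
  by (simp add: gball_def finite_verts)

lemma gball_subset_verts: "gball G n x \<subseteq> verts G"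
  by (auto simp: gball_def)

lemma center_in_gball: "x \<in> verts G \<Longrightarrow> x \<in> gball G n x"
  unfolding mem_gball_iff by (metis le0 relpow_0_I)

lemma gball_0: "x \<in> verts G \<Longrightarrow> gball G 0 x = {x}"
  by (auto simp: mem_gball_iff)

text \<open>Breadth-first recursion; it replaces relational powers in most later inductions on the
  radius.\<close>

lemma gball_Suc:
  assumes "simple_graph G" "x \<in> verts G"
  shows "gball G (Suc n) x = gball G n x \<union> (\<Union>z\<in>gball G n x. neighbors G z)"
proof (intro equalityI subsetI)
  fix y assume "y \<in> gball G (Suc n) x"
  then obtain k where k: "y \<in> verts G" "k \<le> Suc n" "(x, y) \<in> adj_rel G ^^ k"
    by (auto simp: mem_gball_iff)
  show "y \<in> gball G n x \<union> (\<Union>z\<in>gball G n x. neighbors G z)"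
  proof (cases "k \<le> n")
    case True
    then show ?thesis using k by (auto simp: mem_gball_iff)
  next
    case False
    then have "k = Suc n" using k by simp
    then obtain z where z: "(x, z) \<in> adj_rel G ^^ n" "(z, y) \<in> adj_rel G"
      using k by (meson relpow_Suc_E)
    then have "{z, y} \<in> edges G" by (simp add: adj_rel_def)
    then have "z \<in> verts G" using assms simple_graph_edgeD by metis
    with z have "z \<in> gball G n x" by (auto simp: mem_gball_iff)
    with \<open>{z, y} \<in> edges G\<close> show ?thesis by (auto simp: neighbors_def)
  qed
next
  fix y assume "y \<in> gball G n x \<union> (\<Union>z\<in>gball G n x. neighbors G z)"
  then consider "y \<in> gball G n x" | z where "z \<in> gball G n x" "{z, y} \<in> edges G"
    by (auto simp: neighbors_def)
  then show "y \<in> gball G (Suc n) x"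
  proof cases
    case 1
    then show ?thesis by (auto simp: mem_gball_iff) (meson le_SucI)
  next
    case 2
    then obtain k where "k \<le> n" "(x, z) \<in> adj_rel G ^^ k" by (auto simp: mem_gball_iff)
    then have "Suc k \<le> Suc n" "(x, y) \<in> adj_rel G ^^ Suc k"
      using 2 by (auto simp: adj_rel_def intro: relpow_Suc_I)
    then show ?thesis
      using assms 2 simple_graph_edgeD mem_gball_iff by metis
  qed
qed

lemma gball_mono: "m \<le> n \<Longrightarrow> gball G m x \<subseteq> gball G n x"
  by (auto simp: mem_gball_iff) (meson order_trans)

lemma gball_sym: "y \<in> gball G n x \<Longrightarrow> x \<in> verts G \<Longrightarrow> x \<in> gball G n y"
  by (auto simp: mem_gball_iff dest: adj_rel_pow_sym)

lemma gball_trans: "y \<in> gball G m x \<Longrightarrow> z \<in> gball G n y \<Longrightarrow> z \<in> gball G (m + n) x"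
  unfolding mem_gball_iff by (metis (no_types, lifting) add_mono relpow_add relcomp.relcompI)

lemma neighbors_subset_verts: "simple_graph G \<Longrightarrow> neighbors G x \<subseteq> verts G"
  by (auto simp: neighbors_def dest: simple_graph_edgeD)

lemma card_neighbors:
  assumes "G \<in> Gr d"
  shows "card (neighbors G x) \<le> d"
proof (cases "x \<in> verts G")
  case True
  have inj: "inj_on (\<lambda>y. {x, y}) (neighbors G x)"
    by (auto simp: inj_on_def doubleton_eq_iff)
  have "card (neighbors G x) = card ((\<lambda>y. {x, y}) ` neighbors G x)"
    using inj by (simp add: card_image)
  also have "\<dots> \<le> card {e \<in> edges G. x \<in> e}"
    by (rule card_mono) (use finite_edges[OF GrD(1)[OF assms]] in \<open>auto simp: neighbors_def\<close>)
  also have "\<dots> \<le> d" using GrD(2)[OF assms True] by (simp add: vdegree_def)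
  finally show ?thesis .
next
  case False
  then have "neighbors G x = {}"
    using simple_graph_edgeD(1)[OF GrD(1)[OF assms]] by (auto simp: neighbors_def)
  then show ?thesis by simp
qed

lemma finite_neighbors: "simple_graph G \<Longrightarrow> finite (neighbors G x)"
  using finite_subset[OF neighbors_subset_verts finite_verts] .

text \<open>Converts vertex counts into edge counts: it prices the inside and the boundary of a
  ball, the edges lost at the endpoints of a cut, and the edges at a vertex separator.\<close>

lemma card_incident_edges:
  assumes "G \<in> Gr d" "finite S"
  shows "card {e \<in> edges G. e \<inter> S \<noteq> {}} \<le> d * card S"
proof -
  have fin: "finite (edges G)" using finite_edges[OF GrD(1)[OF assms(1)]] .
  have "{e \<in> edges G. e \<inter> S \<noteq> {}} \<subseteq> (\<Union>v\<in>S \<inter> verts G. {e \<in> edges G. v \<in> e})"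
    using GrD(1)[OF assms(1)] by (auto simp: simple_graph_def)
  then have "card {e \<in> edges G. e \<inter> S \<noteq> {}} \<le> card (\<Union>v\<in>S \<inter> verts G. {e \<in> edges G. v \<in> e})"
    by (rule card_mono[rotated]) (use assms fin in auto)
  also have "\<dots> \<le> (\<Sum>v\<in>S \<inter> verts G. card {e \<in> edges G. v \<in> e})"
    by (rule card_UN_le) (use assms in auto)
  also have "\<dots> \<le> (\<Sum>v\<in>S \<inter> verts G. d)"
    by (rule sum_mono) (use GrD(2)[OF assms(1)] in \<open>auto simp: vdegree_def\<close>)
  also have "\<dots> \<le> d * card S" by (simp add: assms card_mono)
  finally show ?thesis .
qed

lemma card_gball:
  assumes "G \<in> Gr d" "x \<in> verts G"
  shows "card (gball G n x) \<le> (d + 1) ^ n"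
proof (induction n)
  case 0
  then show ?case using assms by (simp add: gball_0)
next
  case (Suc n)
  have sg: "simple_graph G" using assms GrD by blast
  have "card (gball G (Suc n) x) \<le> card (gball G n x) + card (\<Union>z\<in>gball G n x. neighbors G z)"
    unfolding gball_Suc[OF sg assms(2)] by (rule card_Un_le)
  also have "card (\<Union>z\<in>gball G n x. neighbors G z) \<le> (\<Sum>z\<in>gball G n x. card (neighbors G z))"
    by (rule card_UN_le) (rule finite_gball[OF sg])
  also have "\<dots> \<le> (\<Sum>z\<in>gball G n x. d)"
    by (rule sum_mono) (rule card_neighbors[OF assms(1)])
  finally have "card (gball G (Suc n) x) \<le> (d + 1) * card (gball G n x)"
    by (simp add: mult.commute)
  then show ?case using Suc by (metis mult_le_mono2 le_trans power_Suc)
qed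

subsection \<open>Hall's marriage theorem and greedy colouring\<close>

text \<open>Induction on \<open>card I\<close>, split by whether some nonempty proper subfamily is
  tight, that is, has exactly as many candidates as members. A tight subfamily is matched
  separately; without one, every nonempty proper subfamily has a candidate to spare, and one choice
  can be fixed arbitrarily.\<close>

lemma hall_marriage:
  assumes "finite I" "\<And>i. i \<in> I \<Longrightarrow> finite (A i)"
    and "\<And>J. J \<subseteq> I \<Longrightarrow> card J \<le> card (\<Union>(A ` J))"
  shows "\<exists>f. inj_on f I \<and> (\<forall>i\<in>I. f i \<in> A i)"
  using assms
proof (induction "card I" arbitrary: I A rule: less_induct)
  case less
  show ?case
  proof (cases "I = {}")
    case True
    then show ?thesis by auto
  next
    case False
    show ?thesis
    proof (cases "\<exists>J. J \<subset> I \<and> J \<noteq> {} \<and> card (\<Union>(A ` J)) = card J")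
      case True
      then obtain J where J: "J \<subset> I" "J \<noteq> {}" "card (\<Union>(A ` J)) = card J" by blast
      have finJ: "finite J" using J less.prems(1) finite_subset by blast
      have "card J < card I" using J less.prems(1) by (simp add: psubset_card_mono)
      then have "\<exists>f. inj_on f J \<and> (\<forall>i\<in>J. f i \<in> A i)"
        using less.prems J finJ by (intro less.hyps) (auto intro: less.prems(3))
      then obtain f where f: "inj_on f J" "\<forall>i\<in>J. f i \<in> A i" by blast
      define U where "U = \<Union>(A ` J)"
      have finU: "finite U" unfolding U_def using finJ J less.prems(2) by auto
      have "\<exists>g. inj_on g (I - J) \<and> (\<forall>i\<in>I - J. g i \<in> A i - U)"
      proof (rule less.hyps)
        show "card (I - J) < card I"
          using J less.prems(1) by (intro psubset_card_mono) auto
        fix L assume L: "L \<subseteq> I - J"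
        have finL: "finite L" using L less.prems(1) finite_subset by blast
        \<comment> \<open>Hall's condition for \<open>L \<union> J\<close>, minus the tight equality
          for \<open>J\<close>, is Hall's condition for \<open>L\<close> once the candidates
          \<open>U\<close> of \<open>J\<close> are removed.\<close>
        have "card L + card J = card (L \<union> J)"
          using L finL finJ by (subst card_Un_disjoint) auto
        also have "\<dots> \<le> card (\<Union>(A ` (L \<union> J)))" using L J by (intro less.prems(3)) auto
        also have "\<Union>(A ` (L \<union> J)) = \<Union>((\<lambda>i. A i - U) ` L) \<union> U" by (auto simp: U_def)
        also have "card \<dots> = card (\<Union>((\<lambda>i. A i - U) ` L)) + card U"
          by (rule card_Un_disjoint) (use finU finL L less.prems(2) in auto)
        finally show "card L \<le> card (\<Union>((\<lambda>i. A i - U) ` L))" using J(3) by (simp add: U_def)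
      qed (use less.prems in auto)
      then obtain g where g: "inj_on g (I - J)" "\<forall>i\<in>I - J. g i \<in> A i - U" by blast
      define h where "h i = (if i \<in> J then f i else g i)" for i
      have hU: "h i \<in> U \<longleftrightarrow> i \<in> J" if "i \<in> I" for i
        using f(2) g(2) that by (auto simp: h_def U_def)
      have "inj_on h I"
      proof (rule inj_onI)
        fix i j assume ij: "i \<in> I" "j \<in> I" "h i = h j"
        then have "i \<in> J \<longleftrightarrow> j \<in> J" using hU by metis
        then show "i = j"
          using ij f(1) g(1) by (cases "i \<in> J") (auto simp: h_def inj_on_def)
      qed
      moreover have "\<forall>i\<in>I. h i \<in> A i" using f g by (auto simp: h_def)
      ultimately show ?thesis by blast
    next
      case False
      obtain i where i: "i \<in> I" using \<open>I \<noteq> {}\<close> by blast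
      have "card {i} \<le> card (\<Union>(A ` {i}))" using i by (intro less.prems(3)) auto
      then obtain a where a: "a \<in> A i" by fastforce
      have "\<exists>g. inj_on g (I - {i}) \<and> (\<forall>j\<in>I - {i}. g j \<in> A j - {a})"
      proof (rule less.hyps)
        show "card (I - {i}) < card I" using i less.prems(1) by (intro psubset_card_mono) auto
        fix L assume L: "L \<subseteq> I - {i}"
        have finL: "finite L" using L less.prems(1) finite_subset by blast
        have fin: "finite (\<Union>(A ` L))" using finL L less.prems(2) by auto
        show "card L \<le> card (\<Union>((\<lambda>j. A j - {a}) ` L))"
        proof (cases "L = {}")
          case False
          have "card L \<le> card (\<Union>(A ` L))" using L by (intro less.prems(3)) auto
          \<comment> \<open>No subfamily is tight, so \<open>L\<close> has a candidate more than it
            needs and survives the loss of \<open>a\<close>.\<close>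
          moreover have "card (\<Union>(A ` L)) \<noteq> card L"
            using \<open>\<nexists>J. J \<subset> I \<and> J \<noteq> {} \<and> card (\<Union>(A ` J)) = card J\<close> False L i by blast
          ultimately have "card L < card (\<Union>(A ` L))" by simp
          also have "\<dots> \<le> card (\<Union>(A ` L) - {a}) + 1"
            by (cases "a \<in> \<Union>(A ` L)") (use fin in \<open>simp_all add: card_Diff_singleton del: Union_iff UN_iff\<close>)
          also have "\<Union>(A ` L) - {a} = \<Union>((\<lambda>j. A j - {a}) ` L)" by auto
          finally show ?thesis by simp
        qed auto
      qed (use less.prems in auto)
      then obtain g where g: "inj_on g (I - {i})" "\<forall>j\<in>I - {i}. g j \<in> A j - {a}" by blast
      have "inj_on (g(i := a)) I"
      proof (rule inj_onI)
        fix u v assume "u \<in> I" "v \<in> I" "(g(i := a)) u = (g(i := a)) v"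
        then show "u = v"
          using g by (cases "u = i"; cases "v = i") (auto simp: inj_on_def)
      qed
      moreover have "\<forall>j\<in>I. (g(i := a)) j \<in> A j" using g a by auto
      ultimately show ?thesis by blast
    qed
  qed
qed

text \<open>Vertices are coloured one at a time; fewer than \<open>c\<close> conflicts always leave
  a colour free. \<open>R\<close> may be reflexive, in which case a vertex is counted among its own
  conflicts.\<close>

lemma greedy_colouring:
  assumes "finite V" "\<And>u v. R u v \<Longrightarrow> R v u" "\<And>v. v \<in> V \<Longrightarrow> card {u \<in> V. R v u} < c"
  shows "\<exists>col. (\<forall>v\<in>V. col v < (c::nat)) \<and> (\<forall>u\<in>V. \<forall>v\<in>V. u \<noteq> v \<longrightarrow> R u v \<longrightarrow> col u \<noteq> col v)"
  using assms(1,3)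
proof (induction V rule: finite_induct)
  case empty
  then show ?case by auto
next
  case (insert x V)
  have "card {u \<in> V. R v u} < c" if "v \<in> V" for v
    by (rule le_less_trans[OF card_mono insert.prems[of v]]) (use insert.hyps that in auto)
  then have "\<exists>col. (\<forall>v\<in>V. col v < c) \<and> (\<forall>u\<in>V. \<forall>v\<in>V. u \<noteq> v \<longrightarrow> R u v \<longrightarrow> col u \<noteq> col v)"
    by (rule insert.IH)
  then obtain col where col: "\<forall>v\<in>V. col v < c" "\<forall>u\<in>V. \<forall>v\<in>V. u \<noteq> v \<longrightarrow> R u v \<longrightarrow> col u \<noteq> col v"
    by (elim exE conjE)
  have "card (col ` {u \<in> V. R x u}) \<le> card {u \<in> V. R x u}"
    by (rule card_image_le) (use insert.hyps in auto)
  also have "\<dots> \<le> card {u \<in> insert x V. R x u}"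
    by (rule card_mono) (use insert.hyps in auto)
  also have "\<dots> < c" using insert.prems by blast
  finally have "card (col ` {u \<in> V. R x u}) < card {..<c}" by simp
  then have "\<not> {..<c} \<subseteq> col ` {u \<in> V. R x u}"
    using card_mono[of "col ` {u \<in> V. R x u}" "{..<c}"] insert.hyps(1) by auto
  then obtain k where k: "k < c" "k \<notin> col ` {u \<in> V. R x u}" by auto
  have "\<forall>v\<in>insert x V. (col(x := k)) v < c" using col k by auto
  moreover have "\<forall>u\<in>insert x V. \<forall>v\<in>insert x V. u \<noteq> v \<longrightarrow> R u v \<longrightarrow> (col(x := k)) u \<noteq> (col(x := k)) v"
  proof (intro ballI impI)
    fix u v assume uv: "u \<in> insert x V" "v \<in> insert x V" "u \<noteq> v" "R u v"
    consider "u = x" "v \<in> V" | "v = x" "u \<in> V" | "u \<in> V" "v \<in> V" "u \<noteq> x" "v \<noteq> x"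
      using uv by blast
    then show "(col(x := k)) u \<noteq> (col(x := k)) v"
      by cases (use uv col k assms(2)[OF uv(4)] in auto)
  qed
  ultimately show ?case by blast
qed

section \<open>Minimum cuts\<close>

abbreviation with_edges :: "'v ugraph \<Rightarrow> 'v set set \<Rightarrow> 'v ugraph" where
  "with_edges G E \<equiv> G\<lparr>edges := E\<rparr>"

text \<open>Tool for comparing two cuts: if no edge of \<open>G\<close> leaves \<open>S\<close> and
  the edges of \<open>G\<close> in \<open>S\<close> all survive in \<open>H\<close>, then passing to
  \<open>H\<close> can only enlarge the component of a vertex of \<open>S\<close>.\<close>

lemma component_of_subset_if_closed:
  assumes "x \<in> S" "S \<inter> verts G \<subseteq> verts H"
    and closed: "\<And>y z. y \<in> S \<Longrightarrow> {y, z} \<in> edges G \<Longrightarrow> z \<in> S \<and> {y, z} \<in> edges H"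
  shows "component_of G x \<subseteq> component_of H x"
proof
  fix y assume y: "y \<in> component_of G x"
  then have "(x, y) \<in> (adj_rel G)\<^sup>*" "y \<in> verts G" by (auto simp: component_of_def)
  from this(1) have "y \<in> S \<and> (x, y) \<in> (adj_rel H)\<^sup>*"
  proof (induction rule: rtrancl_induct)
    case base
    then show ?case using assms by auto
  next
    case (step y z)
    then have "{y, z} \<in> edges G" by (simp add: adj_rel_def)
    then have "z \<in> S \<and> {y, z} \<in> edges H" using closed step by blast
    moreover from this have "(y, z) \<in> adj_rel H" by (simp add: adj_rel_def)
    ultimately show ?case using step.IH by (meson rtrancl.rtrancl_into_rtrancl)
  qed
  then show "y \<in> component_of H x" using \<open>y \<in> verts G\<close> assms(2) by (auto simp: component_of_def)
qed

lemma simple_graph_edge_atE: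
  assumes "simple_graph G" "e \<in> edges G" "v \<in> e"
  obtains z where "e = {v, z}" "z \<noteq> v"
proof -
  obtain x y where "e = {x, y}" "x \<noteq> y" using simple_graph_edgeE[OF assms(1,2)] .
  then show ?thesis using that[of x] that[of y] assms(3) by (auto simp: insert_commute)
qed

definition bounded_cut :: "nat \<Rightarrow> 'v ugraph \<Rightarrow> 'v set set \<Rightarrow> bool" where
  "bounded_cut K G W \<longleftrightarrow> W \<subseteq> edges G \<and>
     (\<forall>x\<in>verts G. card (component_of (with_edges G (edges G - W)) x) \<le> K)"

lemma simple_graph_induced:
  "simple_graph G \<Longrightarrow> U \<subseteq> verts G \<Longrightarrow> U \<noteq> {} \<Longrightarrow> simple_graph (induced G U)"
  by (auto simp: simple_graph_def induced_def intro: finite_subset)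

lemma subgraph_induced:
  "simple_graph G \<Longrightarrow> U \<subseteq> verts G \<Longrightarrow> U \<noteq> {} \<Longrightarrow> subgraph (induced G U) G"
  using simple_graph_induced[of G U] by (auto simp: subgraph_def induced_def)

lemma card_Union_edges:
  assumes "simple_graph G" "W \<subseteq> edges G"
  shows "card (\<Union>W) \<le> 2 * card W"
proof -
  have "finite W" using assms finite_edges finite_subset by blast
  have "card (\<Union>W) \<le> (\<Sum>e\<in>W. card e)"
    using card_UN_le[of W "\<lambda>e. e"] \<open>finite W\<close> by simp
  also have "\<dots> = (\<Sum>e\<in>W. 2)"
    by (rule sum.cong) (use assms in \<open>auto simp: simple_graph_def\<close>)
  finally show ?thesis by simp
qed

text \<open>If each of the \<open>c * m\<close> steps gained more than \<open>f / c\<close>, the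
  total gain would reach \<open>m * f\<close>. Multiplying by \<open>c\<close> keeps everything in
  the naturals. The search begins at 1 because the ball to be found must contain both ends of the
  cut edges at its centres.\<close>

lemma slow_growth_step:
  fixes g :: "nat \<Rightarrow> nat"
  assumes "g (c * m + 1) < m * f" "0 < c"
  shows "\<exists>j. 1 \<le> j \<and> j \<le> c * m \<and> c * g (Suc j) \<le> c * g j + f"
proof (rule ccontr)
  assume "\<not> ?thesis"
  then have step: "c * g (Suc j) > c * g j + f" if "1 \<le> j" "j \<le> c * m" for j
    using that by (meson linorder_not_less)
  have "j \<le> c * m \<Longrightarrow> j * f \<le> c * g (Suc j)" for j
  proof (induction j)
    case (Suc j)
    then show ?case using step[of "Suc j"] by auto
  qed auto
  from this[of "c * m"] have "c * (m * f) \<le> c * g (Suc (c * m))" by (simp add: algebra_simps)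
  then show False using assms by simp
qed

text \<open>A minimum cut into components of bounded size satisfies Hall's condition: were a set of cut
  endpoints to see too few vertices, some ball around it would have a small boundary, and cutting
  this ball off and recutting its inside by hyperfiniteness would be cheaper.\<close>

lemma minimum_cut_expands:
  assumes P: "P \<subseteq> Gr d" "monotone_property P" and G: "G \<in> P" and "0 < d" "0 < m"
    and hyp: "\<And>G. G \<in> P \<Longrightarrow> hyperfinite_graph (1 / (8 * d * m)) K G"
  shows "\<exists>W. bounded_cut K G W \<and>
    (\<forall>F\<subseteq>\<Union>W. m * card F \<le> card (\<Union>v\<in>F. gball G (8 * d * m + 1) v))"
proof -
  have GG: "G \<in> Gr d" and sg: "simple_graph G" using P G GrD by auto
  have "\<exists>W. bounded_cut K G W"
    using hyp[OF G] by (auto simp: hyperfinite_graph_def bounded_cut_def)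
  then obtain W where W: "bounded_cut K G W"
    and least: "\<And>W'. bounded_cut K G W' \<Longrightarrow> card W \<le> card W'"
    using ex_has_least_nat[of "bounded_cut K G" _ card] by blast
  have WE: "W \<subseteq> edges G" using W by (simp add: bounded_cut_def)
  have finE: "finite (edges G)" using finite_edges sg by blast
  have "m * card F \<le> card (\<Union>v\<in>F. gball G (8 * d * m + 1) v)" if F: "F \<subseteq> \<Union>W" for F
  proof (rule ccontr)
    define N where "N j = (\<Union>v\<in>F. gball G j v)" for j
    define f where "f = card F"
    assume "\<not> ?thesis"
    then have small: "card (N (8 * d * m + 1)) < m * f" by (simp add: N_def f_def)
    \<comment> \<open>With \<open>c = 8 * d\<close>, going from radius \<open>j\<close> to
      \<open>Suc j\<close> adds at most \<open>f / (8 * d)\<close> vertices, hence few boundary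
      edges, while \<open>small\<close> still bounds the whole ball by \<open>m * f\<close>.\<close>
    then obtain j where j: "1 \<le> j" "j \<le> 8 * d * m" "8 * d * card (N (Suc j)) \<le> 8 * d * card (N j) + f"
      using slow_growth_step[of "\<lambda>j. card (N j)" "8 * d" m f] \<open>0 < d\<close> by auto
    have FV: "F \<subseteq> verts G" using F WE sg by (auto simp: simple_graph_def)
    have finF: "finite F" using FV finite_verts[OF sg] finite_subset by blast
    have fpos: "0 < f" using small by (cases f) auto
    then have "F \<noteq> {}" by (auto simp: f_def)
    have Nmono: "N i \<subseteq> N k" if "i \<le> k" for i k
      unfolding N_def by (intro UN_mono gball_mono that order_refl)
    have finN: "finite (N i)" for i unfolding N_def by (intro finite_UN_I finF finite_gball sg)
    define U where "U = N j"
    have UV: "U \<subseteq> verts G" unfolding U_def N_def by (intro UN_least gball_subset_verts)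
    have FU: "F \<subseteq> U" unfolding U_def N_def using FV by (auto intro: center_in_gball)
    have nbr: "z \<in> N (Suc i)" if "y \<in> N i" "{y, z} \<in> edges G" for y z i
    proof -
      from that obtain v where "v \<in> F" "y \<in> gball G i v" by (auto simp: N_def)
      moreover from this have "z \<in> gball G (Suc i) v"
        using FV that gball_Suc[OF sg, of v i] by (auto simp: neighbors_def)
      ultimately show ?thesis by (auto simp: N_def)
    qed
    have "U \<noteq> {}" using FU \<open>F \<noteq> {}\<close> by blast
    define H where "H = induced G U"
    have HP: "H \<in> P"
      using P(2) G subgraph_induced[OF sg UV \<open>U \<noteq> {}\<close>] by (auto simp: monotone_property_def H_def)
    have HE: "edges H = {e \<in> edges G. e \<subseteq> U}" and HV: "verts H = U"
      by (simp_all add: H_def induced_def)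
    obtain W' where W': "W' \<subseteq> edges H" "real (card W') \<le> 1 / (8 * d * m) * card (edges H)"
      "\<forall>x\<in>U. card (component_of (with_edges H (edges H - W')) x) \<le> K"
      using hyp[OF HP] by (auto simp: hyperfinite_graph_def HV)
    have W'E: "W' \<subseteq> edges G" using W' HE by auto
    have "card (edges H) \<le> card {e \<in> edges G. e \<inter> U \<noteq> {}}"
    proof (rule card_mono)
      have "e \<noteq> {}" if "e \<in> edges G" for e using simple_graph_edgeE[OF sg that] by blast
      then show "edges H \<subseteq> {e \<in> edges G. e \<inter> U \<noteq> {}}" by (auto simp: HE)
    qed (use finE in auto)
    also have "\<dots> \<le> d * card U" using card_incident_edges[OF GG] finN by (simp add: U_def)
    also have "\<dots> \<le> d * (m * f)"
    proof (rule mult_le_mono2)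
      have "card U \<le> card (N (8 * d * m + 1))"
        unfolding U_def by (rule card_mono[OF finN Nmono]) (use j in simp)
      then show "card U \<le> m * f" using small by simp
    qed
    finally have "card (edges H) \<le> d * m * f" by (simp add: mult.assoc)
    then have "1 / (8 * d * m) * card (edges H) \<le> 1 / (8 * d * m) * real (d * m * f)"
      by (intro mult_left_mono of_nat_mono) auto
    also have "\<dots> = f / 8" using \<open>0 < d\<close> \<open>0 < m\<close> by (simp add: field_simps)
    \<comment> \<open>The hyperfiniteness parameter \<open>1 / (8 * d * m)\<close> is chosen to
      cancel the factor \<open>d * m\<close>, so recutting the inside costs at most
      \<open>f / 8\<close>.\<close>
    finally have cW': "8 * card W' \<le> f" using W'(2) by linarith
    define Bd where "Bd = {e \<in> edges G. e \<inter> U \<noteq> {} \<and> \<not> e \<subseteq> U}"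
    \<comment> \<open>Each boundary edge has an end in the new layer, so the boundary costs at most
      another \<open>f / 8\<close>.\<close>
    have "Bd \<subseteq> {e \<in> edges G. e \<inter> (N (Suc j) - N j) \<noteq> {}}"
    proof
      fix e assume e: "e \<in> Bd"
      then have eE: "e \<in> edges G" by (simp add: Bd_def)
      obtain y z where yz: "e = {y, z}" using simple_graph_edgeE[OF sg eE] by metis
      then consider "y \<in> U" "z \<notin> U" | "z \<in> U" "y \<notin> U" using e by (auto simp: Bd_def)
      then show "e \<in> {e \<in> edges G. e \<inter> (N (Suc j) - N j) \<noteq> {}}"
      proof cases
        case 1
        then show ?thesis using nbr[of y j z] eE yz by (auto simp: U_def)
      next
        case 2
        then show ?thesis using nbr[of z j y] eE yz by (auto simp: U_def insert_commute)
      qed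
    qed
    then have "card Bd \<le> card {e \<in> edges G. e \<inter> (N (Suc j) - N j) \<noteq> {}}"
      by (rule card_mono[rotated]) (use finE in auto)
    also have "\<dots> \<le> d * card (N (Suc j) - N j)" using card_incident_edges[OF GG] finN by simp
    also have "card (N (Suc j) - N j) = card (N (Suc j)) - card (N j)"
      by (rule card_Diff_subset[OF finN Nmono]) simp
    finally have cBd: "8 * card Bd \<le> f" using j(3) by (simp add: diff_mult_distrib2)
    define In where "In = {e \<in> W. e \<subseteq> U}"
    \<comment> \<open>Here \<open>1 \<le> j\<close> matters: a cut edge at a vertex of
      \<open>F\<close> ends within distance 1 and thus lies inside \<open>U\<close>. So the cut
      edges inside \<open>U\<close> cover \<open>F\<close>, and there are at least
      \<open>f / 2\<close> of them.\<close>
    have FIn: "F \<subseteq> \<Union>In"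
    proof
      fix v assume "v \<in> F"
      then obtain e where e: "e \<in> W" "v \<in> e" using F by blast
      then obtain z where z: "e = {v, z}"
        using simple_graph_edge_atE[OF sg] WE by blast
      have "v \<in> N 0" using FV \<open>v \<in> F\<close> by (auto simp: N_def intro: center_in_gball)
      then have "z \<in> N (Suc 0)" using nbr z e WE by blast
      then have "z \<in> U" using Nmono[of "Suc 0" j] j by (auto simp: U_def)
      then have "e \<in> In" using e z FU \<open>v \<in> F\<close> by (auto simp: In_def)
      then show "v \<in> \<Union>In" using e by blast
    qed
    have finIn: "finite In" and InE: "In \<subseteq> edges G"
      using finite_subset[OF WE finE] WE by (auto simp: In_def)
    have "\<Union>In \<subseteq> verts G" using InE sg by (auto simp: simple_graph_def)
    then have "finite (\<Union>In)" by (rule finite_subset) (rule finite_verts[OF sg])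
    then have "card F \<le> card (\<Union>In)" using FIn by (rule card_mono)
    then have cIn: "f \<le> 2 * card In"
      unfolding f_def using card_Union_edges[OF sg InE] by linarith
    \<comment> \<open>The exchange: at least \<open>f / 2\<close> edges leave the cut and at most
      \<open>f / 8 + f / 8\<close> enter. Components inside \<open>U\<close> are contained in those
      of the recut \<open>H\<close>, components outside \<open>U\<close> in those of the old
      cut.\<close>
    define Wn where "Wn = (W - In) \<union> Bd \<union> W'"
    have "bounded_cut K G Wn"
      unfolding bounded_cut_def
    proof (intro conjI ballI)
      show "Wn \<subseteq> edges G" using WE W'E by (auto simp: Wn_def Bd_def)
      fix x assume x: "x \<in> verts G"
      let ?G = "with_edges G (edges G - Wn)"
      show "card (component_of ?G x) \<le> K"
      proof (cases "x \<in> U")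
        case True
        have "component_of ?G x \<subseteq> component_of (with_edges H (edges H - W')) x"
          by (rule component_of_subset_if_closed[of x U])
            (use True in \<open>auto simp: HV HE Wn_def Bd_def\<close>)
        then have "card (component_of ?G x) \<le> card (component_of (with_edges H (edges H - W')) x)"
          by (rule card_mono[rotated])
            (use finite_subset[OF UV finite_verts[OF sg]] in \<open>auto simp: component_of_def HV\<close>)
        then show ?thesis using W'(3) True le_trans by blast
      next
        case False
        have "component_of ?G x \<subseteq> component_of (with_edges G (edges G - W)) x"
          by (rule component_of_subset_if_closed[of x "- U"])
            (use False in \<open>auto simp: Wn_def Bd_def In_def\<close>)
        then have "card (component_of ?G x) \<le> card (component_of (with_edges G (edges G - W)) x)"
          by (rule card_mono[rotated]) (use finite_verts[OF sg] in \<open>auto simp: component_of_def\<close>)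
        then show ?thesis using W x le_trans unfolding bounded_cut_def by blast
      qed
    qed
    then have "card W \<le> card Wn" by (rule least)
    also have "\<dots> \<le> card (W - In) + card Bd + card W'"
      unfolding Wn_def by (meson card_Un_le add_le_mono1 le_trans)
    also have "card (W - In) = card W - card In"
      by (rule card_Diff_subset[OF finIn]) (auto simp: In_def)
    finally have "card W \<le> card W - card In + card Bd + card W'" .
    moreover have "card In \<le> card W"
      by (rule card_mono) (use finite_subset[OF WE finE] in \<open>auto simp: In_def\<close>)
    ultimately show False using cIn cBd cW' fpos by linarith
  qed
  then show ?thesis using W by blast
qed

text \<open>Hall's theorem for \<open>m\<close> copies of each element of \<open>D\<close>. The
  representatives are distinct, so \<open>a\<close> can send each one back to the element it
  represents; this is the ownership map.\<close>

lemma hall_with_multiplicity: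
  assumes "finite D" "\<And>v. v \<in> D \<Longrightarrow> finite (A v)"
    and "\<And>F. F \<subseteq> D \<Longrightarrow> m * card F \<le> card (\<Union>v\<in>F. A v)"
  shows "\<exists>a. \<forall>v\<in>D. m \<le> card {y \<in> A v. a y = Some v}"
proof -
  have "\<exists>f. inj_on f (D \<times> {..<m}) \<and> (\<forall>i\<in>D \<times> {..<m}. f i \<in> A (fst i))"
  proof (rule hall_marriage)
    fix J assume J: "J \<subseteq> D \<times> {..<m}"
    then have "fst ` J \<subseteq> D" by auto
    then have "finite (fst ` J)" using assms(1) finite_subset by blast
    have "J \<subseteq> fst ` J \<times> {..<m}" using J by force
    then have "card J \<le> card (fst ` J \<times> {..<m})"
      by (rule card_mono[rotated]) (use \<open>finite (fst ` J)\<close> in auto)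
    also have "\<dots> = m * card (fst ` J)" by (simp add: card_cartesian_product)
    also have "\<dots> \<le> card (\<Union>v\<in>fst ` J. A v)" using assms(3)[OF \<open>fst ` J \<subseteq> D\<close>] .
    finally show "card J \<le> card (\<Union>i\<in>J. A (fst i))" by simp
  qed (use assms in auto)
  then obtain f where f: "inj_on f (D \<times> {..<m})" "\<forall>i\<in>D \<times> {..<m}. f i \<in> A (fst i)" by blast
  define a where "a y = (if y \<in> f ` (D \<times> {..<m})
    then Some (fst (inv_into (D \<times> {..<m}) f y)) else None)" for y
  have "m \<le> card {y \<in> A v. a y = Some v}" if v: "v \<in> D" for v
  proof -
    have sub: "(\<lambda>i. f (v, i)) ` {..<m} \<subseteq> {y \<in> A v. a y = Some v}"
    proof
      fix y assume "y \<in> (\<lambda>i. f (v, i)) ` {..<m}"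
      then obtain i where i: "i < m" "y = f (v, i)" by auto
      then have "inv_into (D \<times> {..<m}) f y = (v, i)" using f(1) v by simp
      then show "y \<in> {y \<in> A v. a y = Some v}" using f(2) i v by (force simp: a_def)
    qed
    have "inj_on (\<lambda>i. f (v, i)) {..<m}" using f(1) v by (auto simp: inj_on_def)
    then have "m = card ((\<lambda>i. f (v, i)) ` {..<m})" by (simp add: card_image)
    also have "\<dots> \<le> card {y \<in> A v. a y = Some v}"
      by (rule card_mono[OF _ sub]) (use assms(2)[OF v] in auto)
    finally show ?thesis .
  qed
  then show ?thesis by blast
qed

section \<open>Local labels\<close>

text \<open>A label consists of the colour of the vertex, the colours of its neighbours across uncut edges,
  and one plus the colour of the cut endpoint that owns the vertex, or zero if there is none.\<close>

definition label :: "nat \<Rightarrow> nat set \<Rightarrow> nat \<Rightarrow> nat" where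
  "label c N a = prod_encode (c, prod_encode (set_encode N, a))"

definition lcol :: "nat \<Rightarrow> nat" where
  "lcol t = fst (prod_decode t)"

definition lkeep :: "nat \<Rightarrow> nat set" where
  "lkeep t = set_decode (fst (prod_decode (snd (prod_decode t))))"

definition lown :: "nat \<Rightarrow> nat" where
  "lown t = snd (prod_decode (snd (prod_decode t)))"

lemma label_simps [simp]:
  "lcol (label c N a) = c" "finite N \<Longrightarrow> lkeep (label c N a) = N" "lown (label c N a) = a"
  by (simp_all add: label_def lcol_def lkeep_def lown_def)

text \<open>An edge survives only if its two ends list each other's colours. Contradictory labels
  thus count as a cut, and every labelling, honest or not, determines an edge set.\<close>

definition kept :: "'v ugraph \<Rightarrow> ('v \<Rightarrow> nat) \<Rightarrow> 'v set set" where
  "kept G T = {e \<in> edges G. \<forall>u\<in>e. \<forall>v\<in>e. u \<noteq> v \<longrightarrow> lcol (T u) \<in> lkeep (T v)}"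

definition kept_graph :: "'v ugraph \<Rightarrow> ('v \<Rightarrow> nat) \<Rightarrow> 'v ugraph" where
  "kept_graph G T = with_edges G (kept G T)"

text \<open>The local test. Injective colours make ownership by colour unambiguous, the bound by
  \<open>K\<close> makes the whole component visible, and the last clause asks an endpoint of a cut
  edge to exhibit its \<open>m\<close> vertices. The successor keeps 0 free for vertices without
  owner.\<close>

definition good_at :: "'v ugraph set \<Rightarrow> nat \<Rightarrow> nat \<Rightarrow> nat \<Rightarrow> 'v ugraph \<Rightarrow> ('v \<Rightarrow> nat) \<Rightarrow> 'v \<Rightarrow> bool" where
  "good_at P m \<rho> K G T x \<longleftrightarrow>
     inj_on (\<lambda>y. lcol (T y)) (gball G \<rho> x) \<and>
     component_of (kept_graph G T) x \<subseteq> gball G K x \<and>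
     induced (kept_graph G T) (component_of (kept_graph G T) x) \<in> P \<and>
     (x \<in> \<Union>(edges G - kept G T) \<longrightarrow> m \<le> card {y \<in> gball G \<rho> x. lown (T y) = Suc (lcol (T x))})"

lemma kept_iff:
  assumes "simple_graph G"
  shows "{u, v} \<in> kept G T \<longleftrightarrow>
    {u, v} \<in> edges G \<and> lcol (T u) \<in> lkeep (T v) \<and> lcol (T v) \<in> lkeep (T u)"
  using simple_graph_edgeD[OF assms, of u v] by (auto simp: kept_def)

lemma kept_subset: "kept G T \<subseteq> edges G"
  by (auto simp: kept_def)

lemma verts_kept_graph [simp]: "verts (kept_graph G T) = verts G"
  and edges_kept_graph [simp]: "edges (kept_graph G T) = kept G T"
  by (simp_all add: kept_graph_def)

lemma simple_graph_kept: "simple_graph G \<Longrightarrow> simple_graph (kept_graph G T)"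
  by (auto simp: simple_graph_def kept_def)

lemma self_in_component: "x \<in> verts G \<Longrightarrow> x \<in> component_of G x"
  by (simp add: component_of_def)

lemma component_step: "y \<in> component_of G x \<Longrightarrow> {y, z} \<in> edges G \<Longrightarrow> z \<in> verts G \<Longrightarrow> z \<in> component_of G x"
  by (auto simp: component_of_def adj_rel_def intro: rtrancl.rtrancl_into_rtrancl)

lemma component_of_induct [consumes 2, case_names base step]:
  assumes "y \<in> component_of G x" "simple_graph G" "P x"
    and step: "\<And>y z. y \<in> component_of G x \<Longrightarrow> P y \<Longrightarrow> {y, z} \<in> edges G \<Longrightarrow> z \<in> component_of G x \<Longrightarrow> P z"
  shows "P y"
proof -
  have "(x, y) \<in> (adj_rel G)\<^sup>*" using assms by (auto simp: component_of_def)
  then have "y \<in> verts G \<longrightarrow> P y \<and> (x, y) \<in> (adj_rel G)\<^sup>*"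
  proof (induction rule: rtrancl_induct)
    case base
    then show ?case using assms by auto
  next
    case (step y z)
    then have e: "{y, z} \<in> edges G" by (simp add: adj_rel_def)
    then have v: "y \<in> verts G" "z \<in> verts G" using simple_graph_edgeD[OF assms(2)] by blast+
    then have "P y" "y \<in> component_of G x" using step by (auto simp: component_of_def)
    moreover have "z \<in> component_of G x" using component_step[OF _ e] v calculation by blast
    ultimately show ?case using assms(4)[of y z] e by (auto simp: component_of_def)
  qed
  then show ?thesis using assms(1) by (auto simp: component_of_def)
qed

section \<open>Transfer of the local test along isomorphisms of labelled balls\<close>

locale nbhd_iso =
  fixes G H :: "'v ugraph" and T T' :: "'v \<Rightarrow> nat" and x x' :: 'v and r :: nat and f :: "'v \<Rightarrow> 'v"
  assumes sG: "simple_graph G" and sH: "simple_graph H"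
    and xG: "x \<in> verts G" and xH: "x' \<in> verts H"
    and iso: "graph_iso f (induced G (gball G r x)) (induced H (gball H r x'))"
    and root: "f x = x'"
    and lab: "\<And>y. y \<in> gball G r x \<Longrightarrow> T' (f y) = T y"
begin

abbreviation "S \<equiv> gball G r x"
abbreviation "S' \<equiv> gball H r x'"

lemma bij: "bij_betw f S S'"
  using iso by (simp add: graph_iso_def induced_def)

lemma inj: "inj_on f S"
  using bij by (simp add: bij_betw_def)

lemma edge_iff:
  assumes "u \<in> S" "v \<in> S"
  shows "{f u, f v} \<in> edges H \<longleftrightarrow> {u, v} \<in> edges G"
proof -
  have eq: "{e \<in> edges H. e \<subseteq> S'} = (\<lambda>e. f ` e) ` {e \<in> edges G. e \<subseteq> S}"
    using iso by (simp add: graph_iso_def induced_def)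
  have fS: "f u \<in> S'" "f v \<in> S'" using assms bij by (auto simp: bij_betw_def)
  show ?thesis
  proof
    assume "{f u, f v} \<in> edges H"
    then have "{f u, f v} \<in> (\<lambda>e. f ` e) ` {e \<in> edges G. e \<subseteq> S}" using eq fS by blast
    then obtain e where e: "e \<in> edges G" "e \<subseteq> S" "f ` e = f ` {u, v}" by auto
    then have "e = {u, v}" using inj_on_image_eq_iff[OF inj, of e "{u, v}"] assms by auto
    then show "{u, v} \<in> edges G" using e by simp
  next
    assume "{u, v} \<in> edges G"
    then have "f ` {u, v} \<in> (\<lambda>e. f ` e) ` {e \<in> edges G. e \<subseteq> S}"
      using assms by (intro imageI) simp
    then show "{f u, f v} \<in> edges H" unfolding eq[symmetric] by simp
  qed
qed

lemma kept_edge_iff: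
  assumes "u \<in> S" "v \<in> S"
  shows "{f u, f v} \<in> kept H T' \<longleftrightarrow> {u, v} \<in> kept G T"
  unfolding kept_iff[OF sG] kept_iff[OF sH] using edge_iff[OF assms] lab assms by auto

text \<open>Passing to an induced subgraph may change distances, but a ball of radius
  \<open>r\<close> contains all neighbours of its vertices at distance below \<open>r\<close>, so
  distances from the root up to \<open>r\<close> can be read off the ball.\<close>

lemma image_gball: "j \<le> r \<Longrightarrow> f ` gball G j x = gball H j x'"
proof (induction j)
  case 0
  then show ?case using xG xH root by (simp add: gball_0)
next
  case (Suc j)
  then have IH: "f ` gball G j x = gball H j x'" by simp
  have sub: "gball G (Suc j) x \<subseteq> S" "gball H (Suc j) x' \<subseteq> S'"
    using Suc.prems by (auto intro: gball_mono[THEN subsetD])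
  have "f ` neighbors G z = neighbors H (f z)" if z: "z \<in> gball G j x" for z
  proof -
    have zS: "z \<in> S" using z Suc.prems gball_mono[of j r G x] by auto
    have nS: "neighbors G z \<subseteq> S" using sub z unfolding gball_Suc[OF sG xG] by blast
    have "f z \<in> gball H j x'" using IH z by blast
    then have nS': "neighbors H (f z) \<subseteq> S'" using sub unfolding gball_Suc[OF sH xH] by blast
    show ?thesis
    proof (intro equalityI subsetI)
      fix w assume "w \<in> f ` neighbors G z"
      then show "w \<in> neighbors H (f z)"
        using edge_iff[OF zS] nS by (auto simp: neighbors_def)
    next
      fix w assume w: "w \<in> neighbors H (f z)"
      then obtain u where u: "u \<in> S" "w = f u" using nS' bij by (auto simp: bij_betw_def)
      then show "w \<in> f ` neighbors G z" using edge_iff[OF zS u(1)] w by (auto simp: neighbors_def)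
    qed
  qed
  then show ?case
    unfolding gball_Suc[OF sG xG] gball_Suc[OF sH xH] image_Un image_UN IH[symmetric] by simp
qed

text \<open>Only the component in \<open>G\<close> is known to be small; that the one in
  \<open>H\<close> stays in the visible region has to be derived. Its vertices are pulled back one
  edge at a time: from distance at most \<open>K\<close> an edge leads to distance at most
  \<open>Suc K\<close>, which is still visible because \<open>K < r\<close>.\<close>

lemma image_component:
  assumes C: "component_of (kept_graph G T) x \<subseteq> gball G K x" and "K < r"
  shows "f ` component_of (kept_graph G T) x = component_of (kept_graph H T') x'"
proof (intro equalityI subsetI)
  let ?C = "component_of (kept_graph G T) x" and ?C' = "component_of (kept_graph H T') x'"
  have KS: "gball G K x \<subseteq> S" using \<open>K < r\<close> by (intro gball_mono) simp
  {
    fix w assume "w \<in> f ` ?C"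
    then obtain y where y: "y \<in> ?C" "w = f y" by blast
    from y(1) simple_graph_kept[OF sG] have "f y \<in> ?C'"
    proof (induction rule: component_of_induct)
      case base
      then show ?case using root xH by (simp add: self_in_component)
    next
      case (step y z)
      have yz: "y \<in> S" "z \<in> S" using step C KS by blast+
      then have e: "{f y, f z} \<in> kept H T'" using kept_edge_iff step by simp
      then have "f z \<in> verts H" using simple_graph_edgeD[OF simple_graph_kept[OF sH]] by fastforce
      then show ?case using component_step[OF step.IH] e by simp
    qed
    then show "w \<in> ?C'" using y by simp
  next
    fix w assume "w \<in> ?C'"
    from this simple_graph_kept[OF sH] show "w \<in> f ` ?C"
    proof (induction rule: component_of_induct)
      case base
      then show ?case using root xG by (auto simp: self_in_component)
    next
      case (step y' z')
      then obtain y where y: "y \<in> ?C" "y' = f y" by blast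
      have yK: "y \<in> gball G K x" using y C by blast
      have "f y \<in> gball H K x'" using image_gball[of K] yK \<open>K < r\<close> by auto
      moreover have "z' \<in> neighbors H (f y)"
        using step.hyps(2) y kept_subset[of H T'] by (auto simp: neighbors_def)
      ultimately have "z' \<in> gball H (Suc K) x'" unfolding gball_Suc[OF sH xH] by blast
      then have "z' \<in> f ` gball G (Suc K) x" using image_gball[of "Suc K"] \<open>K < r\<close> by simp
      then obtain z where z: "z \<in> gball G (Suc K) x" "z' = f z" by blast
      have "z \<in> S" using z gball_mono[of "Suc K" r G x] \<open>K < r\<close> by auto
      then have e: "{y, z} \<in> kept G T" using kept_edge_iff[of y z] step.hyps(2) y z yK KS by auto
      then have "z \<in> verts G" using simple_graph_edgeD[OF simple_graph_kept[OF sG]] by fastforce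
      then have "z \<in> ?C" using component_step[OF y(1)] e by simp
      then show ?case using z by blast
    qed
  }
qed

lemma good_at_transfer:
  assumes good: "good_at P m \<rho> K G T x" and "\<rho> \<le> r" "K < r" "graph_property d P"
  shows "good_at P m \<rho> K H T' x'"
proof -
  let ?C = "component_of (kept_graph G T) x" and ?C' = "component_of (kept_graph H T') x'"
  have g: "inj_on (\<lambda>y. lcol (T y)) (gball G \<rho> x)" "?C \<subseteq> gball G K x"
    "induced (kept_graph G T) ?C \<in> P"
    "x \<in> \<Union>(edges G - kept G T) \<Longrightarrow> m \<le> card {y \<in> gball G \<rho> x. lown (T y) = Suc (lcol (T x))}"
    using good unfolding good_at_def by auto
  have im: "f ` gball G \<rho> x = gball H \<rho> x'" using image_gball \<open>\<rho> \<le> r\<close> by blast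
  have \<rho>S: "gball G \<rho> x \<subseteq> S" using \<open>\<rho> \<le> r\<close> by (rule gball_mono)
  have KS: "gball G K x \<subseteq> S" using \<open>K < r\<close> by (intro gball_mono) simp
  have xS: "x \<in> S" using xG by (rule center_in_gball)
  have Tx: "T' x' = T x" using lab[OF xS] root by simp
  have C': "f ` ?C = ?C'" using image_component[OF g(2) \<open>K < r\<close>] .
  have "inj_on (\<lambda>y. lcol (T' y)) (gball H \<rho> x')"
    unfolding im[symmetric]
  proof (rule inj_onI)
    fix u' v' assume "u' \<in> f ` gball G \<rho> x" "v' \<in> f ` gball G \<rho> x" "lcol (T' u') = lcol (T' v')"
    moreover from this obtain u v where uv: "u \<in> gball G \<rho> x" "v \<in> gball G \<rho> x" "u' = f u" "v' = f v"
      by blast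
    ultimately have "lcol (T u) = lcol (T v)" using lab \<rho>S by (metis subsetD)
    then show "u' = v'" using inj_onD[OF g(1)] uv by blast
  qed
  moreover have "?C' \<subseteq> gball H K x'"
    using g(2) C' image_gball[of K] \<open>K < r\<close> by (metis image_mono less_imp_le_nat)
  \<comment> \<open>Properties are invariant under isomorphism, and \<open>f\<close> restricted to
    the component is an isomorphism of the kept subgraphs.\<close>
  moreover have "induced (kept_graph H T') ?C' \<in> P"
  proof -
    have CS: "?C \<subseteq> S" using g(2) KS by blast
    have bijC: "bij_betw f ?C ?C'"
      using C' inj_on_subset[OF inj CS] by (simp add: bij_betw_def)
    have "{e \<in> kept H T'. e \<subseteq> ?C'} = (\<lambda>e. f ` e) ` {e \<in> kept G T. e \<subseteq> ?C}"
    proof (intro equalityI subsetI)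
      fix e assume e: "e \<in> {e \<in> kept H T'. e \<subseteq> ?C'}"
      then have "e \<in> edges (kept_graph H T')" by simp
      then obtain u' v' where uv: "e = {u', v'}"
        by (rule simple_graph_edgeE[OF simple_graph_kept[OF sH]])
      then obtain u v where "u \<in> ?C" "v \<in> ?C" "u' = f u" "v' = f v"
        using e unfolding C'[symmetric] by auto
      moreover from this have "{u, v} \<in> kept G T" using kept_edge_iff[of u v] e uv CS by auto
      ultimately show "e \<in> (\<lambda>e. f ` e) ` {e \<in> kept G T. e \<subseteq> ?C}"
        using uv by (intro image_eqI[of _ _ "{u, v}"]) auto
    next
      fix e' assume "e' \<in> (\<lambda>e. f ` e) ` {e \<in> kept G T. e \<subseteq> ?C}"
      then obtain e where e: "e' = f ` e" "e \<in> kept G T" "e \<subseteq> ?C" by blast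
      then have "e \<in> edges (kept_graph G T)" by simp
      then obtain u v where uv: "e = {u, v}"
        by (rule simple_graph_edgeE[OF simple_graph_kept[OF sG]])
      then have "u \<in> S" "v \<in> S" using e CS by auto
      then show "e' \<in> {e \<in> kept H T'. e \<subseteq> ?C'}"
        using kept_edge_iff[of u v] e uv unfolding C'[symmetric] by auto
    qed
    then have "graph_iso f (induced (kept_graph G T) ?C) (induced (kept_graph H T') ?C')"
      using bijC by (simp add: graph_iso_def induced_def)
    moreover have "simple_graph (induced (kept_graph H T') ?C')"
      by (rule simple_graph_induced[OF simple_graph_kept[OF sH]])
        (use self_in_component[of x' "kept_graph H T'"] xH in \<open>auto simp: component_of_def\<close>)
    ultimately show ?thesis using g(3) assms(4) unfolding graph_property_def by (elim conjE) blast
  qed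
  \<comment> \<open>Whether \<open>x'\<close> meets a cut edge is itself visible: the other end is
    at distance 1, within radius \<open>r\<close>.\<close>
  moreover have "m \<le> card {y \<in> gball H \<rho> x'. lown (T' y) = Suc (lcol (T' x'))}"
    if cut: "x' \<in> \<Union>(edges H - kept H T')"
  proof -
    from cut obtain e where e: "e \<in> edges H" "e \<notin> kept H T'" "x' \<in> e" by blast
    obtain z' where z': "e = {x', z'}" by (rule simple_graph_edge_atE[OF sH e(1,3)])
    have "z' \<in> gball H (Suc 0) x'"
      using e z' gball_Suc[OF sH xH, of 0] xH by (auto simp: gball_0 neighbors_def)
    then have "z' \<in> S'" using gball_mono[of "Suc 0" r H x'] \<open>K < r\<close> by auto
    then obtain z where z: "z \<in> S" "z' = f z" using bij by (auto simp: bij_betw_def)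
    then have "{x, z} \<in> edges G - kept G T"
      using edge_iff[OF xS z(1)] kept_edge_iff[OF xS z(1)] e z' root by auto
    then have "m \<le> card {y \<in> gball G \<rho> x. lown (T y) = Suc (lcol (T x))}" by (intro g(4)) blast
    also have "\<dots> = card (f ` {y \<in> gball G \<rho> x. lown (T y) = Suc (lcol (T x))})"
      by (rule card_image[symmetric], rule inj_on_subset[OF inj]) (use \<rho>S in auto)
    also have "f ` {y \<in> gball G \<rho> x. lown (T y) = Suc (lcol (T x))} =
      {y \<in> gball H \<rho> x'. lown (T' y) = Suc (lcol (T' x'))}"
      unfolding im[symmetric] Tx using lab[OF subsetD[OF \<rho>S]] by (auto intro: imageI)
    finally show ?thesis .
  qed
  ultimately show ?thesis unfolding good_at_def by blast
qed

end

section \<open>Verification of hyperfinite properties\<close>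

lemma subgraph_in_Gr:
  assumes "subgraph H G" "G \<in> Gr d"
  shows "H \<in> Gr d"
proof -
  have "vdegree H v \<le> d" if "v \<in> verts H" for v
  proof -
    have "vdegree H v \<le> vdegree G v"
      unfolding vdegree_def
      by (rule card_mono) (use assms finite_edges[OF GrD(1)[OF assms(2)]] in \<open>auto simp: subgraph_def\<close>)
    then show ?thesis using GrD(2)[OF assms(2), of v] that assms(1) by (auto simp: subgraph_def)
  qed
  then show ?thesis using assms by (auto simp: Gr_def subgraph_def)
qed

section \<open>Neighbourhoods as rooted balls and their classes\<close>

lemma nbhd_eq: "nbhd r x G T = (induced G (gball G r x), x, restrict T (gball G r x))"
  unfolding nbhd_def gball_def Let_def by (rule refl)

text \<open>Shortest paths from the centre stay inside the ball. Hence the subgraph induced on it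
  again has radius at most \<open>r\<close>, as \<open>concrete_balls\<close> demands.\<close>

lemma gball_subset_gball_induced:
  assumes "simple_graph G" "x \<in> verts G" "j \<le> r"
  shows "gball G j x \<subseteq> gball (induced G (gball G r x)) j x"
  using \<open>j \<le> r\<close>
proof (induction j)
  case 0
  then show ?case using assms center_in_gball[OF assms(2), of r]
    by (simp add: gball_0 center_in_gball induced_def)
next
  case (Suc j)
  let ?B = "induced G (gball G r x)"
  have xB: "x \<in> verts ?B" using center_in_gball[OF assms(2)] by (simp add: induced_def)
  have sB: "simple_graph ?B"
    by (rule simple_graph_induced[OF assms(1) gball_subset_verts])
      (use center_in_gball[OF assms(2), of r] in auto)
  have IH: "gball G j x \<subseteq> gball ?B j x" using Suc by simp
  show ?case
  proof
    fix y assume y: "y \<in> gball G (Suc j) x"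
    then have yr: "y \<in> gball G r x" using gball_mono[OF Suc.prems, of G x] by blast
    from y consider "y \<in> gball G j x" | z where "z \<in> gball G j x" "{z, y} \<in> edges G"
      unfolding gball_Suc[OF assms(1,2)] by (auto simp: neighbors_def)
    then show "y \<in> gball ?B (Suc j) x"
    proof cases
      case 1
      then show ?thesis using IH gball_mono[of j "Suc j" ?B x] by auto
    next
      case 2
      then have "z \<in> gball G r x" using gball_mono[of j r G x] Suc.prems by auto
      then have "y \<in> neighbors ?B z" using 2 yr by (simp add: neighbors_def induced_def)
      then show ?thesis unfolding gball_Suc[OF sB xB] using 2 IH by blast
    qed
  qed
qed

lemma nbhd_in_concrete_balls:
  assumes "G \<in> Gr d" "x \<in> verts G" "T \<in> verts G \<rightarrow> Q"
  shows "nbhd r x G T \<in> concrete_balls Q r d"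
proof -
  have sg: "simple_graph G" using GrD assms by blast
  let ?S = "gball G r x"
  have "induced G ?S \<in> Gr d"
    by (rule subgraph_in_Gr[OF subgraph_induced[OF sg gball_subset_verts] assms(1)])
      (use center_in_gball[OF assms(2), of r] in auto)
  moreover have "gdist (induced G ?S) x y \<le> enat r" if "y \<in> ?S" for y
    using gball_subset_gball_induced[OF sg assms(2) order_refl] that by (auto simp: gball_def)
  ultimately show ?thesis
    using center_in_gball[OF assms(2), of r] assms(3) gball_subset_verts[of G r x]
    by (auto simp: nbhd_eq concrete_balls_def induced_def)
qed

lemma ball_iso_refl: "b \<in> concrete_balls Q r d \<Longrightarrow> (b, b) \<in> ball_iso Q r d"
proof -
  obtain B x T where b: "b = (B, x, T)" by (metis prod_cases3)
  assume "b \<in> concrete_balls Q r d"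
  moreover have "graph_iso id B B \<and> id x = x \<and> (\<forall>y\<in>verts B. T (id y) = T y)"
    by (simp add: graph_iso_def)
  ultimately show ?thesis unfolding b ball_iso_def by blast
qed

text \<open>Reflexivity puts the neighbourhood in \<open>H\<close> into its own class, hence into
  the class of the one in \<open>G\<close>, and membership there is exactly an isomorphism. On the
  balls the restricted labellings agree with \<open>T\<close> and \<open>T'\<close>.\<close>

lemma nbhd_class_eqE:
  assumes "nbhd_class Q r d x' H T' = nbhd_class Q r d x G T"
    and "H \<in> Gr d" "x' \<in> verts H" "T' \<in> verts H \<rightarrow> Q" "G \<in> Gr d" "x \<in> verts G"
  obtains f where "nbhd_iso G H T T' x x' r f"
proof -
  have "nbhd r x' H T' \<in> nbhd_class Q r d x' H T'"
    using ball_iso_refl[OF nbhd_in_concrete_balls[OF assms(2-4)]] by (simp add: nbhd_class_def)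
  then have "(nbhd r x G T, nbhd r x' H T') \<in> ball_iso Q r d"
    unfolding assms(1) by (simp add: nbhd_class_def)
  then obtain f where f: "graph_iso f (induced G (gball G r x)) (induced H (gball H r x'))" "f x = x'"
    "\<forall>y\<in>gball G r x. restrict T' (gball H r x') (f y) = restrict T (gball G r x) y"
    by (auto simp: ball_iso_def nbhd_eq induced_def)
  have "f y \<in> gball H r x'" if "y \<in> gball G r x" for y
    using f(1) that by (auto simp: graph_iso_def induced_def bij_betw_def)
  then have "nbhd_iso G H T T' x x' r f"
    using f assms GrD by unfold_locales auto
  then show ?thesis by (rule that)
qed

section \<open>Soundness: local tests certify closeness to the property\<close>

lemma component_of_eq:
  assumes "y \<in> component_of G x"
  shows "component_of G y = component_of G x"
proof -
  have "sym ((adj_rel G)\<^sup>*)" by (intro sym_rtrancl symI) (simp add: adj_rel_sym)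
  then have "(y, x) \<in> (adj_rel G)\<^sup>*" "(x, y) \<in> (adj_rel G)\<^sup>*"
    using assms by (auto simp: component_of_def dest: symD)
  then show ?thesis by (auto simp: component_of_def intro: rtrancl_trans)
qed

text \<open>Components are joined one by one by the binary closure. The induction runs over nonempty
  sets of representatives, since nothing puts the empty graph into \<open>P\<close>; a
  representative whose component is already present adds nothing.\<close>

lemma disjoint_union_closed_components:
  assumes P: "closed_under_disjoint_unions P" and sg: "simple_graph G"
    and comps: "\<And>x. x \<in> verts G \<Longrightarrow> induced G (component_of G x) \<in> P"
  shows "G \<in> P"
proof -
  have "induced G (\<Union>x\<in>X. component_of G x) \<in> P" if "finite X" "X \<noteq> {}" "X \<subseteq> verts G" for X
    using that
  proof (induction X rule: finite_ne_induct)
    case (singleton x)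
    then show ?case using comps by simp
  next
    case (insert x X)
    let ?U = "\<Union>x\<in>X. component_of G x"
    have IH: "induced G ?U \<in> P" using insert by blast
    show ?case
    proof (cases "component_of G x \<inter> ?U = {}")
      case True
      have "{e \<in> edges G. e \<subseteq> component_of G x \<union> ?U} =
        {e \<in> edges G. e \<subseteq> component_of G x} \<union> {e \<in> edges G. e \<subseteq> ?U}"
      proof (intro equalityI subsetI)
        fix e assume e: "e \<in> {e \<in> edges G. e \<subseteq> component_of G x \<union> ?U}"
        then have "e \<in> edges G" by blast
        then obtain u v where uv: "e = {u, v}" "u \<in> verts G" "v \<in> verts G"
          by (rule simple_graph_edgeE[OF sg])
        have same: "u \<in> component_of G y \<longleftrightarrow> v \<in> component_of G y" for y
          using component_step[of u G y v] component_step[of v G y u] uv e by (auto simp: insert_commute)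
        have "e \<subseteq> component_of G x \<or> e \<subseteq> ?U" using e uv same by auto
        then show "e \<in> {e \<in> edges G. e \<subseteq> component_of G x} \<union> {e \<in> edges G. e \<subseteq> ?U}"
          using e by blast
      qed auto
      then have "induced G (\<Union>x\<in>insert x X. component_of G x) =
        graph_union (induced G (component_of G x)) (induced G ?U)"
        by (simp add: induced_def graph_union_def)
      moreover have "induced G (component_of G x) \<in> P" using comps insert by simp
      moreover have "verts (induced G (component_of G x)) \<inter> verts (induced G ?U) = {}"
        using True by (simp add: induced_def)
      ultimately show ?thesis
        using P IH unfolding closed_under_disjoint_unions_def by metis
    next
      case False
      then obtain y z where "y \<in> X" "z \<in> component_of G x" "z \<in> component_of G y" by blast
      then have "component_of G x = component_of G y" using component_of_eq by metis
      then have "(\<Union>x\<in>insert x X. component_of G x) = ?U" using \<open>y \<in> X\<close> by blast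
      then show ?thesis using IH by simp
    qed
  qed
  from this[of "verts G"] have "induced G (\<Union>x\<in>verts G. component_of G x) \<in> P"
    using sg by (simp add: simple_graph_def)
  moreover have "(\<Union>x\<in>verts G. component_of G x) = verts G"
    using self_in_component by (fastforce simp: component_of_def)
  moreover have "induced G (verts G) = G"
  proof -
    have "{e \<in> edges G. e \<subseteq> verts G} = edges G" using sg by (auto simp: simple_graph_def)
    then show ?thesis by (simp add: induced_def)
  qed
  ultimately show ?thesis by simp
qed

text \<open>For the count, injectivity is applied around the owned vertex: if \<open>y\<close> were
  owned by both \<open>v\<close> and \<open>w\<close>, both would lie in the ball around
  \<open>y\<close> and carry the colour stored at \<open>y\<close>, so they coincide. The owned sets
  are therefore disjoint, and their sizes add up to at most the number of vertices.\<close>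

lemma good_everywhere_sound:
  assumes P: "closed_under_disjoint_unions P" and H: "simple_graph H"
    and good: "\<And>x. x \<in> verts H \<Longrightarrow> good_at P m \<rho> K H T x"
  shows "kept_graph H T \<in> P" "m * card (\<Union>(edges H - kept H T)) \<le> card (verts H)"
proof -
  show "kept_graph H T \<in> P"
    by (rule disjoint_union_closed_components[OF P simple_graph_kept[OF H]])
      (use good in \<open>auto simp: good_at_def\<close>)
  let ?D = "\<Union>(edges H - kept H T)"
  let ?A = "\<lambda>v. {y \<in> gball H \<rho> v. lown (T y) = Suc (lcol (T v))}"
  have DV: "?D \<subseteq> verts H" using H by (auto simp: simple_graph_def)
  have finD: "finite ?D" using DV finite_verts[OF H] by (rule finite_subset)
  have "m * card ?D = (\<Sum>v\<in>?D. m)" by simp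
  also have "\<dots> \<le> (\<Sum>v\<in>?D. card (?A v))"
  proof (rule sum_mono)
    fix v assume v: "v \<in> ?D"
    then have "good_at P m \<rho> K H T v" using DV good by blast
    then show "m \<le> card (?A v)" using v unfolding good_at_def by blast
  qed
  also have "\<dots> = card (\<Union>v\<in>?D. ?A v)"
  proof (rule card_UN_disjoint[symmetric])
    show "\<forall>v\<in>?D. finite (?A v)" using finite_gball[OF H] by simp
    show "\<forall>v\<in>?D. \<forall>w\<in>?D. v \<noteq> w \<longrightarrow> ?A v \<inter> ?A w = {}"
    proof (intro ballI impI, rule ccontr)
      fix v w assume vw: "v \<in> ?D" "w \<in> ?D" "v \<noteq> w" "?A v \<inter> ?A w \<noteq> {}"
      then obtain y where y: "y \<in> gball H \<rho> v" "y \<in> gball H \<rho> w"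
        "lown (T y) = Suc (lcol (T v))" "lown (T y) = Suc (lcol (T w))" by blast
      then have "y \<in> verts H" using gball_subset_verts[of H \<rho> v] by blast
      then have "inj_on (\<lambda>y. lcol (T y)) (gball H \<rho> y)" using good by (simp add: good_at_def)
      moreover have "v \<in> gball H \<rho> y" "w \<in> gball H \<rho> y"
        using y vw(1,2) DV by (auto intro: gball_sym)
      moreover have "lcol (T v) = lcol (T w)" using y by simp
      ultimately show False using vw(3) by (auto dest: inj_onD)
    qed
  qed (rule finD)
  also have "\<dots> \<le> card (verts H)"
    by (rule card_mono[OF finite_verts[OF H]]) (auto intro: subsetD[OF gball_subset_verts])
  finally show "m * card ?D \<le> card (verts H)" .
qed

section \<open>Completeness: honest labels pass the local tests\<close>

lemma component_subset_gball:
  assumes sg: "simple_graph G" and x: "x \<in> verts G" and card: "card (component_of G x) \<le> K"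
  shows "component_of G x \<subseteq> gball G K x"
proof -
  have sub: "gball G j x \<subseteq> component_of G x" for j
    by (auto simp: mem_gball_iff component_of_def intro: relpow_imp_rtrancl)
  have fin: "finite (component_of G x)" using finite_verts[OF sg] by (simp add: component_of_def)
  \<comment> \<open>A ball starts with one vertex and gains at least one per radius until it is
    stationary; if it still grew after radius \<open>K\<close>, it would have more than
    \<open>K\<close> vertices of the component.\<close>
  have "\<exists>j\<le>K. gball G (Suc j) x = gball G j x"
  proof (rule ccontr)
    assume no: "\<not> ?thesis"
    have "j \<le> Suc K \<Longrightarrow> j < card (gball G j x)" for j
    proof (induction j)
      case 0
      then show ?case using x by (simp add: gball_0)
    next
      case (Suc j)
      have "gball G j x \<subset> gball G (Suc j) x"
        using no Suc.prems gball_mono[of j "Suc j" G x] by auto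
      then have "card (gball G j x) < card (gball G (Suc j) x)"
        by (intro psubset_card_mono finite_gball sg)
      then show ?case using Suc by simp
    qed
    from this[of K] have "K < card (gball G K x)" by simp
    also have "\<dots> \<le> card (component_of G x)" by (rule card_mono[OF fin sub])
    finally show False using card by simp
  qed
  then obtain j where j: "j \<le> K" "gball G (Suc j) x = gball G j x" by blast
  have "y \<in> gball G j x" if "y \<in> component_of G x" for y
    using that sg
  proof (induction rule: component_of_induct)
    case base
    then show ?case using x by (rule center_in_gball)
  next
    case (step y z)
    then have "z \<in> gball G (Suc j) x"
      unfolding gball_Suc[OF sg x] by (auto simp: neighbors_def)
    then show ?case using j by simp
  qed
  then show ?thesis using gball_mono[OF j(1), of G x] by blast
qed

lemma gball_with_edges_subset:
  assumes "E \<subseteq> edges G"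
  shows "gball (with_edges G E) n x \<subseteq> gball G n x"
proof -
  have "adj_rel (with_edges G E) \<subseteq> adj_rel G" using assms by (auto simp: adj_rel_def)
  then have "adj_rel (with_edges G E) ^^ k \<subseteq> adj_rel G ^^ k" for k
    by (induction k) (auto simp: relcomp_mono)
  note mono = this
  show ?thesis
  proof
    fix y assume "y \<in> gball (with_edges G E) n x"
    then obtain k where "y \<in> verts G" "k \<le> n" "(x, y) \<in> adj_rel (with_edges G E) ^^ k"
      by (auto simp: mem_gball_iff)
    then show "y \<in> gball G n x" unfolding mem_gball_iff using mono[of k] by blast
  qed
qed

text \<open>Vertices in conflict share a ball of radius \<open>\<rho>\<close>, so all conflicts of a
  vertex lie within \<open>2 * \<rho>\<close>; this gives the number \<open>c\<close> of colours.
  Monotonicity puts the components left by \<open>W\<close> into \<open>P\<close>.\<close>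

lemma good_labelling_exists:
  assumes P: "P \<subseteq> Gr d" "monotone_property P" and G: "G \<in> P"
    and W: "bounded_cut K G W" and "0 < \<rho>"
    and own: "\<And>v. v \<in> \<Union>W \<Longrightarrow> m \<le> card {y \<in> gball G \<rho> v. a y = Some v}"
    and c: "c = Suc ((d + 1) ^ (2 * \<rho>))"
  shows "\<exists>T \<in> verts G \<rightarrow> (\<lambda>(i, N, j). label i N j) ` ({..<c} \<times> Pow {..<c} \<times> {..c}).
    \<forall>x\<in>verts G. good_at P m \<rho> K G T x"
proof -
  have GG: "G \<in> Gr d" and sg: "simple_graph G" using P G GrD by auto
  define R where "R u v \<longleftrightarrow> (\<exists>x\<in>verts G. u \<in> gball G \<rho> x \<and> v \<in> gball G \<rho> x)" for u v
  have "\<exists>col. (\<forall>v\<in>verts G. col v < c) \<and> (\<forall>u\<in>verts G. \<forall>v\<in>verts G. u \<noteq> v \<longrightarrow> R u v \<longrightarrow> col u \<noteq> col v)"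
  proof (rule greedy_colouring)
    fix v assume v: "v \<in> verts G"
    have "{u \<in> verts G. R v u} \<subseteq> gball G (2 * \<rho>) v"
      using gball_trans[of _ G \<rho> v _ \<rho>] gball_sym[of v G \<rho>] v by (auto simp: R_def mult_2)
    then have "card {u \<in> verts G. R v u} \<le> card (gball G (2 * \<rho>) v)"
      by (rule card_mono[OF finite_gball[OF sg]])
    also have "\<dots> < c" using card_gball[OF GG v] unfolding c by (rule le_imp_less_Suc)
    finally show "card {u \<in> verts G. R v u} < c" .
  qed (use finite_verts[OF sg] in \<open>auto simp: R_def\<close>)
  then obtain col where col: "\<forall>v\<in>verts G. col v < c"
    "\<forall>u\<in>verts G. \<forall>v\<in>verts G. u \<noteq> v \<longrightarrow> R u v \<longrightarrow> col u \<noteq> col v" by (elim exE conjE)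
  have inj: "inj_on col (gball G \<rho> x)" if "x \<in> verts G" for x
  proof (rule inj_onI)
    fix u v assume uv: "u \<in> gball G \<rho> x" "v \<in> gball G \<rho> x" "col u = col v"
    then have "R u v" "u \<in> verts G" "v \<in> verts G"
      using that gball_subset_verts[of G \<rho> x] by (auto simp: R_def)
    then show "u = v" using col(2) uv(3) by blast
  qed
  have WE: "W \<subseteq> edges G" using W by (simp add: bounded_cut_def)
  define G' where "G' = with_edges G (edges G - W)"
  have sG': "simple_graph G'" using sg by (auto simp: G'_def simple_graph_def)
  \<comment> \<open>The ownership map may return a value that is no vertex; sending it to 0 keeps
    \<open>owner\<close> at most \<open>c\<close>, so labels stay in the finite set.\<close>
  define owner where
    "owner v = (case a v of None \<Rightarrow> 0 | Some u \<Rightarrow> if u \<in> verts G then Suc (col u) else 0)" for v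
  define T where "T v = label (col v) (col ` neighbors G' v) (owner v)" for v
  have nb: "finite (neighbors G' v)" "neighbors G' v \<subseteq> verts G" for v
    using finite_neighbors[OF sG'] neighbors_subset_verts[OF sG', of v] by (auto simp: G'_def)
  have T [simp]: "lcol (T v) = col v" "lkeep (T v) = col ` neighbors G' v" "lown (T v) = owner v" for v
    using nb by (simp_all add: T_def)
  have "T \<in> verts G \<rightarrow> (\<lambda>(i, N, j). label i N j) ` ({..<c} \<times> Pow {..<c} \<times> {..c})"
  proof
    fix v assume v: "v \<in> verts G"
    have "owner v \<le> c" using col(1) by (auto simp: owner_def Suc_le_eq split: option.split)
    moreover have "col ` neighbors G' v \<subseteq> {..<c}" using nb col(1) by auto
    ultimately show "T v \<in> (\<lambda>(i, N, j). label i N j) ` ({..<c} \<times> Pow {..<c} \<times> {..c})"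
      unfolding T_def using col(1) v
      by (intro image_eqI[of _ _ "(col v, col ` neighbors G' v, owner v)"]) auto
  qed
  moreover have "good_at P m \<rho> K G T x" if x: "x \<in> verts G" for x
  proof -
    have nbr_ball: "neighbors G v \<subseteq> gball G \<rho> v" if "v \<in> verts G" for v
    proof -
      have "neighbors G v \<subseteq> gball G (Suc 0) v"
        unfolding gball_Suc[OF sg that] using that by (auto simp: gball_0)
      also have "\<dots> \<subseteq> gball G \<rho> v" using \<open>0 < \<rho>\<close> by (intro gball_mono) simp
      finally show ?thesis .
    qed
    \<comment> \<open>The list at \<open>v\<close> records only colours, so a cut edge
      \<open>{u, v}\<close> could pass for a kept one if some kept neighbour \<open>u'\<close> of
      \<open>v\<close> had the colour of \<open>u\<close>. Both lie in the ball around
      \<open>v\<close>, as \<open>0 < \<rho>\<close>, and colours are distinct there.\<close>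
    have key: "col u \<in> col ` neighbors G' v \<longleftrightarrow> {u, v} \<notin> W" if uv: "{u, v} \<in> edges G" for u v
    proof
      assume "col u \<in> col ` neighbors G' v"
      then obtain u' where u': "u' \<in> neighbors G' v" "col u = col u'" by blast
      have v: "v \<in> verts G" using simple_graph_edgeD[OF sg uv] by blast
      have "u \<in> gball G \<rho> v" "u' \<in> gball G \<rho> v"
        using nbr_ball[OF v] u' uv by (auto simp: neighbors_def G'_def insert_commute)
      then have "u = u'" using inj_onD[OF inj[OF v] u'(2)] by blast
      then show "{u, v} \<notin> W" using u' by (auto simp: neighbors_def G'_def insert_commute)
    next
      assume "{u, v} \<notin> W"
      then show "col u \<in> col ` neighbors G' v"
        using uv by (intro imageI) (simp add: neighbors_def G'_def insert_commute)
    qed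
    have kept: "kept G T = edges G - W"
    proof (intro equalityI subsetI)
      fix e assume e: "e \<in> kept G T"
      then have "e \<in> edges G" using kept_subset by blast
      then obtain u v where uv: "e = {u, v}" by (rule simple_graph_edgeE[OF sg])
      then show "e \<in> edges G - W" using e key[of u v] kept_iff[OF sg, of u v T] by auto
    next
      fix e assume e: "e \<in> edges G - W"
      then have "e \<in> edges G" by blast
      then obtain u v where uv: "e = {u, v}" by (rule simple_graph_edgeE[OF sg])
      then show "e \<in> kept G T"
        using e key[of u v] key[of v u] kept_iff[OF sg, of u v T] by (auto simp: insert_commute)
    qed
    have kg: "kept_graph G T = G'" by (simp add: kept_graph_def kept G'_def)
    have x': "x \<in> verts G'" using x by (simp add: G'_def)
    have "card (component_of G' x) \<le> K" using W x by (simp add: bounded_cut_def G'_def)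
    then have "component_of G' x \<subseteq> gball G' K x" by (rule component_subset_gball[OF sG' x'])
    also have "\<dots> \<subseteq> gball G K x" unfolding G'_def by (rule gball_with_edges_subset) auto
    finally have ball: "component_of G' x \<subseteq> gball G K x" .
    have "subgraph (induced G' (component_of G' x)) G"
      using subgraph_induced[OF sG', of "component_of G' x"] self_in_component[OF x']
      by (auto simp: subgraph_def G'_def component_of_def)
    then have inP: "induced G' (component_of G' x) \<in> P"
      using P(2) G by (auto simp: monotone_property_def)
    have cut: "m \<le> card {y \<in> gball G \<rho> x. lown (T y) = Suc (lcol (T x))}" if "x \<in> \<Union>(edges G - kept G T)"
    proof -
      have "x \<in> \<Union>W" using that kept by blast
      then have "m \<le> card {y \<in> gball G \<rho> x. a y = Some x}" by (rule own)
      also have "\<dots> \<le> card {y \<in> gball G \<rho> x. lown (T y) = Suc (lcol (T x))}"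
        by (rule card_mono) (use x finite_gball[OF sg] in \<open>auto simp: owner_def\<close>)
      finally show ?thesis .
    qed
    show ?thesis
      unfolding good_at_def kg using inj[OF x] ball inP cut by simp
  qed
  ultimately show ?thesis by blast
qed

theorem hyperfinite_approx_verifiable:
  fixes P :: "'v ugraph set"
  assumes "0 < d" "graph_property d P" "monotone_property P" "hyperfinite P"
    "closed_under_disjoint_unions P"
  shows "approx_verifiable d P"
  unfolding approx_verifiable_def
proof (intro allI impI)
  fix \<epsilon> :: real assume "0 < \<epsilon>"
  have P: "P \<subseteq> Gr d" using assms(2) by (simp add: graph_property_def)
  \<comment> \<open>With at most \<open>card (verts H) / m\<close> endpoints and at most
    \<open>d\<close> edges at each, the number of cut edges is at most
    \<open>\<epsilon> * card (verts H)\<close>.\<close>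
  define m where "m = nat \<lceil>d / \<epsilon>\<rceil> + 1"
  have m: "0 < m" "d / \<epsilon> \<le> m" by (simp_all add: m_def) linarith
  obtain K where K: "\<And>G. G \<in> P \<Longrightarrow> hyperfinite_graph (1 / (8 * real d * real m)) K G"
  proof -
    have "(0::real) < 1 / (8 * d * m)" using \<open>0 < d\<close> m by simp
    then obtain K where "\<forall>G\<in>P. hyperfinite_graph (1 / (8 * d * m)) K G"
      using assms(4) unfolding hyperfinite_def by blast
    then show ?thesis by (intro that[of K]) simp
  qed
  define \<rho> where "\<rho> = 8 * d * m + 1"
  \<comment> \<open>Sees the ownership ball of radius \<open>\<rho>\<close> and at least one step
    beyond radius \<open>K\<close>, as the transfer requires.\<close>
  define r where "r = Suc (\<rho> + K)"
  define c where "c = Suc ((d + 1) ^ (2 * \<rho>))"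
  define Q where "Q = (\<lambda>(i, N, j). label i N j) ` ({..<c} \<times> Pow {..<c} \<times> {..c})"
  \<comment> \<open>The accepted classes are those with some good representative. Honest labellings
    then pass at once, and all work goes into soundness, where goodness is carried over from the
    representative to the actual vertex.\<close>
  define \<V> where "\<V> = {nbhd_class Q r d x G T | x G T.
    G \<in> Gr d \<and> x \<in> verts G \<and> T \<in> verts G \<rightarrow> Q \<and> good_at P m \<rho> K G T x}"
  have "finite Q" by (simp add: Q_def)
  moreover have "0 < r" by (simp add: r_def)
  moreover have "\<V> \<subseteq> ball_classes Q r d"
    using nbhd_in_concrete_balls
    by (fastforce simp: \<V>_def ball_classes_def nbhd_class_def intro: quotientI)
  moreover have "\<exists>T \<in> verts G \<rightarrow> Q. accepts Q r d \<V> G T" if G: "G \<in> P" for G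
  proof -
    have sg: "simple_graph G" using P G GrD by auto
    obtain W where W: "bounded_cut K G W"
      "\<And>F. F \<subseteq> \<Union>W \<Longrightarrow> m * card F \<le> card (\<Union>v\<in>F. gball G \<rho> v)"
      using minimum_cut_expands[OF P assms(3) G \<open>0 < d\<close> m(1) K] unfolding \<rho>_def by auto
    have "\<Union>W \<subseteq> verts G" using W(1) sg by (auto simp: bounded_cut_def simple_graph_def)
    then have "finite (\<Union>W)" using finite_verts[OF sg] by (rule finite_subset)
    then obtain a where a: "\<forall>v\<in>\<Union>W. m \<le> card {y \<in> gball G \<rho> v. a y = Some v}"
      using hall_with_multiplicity[of "\<Union>W" "gball G \<rho>" m] finite_gball[OF sg] W(2) by metis
    have "\<exists>T \<in> verts G \<rightarrow> Q. \<forall>x\<in>verts G. good_at P m \<rho> K G T x"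
      unfolding Q_def
      by (rule good_labelling_exists[OF P assms(3) G W(1) _ _ c_def]) (use a in \<open>auto simp: \<rho>_def\<close>)
    then obtain T where T: "T \<in> verts G \<rightarrow> Q" "\<forall>x\<in>verts G. good_at P m \<rho> K G T x" by (elim bexE)
    have "accepts Q r d \<V> G T" unfolding accepts_def \<V>_def using T P G by blast
    then show ?thesis using T by blast
  qed
  moreover have "\<not> accepts Q r d \<V> H T"
    if H: "H \<in> Gr d" "edit_dist H P > ereal \<epsilon>" "T \<in> verts H \<rightarrow> Q" for H T
  proof
    assume acc: "accepts Q r d \<V> H T"
    have sH: "simple_graph H" using GrD H by blast
    have good: "good_at P m \<rho> K H T x" if x: "x \<in> verts H" for x
    proof -
      have "nbhd_class Q r d x H T \<in> \<V>" using acc x by (simp add: accepts_def)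
      then obtain x0 G T0 where G: "nbhd_class Q r d x H T = nbhd_class Q r d x0 G T0"
        "G \<in> Gr d" "x0 \<in> verts G" "good_at P m \<rho> K G T0 x0"
        unfolding \<V>_def by blast
      obtain f where "nbhd_iso G H T0 T x0 x r f"
        using nbhd_class_eqE[OF G(1) H(1) x H(3) G(2,3)] .
      then show ?thesis
        by (rule nbhd_iso.good_at_transfer[OF _ G(4) _ _ assms(2)]) (simp_all add: r_def)
    qed
    have kP: "kept_graph H T \<in> P"
      and cnt: "m * card (\<Union>(edges H - kept H T)) \<le> card (verts H)"
      using good_everywhere_sound[OF assms(5) sH good] by blast+
    let ?D = "\<Union>(edges H - kept H T)" and ?n = "card (verts H)"
    have npos: "0 < ?n" using sH by (simp add: simple_graph_def card_gt_0_iff)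
    have "?D \<subseteq> verts H" using sH by (auto simp: simple_graph_def)
    then have finD: "finite ?D" using finite_verts[OF sH] by (rule finite_subset)
    have "edges H - kept H T \<subseteq> {e \<in> edges H. e \<inter> ?D \<noteq> {}}"
    proof
      fix e assume e: "e \<in> edges H - kept H T"
      then have "e \<in> edges H" by blast
      then have "e \<noteq> {}" by (rule simple_graph_edgeE[OF sH]) blast
      then show "e \<in> {e \<in> edges H. e \<inter> ?D \<noteq> {}}" using e by blast
    qed
    then have "card (edges H - kept H T) \<le> card {e \<in> edges H. e \<inter> ?D \<noteq> {}}"
      by (rule card_mono[rotated]) (use finite_edges[OF sH] in simp)
    also have "\<dots> \<le> d * card ?D" by (rule card_incident_edges[OF H(1) finD])
    finally have "m * card (edges H - kept H T) \<le> m * (d * card ?D)" by (rule mult_le_mono2)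
    also have "\<dots> = d * (m * card ?D)" by simp
    also have "\<dots> \<le> d * ?n" by (rule mult_le_mono2[OF cnt])
    finally have "real (m * card (edges H - kept H T)) \<le> real (d * ?n)" by (rule of_nat_mono)
    moreover have "real d \<le> \<epsilon> * m" using m(2) \<open>0 < \<epsilon>\<close> by (simp add: field_simps)
    then have "real (d * ?n) \<le> \<epsilon> * m * ?n" by (simp add: mult_right_mono)
    ultimately have "real m * card (edges H - kept H T) \<le> real m * (\<epsilon> * ?n)"
      by (simp add: mult_ac)
    then have le: "real (card (edges H - kept H T)) / ?n \<le> \<epsilon>"
      using m(1) npos by (simp add: field_simps)
    have sd: "sym_diff (edges (kept_graph H T)) (edges H) = edges H - kept H T"
      using kept_subset[of H T] by auto
    \<comment> \<open>Dropping the edges that are not kept gives a member of \<open>P\<close> on the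
      same vertices, hence a competitor in the infimum.\<close>
    have "edit_dist H P \<le> ereal (real (card (sym_diff (edges (kept_graph H T)) (edges H))) / ?n)"
      unfolding edit_dist_def by (rule INF_lower) (use kP in simp)
    also have "\<dots> \<le> ereal \<epsilon>" unfolding sd using le by simp
    finally show False using H(2) by simp
  qed
  ultimately show "\<exists>(Q :: nat set) r \<V>. finite Q \<and> 0 < r \<and> \<V> \<subseteq> ball_classes Q r d \<and>
     (\<forall>G\<in>P. \<exists>T \<in> verts G \<rightarrow> Q. accepts Q r d \<V> G T) \<and>
     (\<forall>H\<in>Gr d. edit_dist H P > ereal \<epsilon> \<longrightarrow> (\<forall>T \<in> verts H \<rightarrow> Q. \<not> accepts Q r d \<V> H T))"
    by (intro exI[of _ Q] exI[of _ r] exI[of _ \<V>] conjI ballI impI) simp_all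
qed

section \<open>Theta curves in the plane\<close>

text \<open>If a point z saw all three arcs of a theta curve, take a point in the face of the cycle
  formed by the first two arcs that does not contain the third: Janiszewski's theorem separates it from
  z by one of the other two cycles, although both points see the same remaining arc.\<close>

lemma theta_curve_no_common_face:
  fixes c0 c1 c2 :: "real \<Rightarrow> complex"
  assumes arcs: "arc c0" "arc c1" "arc c2"
    and ends: "pathstart c0 = a" "pathstart c1 = a" "pathstart c2 = a"
      "pathfinish c0 = b" "pathfinish c1 = b" "pathfinish c2 = b"
    and int: "path_image c0 \<inter> path_image c1 = {a, b}" "path_image c0 \<inter> path_image c2 = {a, b}"
      "path_image c1 \<inter> path_image c2 = {a, b}"
    and q: "q0 \<in> path_image c0 - {a, b}" "q1 \<in> path_image c1 - {a, b}" "q2 \<in> path_image c2 - {a, b}"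
    and see: "connected_component (- (path_image c1 \<union> path_image c2)) z q0"
      "connected_component (- (path_image c0 \<union> path_image c2)) z q1"
      "connected_component (- (path_image c0 \<union> path_image c1)) z q2"
  shows False
proof -
  define I0 I1 I2 where I: "I0 = path_image c0" "I1 = path_image c1" "I2 = path_image c2"
  define J0 J1 J2 where J: "J0 = I1 \<union> I2" "J1 = I0 \<union> I2" "J2 = I0 \<union> I1"
  have see': "connected_component (- J0) z q0" "connected_component (- J1) z q1"
    "connected_component (- J2) z q2"
    using see by (simp_all add: J I)
  have compI: "compact I0" "compact I1" "compact I2" "connected I2"
    using arcs by (auto simp: I compact_arc_image connected_arc_image)
  have int': "I0 \<inter> I1 = {a, b}" "I0 \<inter> I2 = {a, b}" "I1 \<inter> I2 = {a, b}"
    using int by (simp_all add: I)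
  have q': "q0 \<in> I0 - {a, b}" "q1 \<in> I1 - {a, b}" "q2 \<in> I2 - {a, b}"
    using q by (simp_all add: I)
  define g where "g = c0 +++ reversepath c1"
  have gim: "path_image g = J2"
    unfolding g_def J I using ends by (subst path_image_join) auto
  have "simple_path g"
    unfolding g_def
    by (rule simple_path_join_loop) (use arcs ends int in \<open>auto simp: arc_reversepath\<close>)
  moreover have "pathfinish g = pathstart g" using ends by (simp add: g_def)
  ultimately obtain inner outer where io: "inner \<noteq> {}" "connected inner" "outer \<noteq> {}" "connected outer"
     "inner \<inter> outer = {}" "inner \<union> outer = - J2" "frontier inner = J2" "frontier outer = J2"
    "open inner" "open outer"
    using Jordan_curve[of g] unfolding gim by metis
  \<comment> \<open>\<open>V\<close> is the face of the cycle \<open>J2\<close> without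
    \<open>z\<close>, and \<open>V'\<close> is the other face; the argument is the same for both
    ways of naming them.\<close>
  have side: False if V: "V \<noteq> {}" "connected V" "V \<inter> V' = {}" "V \<union> V' = - J2" "frontier V = J2"
    "z \<notin> V" "connected V'" "open V" "open V'" for V V'
  proof -
    obtain w where w: "w \<in> V" using V by blast
    obtain C where C: "connected C" "C \<subseteq> - J2" "z \<in> C" "q2 \<in> C"
      using see'(3) by (auto simp: connected_component_def)
    have "C \<inter> V = {}"
      using connectedD[OF C(1) V(8,9)] C V by blast
    \<comment> \<open>The third arc without its ends is connected, avoids \<open>J2\<close>, and
      contains \<open>q2\<close>, which \<open>z\<close> reaches without meeting \<open>J2\<close>.
      So it lies on the side of \<open>z\<close>, and \<open>V\<close> misses it.\<close>
    have "I2 - {a, b} \<subseteq> V'"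
    proof -
      have conn: "connected (I2 - {a, b})"
        using connected_simple_path_endless[of c2] arcs ends by (simp add: I arc_imp_simple_path)
      have "I2 - {a, b} \<subseteq> - J2" using int' by (auto simp: J)
      then have "V \<inter> (I2 - {a, b}) = {}"
        using connectedD[OF conn V(8,9)] V C \<open>C \<inter> V = {}\<close> q' by blast
      then show ?thesis using \<open>I2 - {a, b} \<subseteq> - J2\<close> V by blast
    qed
    moreover have "a \<in> J2" "b \<in> J2" using int' by (auto simp: J)
    ultimately have "V \<inter> I2 = {}" using V by blast
    have nw: "\<not> connected_component (- J2) w z"
    proof
      assume "connected_component (- J2) w z"
      then obtain D where D: "connected D" "D \<subseteq> - J2" "w \<in> D" "z \<in> D"
        by (auto simp: connected_component_def)
      then show False using connectedD[OF D(1) V(8,9)] V w by blast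
    qed
    \<comment> \<open>Points of the cycle are frontier points of \<open>V\<close>, so adding one
      keeps the set connected: \<open>w\<close> reaches \<open>q0\<close> without meeting
      \<open>J0\<close>, just as \<open>z\<close> does.\<close>
    have w0: "connected_component (- J0) w (q0)"
    proof -
      have "q0 \<in> closure V" using V(5) q' by (auto simp: J frontier_def)
      then have "connected (insert (q0) V)"
        using connected_intermediate_closure[OF V(2)] closure_subset by blast
      moreover have "insert (q0) V \<subseteq> - J0"
        using \<open>V \<inter> I2 = {}\<close> V(4) q' int' by (auto simp: J)
      ultimately show ?thesis using w unfolding connected_component_def by blast
    qed
    have w1: "connected_component (- J1) w (q1)"
    proof -
      have "q1 \<in> closure V" using V(5) q' by (auto simp: J frontier_def)
      then have "connected (insert (q1) V)"
        using connected_intermediate_closure[OF V(2)] closure_subset by blast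
      moreover have "insert (q1) V \<subseteq> - J1"
        using \<open>V \<inter> I2 = {}\<close> V(4) q' int' by (auto simp: J)
      ultimately show ?thesis using w unfolding connected_component_def by blast
    qed
    \<comment> \<open>\<open>J0\<close> and \<open>J1\<close> meet in the connected arc
      \<open>I2\<close> and neither separates \<open>w\<close> from \<open>z\<close>, so their union
      does not either. But the union contains \<open>J2\<close>, which does by
      \<open>nw\<close>.\<close>
    have "connected_component (- (J0 \<union> J1)) w z"
    proof (rule Janiszewski)
      show "compact (J0)" using compI by (auto simp: J)
      have "J0 \<inter> J1 = I2" using int' by (auto simp: J)
      then show "connected (J0 \<inter> J1)" using compI by simp
      show "connected_component (- J0) w z"
        using w0 see'(1) connected_component_sym connected_component_trans by blast
      show "connected_component (- J1) w z"
        using w1 see'(2) connected_component_sym connected_component_trans by blast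
    qed (use compI in \<open>auto simp: J compact_imp_closed\<close>)
    then have "connected_component (- J2) w z"
      by (rule connected_component_of_subset) (auto simp: J)
    then show False using nw by simp
  qed
  show False
  proof (cases "z \<in> inner")
    case True
    then show ?thesis using side[of outer inner] io by blast
  next
    case False
    then show ?thesis using side[of inner outer] io by blast
  qed
qed

section \<open>Clique minors of planar graphs\<close>

definition conn_in :: "'v ugraph \<Rightarrow> 'v set \<Rightarrow> bool" where
  "conn_in G C \<longleftrightarrow> C \<noteq> {} \<and> C \<subseteq> verts G \<and> (\<forall>x\<in>C. \<forall>y\<in>C. (x, y) \<in> (adj_rel G \<inter> C \<times> C)\<^sup>*)"

definition adjacent_sets :: "'v ugraph \<Rightarrow> 'v set \<Rightarrow> 'v set \<Rightarrow> bool" where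
  "adjacent_sets G A B \<longleftrightarrow> (\<exists>a\<in>A. \<exists>b\<in>B. {a, b} \<in> edges G)"

text \<open>The branch sets of a complete minor on \<open>card M\<close> vertices.\<close>

definition clique_model :: "'v ugraph \<Rightarrow> 'v set set \<Rightarrow> bool" where
  "clique_model G M \<longleftrightarrow> finite M \<and> (\<forall>A\<in>M. conn_in G A) \<and>
     (\<forall>A\<in>M. \<forall>B\<in>M. A \<noteq> B \<longrightarrow> A \<inter> B = {} \<and> adjacent_sets G A B)"

lemma adjacent_sets_sym: "adjacent_sets G A B \<Longrightarrow> adjacent_sets G B A"
  unfolding adjacent_sets_def by (metis insert_commute)

lemma conn_in_Un:
  assumes A: "conn_in G A" and B: "conn_in G B" and adj: "adjacent_sets G A B"
  shows "conn_in G (A \<union> B)"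
proof -
  let ?R = "(adj_rel G \<inter> (A \<union> B) \<times> (A \<union> B))\<^sup>*"
  have RA: "(x, y) \<in> ?R" if "x \<in> A" "y \<in> A" for x y
  proof -
    have "(x, y) \<in> (adj_rel G \<inter> A \<times> A)\<^sup>*" using A that by (simp add: conn_in_def)
    then show ?thesis by (rule rtrancl_mono[THEN subsetD, rotated]) auto
  qed
  have RB: "(x, y) \<in> ?R" if "x \<in> B" "y \<in> B" for x y
  proof -
    have "(x, y) \<in> (adj_rel G \<inter> B \<times> B)\<^sup>*" using B that by (simp add: conn_in_def)
    then show ?thesis by (rule rtrancl_mono[THEN subsetD, rotated]) auto
  qed
  obtain a b where ab: "a \<in> A" "b \<in> B" "{a, b} \<in> edges G" using adj by (auto simp: adjacent_sets_def)
  have Rab: "(a, b) \<in> ?R" "(b, a) \<in> ?R"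
    using ab by (auto simp: adj_rel_def insert_commute intro!: r_into_rtrancl)
  have Ra: "(a, y) \<in> ?R" "(y, a) \<in> ?R" if "y \<in> A \<union> B" for y
    using that RA[of a y] RA[of y a] RB[of b y] RB[of y b] ab Rab
    by (auto intro: rtrancl_trans)
  have "(x, y) \<in> ?R" if "x \<in> A \<union> B" "y \<in> A \<union> B" for x y
    using Ra(2)[OF that(1)] Ra(1)[OF that(2)] by (rule rtrancl_trans)
  then show ?thesis using A B unfolding conn_in_def by blast
qed

section \<open>Paths inside connected sets\<close>

abbreviation walk :: "'v ugraph \<Rightarrow> 'v list \<Rightarrow> bool" where
  "walk G \<equiv> successively (\<lambda>x y. {x, y} \<in> edges G)"

lemma walk_rev: "walk G (rev xs) \<longleftrightarrow> walk G xs"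
  by (simp add: insert_commute)

lemma conn_in_path:
  assumes "conn_in G C" "x \<in> C" "y \<in> C"
  obtains xs where "xs \<noteq> []" "hd xs = x" "last xs = y" "distinct xs" "set xs \<subseteq> C" "walk G xs"
proof -
  have "(x, y) \<in> (adj_rel G \<inter> C \<times> C)\<^sup>*" using assms by (simp add: conn_in_def)
  then have "\<exists>xs. xs \<noteq> [] \<and> hd xs = x \<and> last xs = y \<and> distinct xs \<and> set xs \<subseteq> C \<and> walk G xs"
  proof (induction rule: rtrancl_induct)
    case base
    then show ?case using assms(2) by (intro exI[of _ "[x]"]) auto
  next
    case (step y z)
    then obtain xs where xs: "xs \<noteq> []" "hd xs = x" "last xs = y" "distinct xs" "set xs \<subseteq> C" "walk G xs"
      by blast
    have yz: "{y, z} \<in> edges G" "z \<in> C" using step by (auto simp: adj_rel_def)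
    \<comment> \<open>A step back onto the path truncates it at the repeated vertex, which keeps the
      list distinct.\<close>
    show ?case
    proof (cases "z \<in> set xs")
      case True
      then obtain as bs where "xs = as @ z # bs" by (meson split_list)
      then have "hd (as @ [z]) = x" "distinct (as @ [z])" "set (as @ [z]) \<subseteq> C" "walk G (as @ [z])"
        using xs by (auto simp: hd_append successively_append_iff split: if_splits)
      then show ?thesis by (intro exI[of _ "as @ [z]"]) auto
    next
      case False
      then show ?thesis
        using xs yz by (intro exI[of _ "xs @ [z]"]) (auto simp: successively_append_iff)
    qed
  qed
  then show ?thesis using that by blast
qed

text \<open>Follow a path from \<open>u2\<close> towards \<open>u0\<close> until it first meets a
  path from \<open>u0\<close> to \<open>u1\<close>; the meeting vertex is the centre
  \<open>c\<close> and splits the other path into two legs. A leg may consist of \<open>c\<close>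
  alone.\<close>

lemma conn_in_tripod:
  assumes C: "conn_in G C" and "u0 \<in> C" "u1 \<in> C" "u2 \<in> C"
  obtains c l0 l1 l2 where
    "\<And>l. l \<in> {l0, l1, l2} \<Longrightarrow> l \<noteq> [] \<and> hd l = c \<and> distinct l \<and> set l \<subseteq> C \<and> walk G l"
    "last l0 = u0" "last l1 = u1" "last l2 = u2"
    "set l0 \<inter> set l1 = {c}" "set l0 \<inter> set l2 = {c}" "set l1 \<inter> set l2 = {c}"
proof -
  obtain xs where xs: "xs \<noteq> []" "hd xs = u0" "last xs = u1" "distinct xs" "set xs \<subseteq> C" "walk G xs"
    using conn_in_path[OF C assms(2,3)] .
  obtain ys where ys: "ys \<noteq> []" "hd ys = u2" "last ys = u0" "distinct ys" "set ys \<subseteq> C" "walk G ys"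
    using conn_in_path[OF C assms(4,2)] .
  have "\<exists>y\<in>set ys. y \<in> set xs" using xs(1,2) ys(1,3) by (metis hd_in_set last_in_set)
  then obtain as c bs where c: "ys = as @ c # bs" "c \<in> set xs" "\<forall>y\<in>set as. y \<notin> set xs"
    using split_list_first_prop[of ys "\<lambda>y. y \<in> set xs"] by blast
  obtain ps qs where pq: "xs = ps @ c # qs" using c(2) by (meson split_list)
  let ?l0 = "rev (ps @ [c])" and ?l1 = "c # qs" and ?l2 = "rev (as @ [c])"
  show ?thesis
  proof (rule that[of ?l0 ?l1 ?l2 c])
    fix l assume "l \<in> {?l0, ?l1, ?l2}"
    then consider "l = ?l0" | "l = ?l1" | "l = ?l2" by blast
    then show "l \<noteq> [] \<and> hd l = c \<and> distinct l \<and> set l \<subseteq> C \<and> walk G l"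
    proof cases
      case 1
      have "walk G (ps @ [c])" using xs(6) unfolding pq by (auto simp: successively_append_iff)
      then show ?thesis using 1 xs(4,5) walk_rev[of G "ps @ [c]"] unfolding pq by auto
    next
      case 2
      have "walk G (c # qs)" using xs(6) unfolding pq by (auto simp: successively_append_iff)
      then show ?thesis using 2 xs(4,5) unfolding pq by auto
    next
      case 3
      have "walk G (as @ [c])" using ys(6) unfolding c(1) by (auto simp: successively_append_iff)
      then show ?thesis using 3 ys(4,5) walk_rev[of G "as @ [c]"] unfolding c(1) by auto
    qed
  next
    show "last ?l0 = u0" using xs(2) unfolding pq by (cases ps) auto
    show "last ?l1 = u1" using xs(3) unfolding pq by auto
    show "last ?l2 = u2" using ys(2) unfolding c(1) by (cases as) auto
    show "set ?l0 \<inter> set ?l1 = {c}" using xs(4) unfolding pq by auto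
    show "set ?l0 \<inter> set ?l2 = {c}" using c(3) unfolding pq by auto
    show "set ?l1 \<inter> set ?l2 = {c}" using c(3) unfolding pq by auto
  qed
qed

fun path_edges :: "'v list \<Rightarrow> 'v set set" where
  "path_edges (x # y # xs) = insert {x, y} (path_edges (y # xs))"
| "path_edges _ = {}"

lemma path_edges_subset: "walk G xs \<Longrightarrow> path_edges xs \<subseteq> edges G"
  by (induction xs rule: path_edges.induct) auto

lemma path_edges_verts: "e \<in> path_edges xs \<Longrightarrow> e \<subseteq> set xs"
  by (induction xs rule: path_edges.induct) auto

lemma in_path_edge: "v \<in> set xs \<Longrightarrow> 2 \<le> length xs \<Longrightarrow> \<exists>e\<in>path_edges xs. v \<in> e"
proof (induction xs rule: path_edges.induct)
  case (1 x y xs)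
  then show ?case by (cases xs) auto
qed auto

text \<open>Ensures that two paths of the theta, which share only their ends, have no common edge:
  such an edge would have to join these ends.\<close>

lemma ends_not_path_edge:
  assumes "distinct xs" "3 \<le> length xs"
  shows "{hd xs, last xs} \<notin> path_edges xs"
proof -
  obtain x y z zs where xs: "xs = x # y # z # zs"
    using assms(2) by (metis One_nat_def Suc_le_length_iff numeral_3_eq_3)
  have "last (z # zs) \<in> set (z # zs)" by (rule last_in_set) simp
  then have "{x, last (z # zs)} \<noteq> {x, y}" using assms(1) unfolding xs by (auto simp: doubleton_eq_iff)
  moreover have "{x, last (z # zs)} \<notin> path_edges (y # z # zs)"
    using path_edges_verts[of "{x, last (z # zs)}" "y # z # zs"] assms(1) unfolding xs by auto
  ultimately show ?thesis unfolding xs by simp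
qed

text \<open>One arc of the theta: a leg \<open>l\<close> in one branch set, a path \<open>b\<close>
  through a second, and a leg \<open>l'\<close> in a third, traversed backwards. Three nonempty
  pieces guarantee an interior vertex.\<close>

lemma join_paths:
  assumes "l \<noteq> []" "b \<noteq> []" "l' \<noteq> []" "walk G l" "walk G b" "walk G l'"
    and "distinct l" "distinct b" "distinct l'"
    and "set l \<inter> set b = {}" "set l \<inter> set l' = {}" "set b \<inter> set l' = {}"
    and "{last l, hd b} \<in> edges G" "{last b, last l'} \<in> edges G"
  shows "walk G (l @ b @ rev l') \<and> distinct (l @ b @ rev l') \<and> 3 \<le> length (l @ b @ rev l') \<and>
    hd (l @ b @ rev l') = hd l \<and> last (l @ b @ rev l') = hd l'"
proof (intro conjI)
  show "walk G (l @ b @ rev l')"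
    using assms walk_rev[of G l'] by (auto simp: successively_append_iff hd_rev)
  show "distinct (l @ b @ rev l')" using assms by auto
  show "3 \<le> length (l @ b @ rev l')"
    using assms(1-3) by (cases l; cases b; cases l') auto
qed (use assms in \<open>auto simp: last_rev\<close>)

section \<open>Plane drawings of connected sets and paths\<close>

locale drawing =
  fixes G :: "'v ugraph" and p :: "'v \<Rightarrow> complex" and \<gamma> :: "'v set \<Rightarrow> real \<Rightarrow> complex"
  assumes simple: "simple_graph G"
    and inj: "inj_on p (verts G)"
    and edge_arc: "e \<in> edges G \<Longrightarrow> arc (\<gamma> e)"
    and edge_ends: "e \<in> edges G \<Longrightarrow> {pathstart (\<gamma> e), pathfinish (\<gamma> e)} = p ` e"
    and edge_vertex: "e \<in> edges G \<Longrightarrow> v \<in> verts G \<Longrightarrow> p v \<in> path_image (\<gamma> e) \<Longrightarrow> v \<in> e"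
    and edge_cross: "e \<in> edges G \<Longrightarrow> e' \<in> edges G \<Longrightarrow> e \<noteq> e' \<Longrightarrow>
      path_image (\<gamma> e) \<inter> path_image (\<gamma> e') \<subseteq> p ` (e \<inter> e')"
begin

definition drawn :: "'v set \<Rightarrow> complex set" where
  "drawn C = p ` C \<union> (\<Union>e\<in>{e \<in> edges G. e \<subseteq> C}. path_image (\<gamma> e))"

lemma ends_in_image: "e \<in> edges G \<Longrightarrow> p ` e \<subseteq> path_image (\<gamma> e)"
  by (simp flip: edge_ends add: pathstart_in_path_image pathfinish_in_path_image)

text \<open>Drawn edges meet vertices and each other only in common ends, and vertex-disjoint sets
  have none.\<close>

lemma drawn_disjoint:
  assumes "C \<subseteq> verts G" "C' \<subseteq> verts G" "C \<inter> C' = {}"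
  shows "drawn C \<inter> drawn C' = {}"
proof -
  have 1: "p ` C \<inter> p ` C' = {}"
    using inj_on_image_Int[OF inj assms(1,2)] assms(3) by simp
  have 2: "p ` C \<inter> path_image (\<gamma> e) = {}" if "e \<in> edges G" "e \<subseteq> C'" for e
    using edge_vertex[OF that(1)] that assms by blast
  have 3: "p ` C' \<inter> path_image (\<gamma> e) = {}" if "e \<in> edges G" "e \<subseteq> C" for e
    using edge_vertex[OF that(1)] that assms by blast
  have 4: "path_image (\<gamma> e) \<inter> path_image (\<gamma> e') = {}"
    if E: "e \<in> edges G" "e \<subseteq> C" "e' \<in> edges G" "e' \<subseteq> C'" for e e'
  proof -
    have "e \<inter> e' = {}" using that assms by blast
    moreover obtain u v where "e = {u, v}" by (rule simple_graph_edgeE[OF simple E(1)])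
    ultimately show ?thesis using edge_cross[OF that(1,3)] by auto
  qed
  show ?thesis
  proof (rule equals0I)
    fix q assume "q \<in> drawn C \<inter> drawn C'"
    then have "q \<in> p ` C \<or> (\<exists>e. e \<in> edges G \<and> e \<subseteq> C \<and> q \<in> path_image (\<gamma> e))"
      "q \<in> p ` C' \<or> (\<exists>e. e \<in> edges G \<and> e \<subseteq> C' \<and> q \<in> path_image (\<gamma> e))"
      unfolding drawn_def by blast+
    then show False
    proof (elim disjE exE conjE)
      fix e e' assume "e \<in> edges G" "e \<subseteq> C" "q \<in> path_image (\<gamma> e)"
        "e' \<in> edges G" "e' \<subseteq> C'" "q \<in> path_image (\<gamma> e')"
      then show False using 4[of e e'] by auto
    qed (use 1 2 3 in blast)+
  qed
qed

lemma connected_drawn: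
  assumes C: "conn_in G C"
  shows "connected (drawn C)"
proof -
  obtain x where x: "x \<in> C" using C by (auto simp: conn_in_def)
  have edge_cc: "connected_component (drawn C) a b"
    if "e \<in> edges G" "e \<subseteq> C" "a \<in> path_image (\<gamma> e)" "b \<in> path_image (\<gamma> e)" for a b e
    using connected_component_of_subset[of "path_image (\<gamma> e)" a b "drawn C"]
      connected_arc_image[OF edge_arc[OF that(1)]] that
    by (auto simp: drawn_def connected_component_def)
  have vert: "connected_component (drawn C) (p x) (p y)" if "y \<in> C" for y
  proof -
    have "(x, y) \<in> (adj_rel G \<inter> C \<times> C)\<^sup>*" using C x that by (simp add: conn_in_def)
    then show ?thesis
    proof (induction rule: rtrancl_induct)
      case base
      then show ?case using x by (simp add: drawn_def connected_component_refl)
    next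
      case (step y z)
      then have "{y, z} \<in> edges G" "{y, z} \<subseteq> C" by (auto simp: adj_rel_def)
      then have "connected_component (drawn C) (p y) (p z)"
        using edge_cc[of "{y, z}"] ends_in_image[of "{y, z}"] by auto
      then show ?case using step.IH connected_component_trans by metis
    qed
  qed
  have "connected_component (drawn C) (p x) q" if q: "q \<in> drawn C" for q
  proof (cases "q \<in> p ` C")
    case True
    then show ?thesis using vert by blast
  next
    case False
    then obtain e where e: "e \<in> edges G" "e \<subseteq> C" "q \<in> path_image (\<gamma> e)"
      using q by (auto simp: drawn_def)
    obtain u v where "e = {u, v}" by (rule simple_graph_edgeE[OF simple e(1)])
    then have "u \<in> C" "p u \<in> path_image (\<gamma> e)" using e ends_in_image[OF e(1)] by auto
    then show ?thesis using vert[of u] edge_cc[OF e(1,2), of "p u" q] e connected_component_trans by metis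
  qed
  then show ?thesis
    unfolding connected_iff_connected_component by (metis connected_component_sym connected_component_trans)
qed

text \<open>Edges are unordered and their arcs have an arbitrary direction; joining arcs along a
  path needs the direction from \<open>x\<close> to \<open>y\<close>.\<close>

lemma edge_arc_from:
  assumes "{x, y} \<in> edges G"
  obtains g where "arc g" "pathstart g = p x" "pathfinish g = p y" "path_image g = path_image (\<gamma> {x, y})"
proof (cases "pathstart (\<gamma> {x, y}) = p x")
  case True
  have "pathfinish (\<gamma> {x, y}) = p y"
    using edge_ends[OF assms] True arc_distinct_ends[OF edge_arc[OF assms]]
    by (auto simp: doubleton_eq_iff)
  then show ?thesis using that[of "\<gamma> {x, y}"] True edge_arc[OF assms] by simp
next
  case False
  then have "pathstart (\<gamma> {x, y}) = p y" "pathfinish (\<gamma> {x, y}) = p x"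
    using edge_ends[OF assms] by (auto simp: doubleton_eq_iff)
  then show ?thesis
    using that[of "reversepath (\<gamma> {x, y})"] edge_arc[OF assms] by (simp add: arc_reversepath)
qed

definition path_drawn :: "'v list \<Rightarrow> complex set" where
  "path_drawn xs = (\<Union>e\<in>path_edges xs. path_image (\<gamma> e))"

text \<open>The arc of the first edge meets the rest only at \<open>y\<close>, because
  \<open>x\<close> occurs in no later edge of a path without repetitions.\<close>

lemma path_arc:
  assumes "2 \<le> length xs" "distinct xs" "walk G xs"
  shows "\<exists>g. arc g \<and> pathstart g = p (hd xs) \<and> pathfinish g = p (last xs) \<and> path_image g = path_drawn xs"
  using assms
proof (induction xs rule: path_edges.induct)
  case (1 x y xs)
  have xy: "{x, y} \<in> edges G" using 1 by simp
  obtain g where g: "arc g" "pathstart g = p x" "pathfinish g = p y" "path_image g = path_image (\<gamma> {x, y})"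
    using edge_arc_from[OF xy] .
  show ?case
  proof (cases xs)
    case Nil
    then show ?thesis using g by (intro exI[of _ g]) (simp add: path_drawn_def)
  next
    case (Cons z zs)
    then obtain h where h: "arc h" "pathstart h = p y" "pathfinish h = p (last (y # xs))"
      "path_image h = path_drawn (y # xs)"
      using 1 by auto
    have "path_image g \<inter> path_image h \<subseteq> {pathstart h}"
    proof
      fix q assume q: "q \<in> path_image g \<inter> path_image h"
      then obtain e where e: "e \<in> path_edges (y # xs)" "q \<in> path_image (\<gamma> e)"
        using h(4) by (auto simp: path_drawn_def)
      have eE: "e \<in> edges G" using e path_edges_subset[of G "y # xs"] 1(4) by auto
      have "x \<notin> e" using path_edges_verts[OF e(1)] 1(3) by auto
      then have "q \<in> p ` ({x, y} \<inter> e)" using edge_cross[OF xy eE] q g(4) e(2) by blast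
      then show "q \<in> {pathstart h}" using \<open>x \<notin> e\<close> h(2) by auto
    qed
    then have "arc (g +++ h)" using g h by (intro arc_join) auto
    moreover have "path_image (g +++ h) = path_drawn (x # y # xs)"
      using g h by (subst path_image_join) (auto simp: path_drawn_def)
    ultimately show ?thesis using g h by (intro exI[of _ "g +++ h"]) simp
  qed
qed auto

lemma path_drawn_subset:
  assumes "walk G xs"
  shows "path_drawn xs \<subseteq> drawn (set xs)"
proof -
  have "path_edges xs \<subseteq> {e \<in> edges G. e \<subseteq> set xs}"
    using path_edges_subset[OF assms] path_edges_verts[of _ xs] by auto
  then show ?thesis unfolding path_drawn_def drawn_def by blast
qed

lemma vertex_in_path_drawn:
  assumes "v \<in> set xs" "2 \<le> length xs" "walk G xs"
  shows "p v \<in> path_drawn xs"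
proof -
  obtain e where e: "e \<in> path_edges xs" "v \<in> e" using in_path_edge[OF assms(1,2)] by blast
  then have "e \<in> edges G" using path_edges_subset[OF assms(3)] by blast
  then show ?thesis using ends_in_image[of e] e by (auto simp: path_drawn_def)
qed

lemma path_drawn_Int:
  assumes xs: "walk G xs" "distinct xs" "3 \<le> length xs" "hd xs = a" "last xs = b"
    and ys: "walk G ys" "3 \<le> length ys"
    and int: "set xs \<inter> set ys = {a, b}"
  shows "path_drawn xs \<inter> path_drawn ys = {p a, p b}"
proof (intro equalityI subsetI)
  fix q assume "q \<in> path_drawn xs \<inter> path_drawn ys"
  then obtain e e' where e: "e \<in> path_edges xs" "q \<in> path_image (\<gamma> e)"
    "e' \<in> path_edges ys" "q \<in> path_image (\<gamma> e')"
    by (auto simp: path_drawn_def)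
  have E: "e \<in> edges G" "e' \<in> edges G" using e path_edges_subset xs(1) ys(1) by blast+
  have sub: "e \<inter> e' \<subseteq> {a, b}" using path_edges_verts[OF e(1)] path_edges_verts[OF e(3)] int by blast
  have "e \<noteq> e'"
  proof
    assume "e = e'"
    then have "e \<subseteq> {a, b}" using sub by blast
    moreover obtain u v where "e = {u, v}" "u \<noteq> v" by (rule simple_graph_edgeE[OF simple E(1)])
    ultimately have "e = {a, b}" by auto
    then show False using ends_not_path_edge[OF xs(2,3)] xs(4,5) e(1) by simp
  qed
  then have "q \<in> p ` (e \<inter> e')" using edge_cross[OF E] e by blast
  then show "q \<in> {p a, p b}" using sub by blast
next
  fix q assume "q \<in> {p a, p b}"
  moreover have "a \<in> set xs" "b \<in> set xs" "a \<in> set ys" "b \<in> set ys" using int by blast+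
  ultimately show "q \<in> path_drawn xs \<inter> path_drawn ys"
    using vertex_in_path_drawn[of _ xs] vertex_in_path_drawn[of _ ys] xs ys by auto
qed

text \<open>Combinatorial form of \<open>theta_curve_no_common_face\<close>. The set
  \<open>C0\<close> leading from \<open>z\<close> to the first path may run along that path; it has
  to avoid only the other two, which keeps its drawing in the complement of the cycle they form.
  Likewise for \<open>C1\<close> and \<open>C2\<close>.\<close>

lemma no_theta_with_apex:
  assumes paths: "\<And>xs. xs \<in> {xs0, xs1, xs2} \<Longrightarrow>
      walk G xs \<and> distinct xs \<and> 3 \<le> length xs \<and> hd xs = a \<and> last xs = b \<and> set xs \<subseteq> verts G"
    and int: "set xs0 \<inter> set xs1 = {a, b}" "set xs0 \<inter> set xs2 = {a, b}" "set xs1 \<inter> set xs2 = {a, b}"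
    and w: "w0 \<in> set xs0 - {a, b}" "w1 \<in> set xs1 - {a, b}" "w2 \<in> set xs2 - {a, b}"
    and conn: "conn_in G C0" "conn_in G C1" "conn_in G C2"
    and C: "z \<in> C0" "z \<in> C1" "z \<in> C2" "w0 \<in> C0" "w1 \<in> C1" "w2 \<in> C2"
    and disj: "C0 \<inter> (set xs1 \<union> set xs2) = {}" "C1 \<inter> (set xs0 \<union> set xs2) = {}"
      "C2 \<inter> (set xs0 \<union> set xs1) = {}"
  shows False
proof -
  have arcs: "\<exists>g. arc g \<and> pathstart g = p a \<and> pathfinish g = p b \<and> path_image g = path_drawn xs"
    if "xs \<in> {xs0, xs1, xs2}" for xs
    using path_arc[of xs] paths[OF that] by auto
  obtain c0 where c0: "arc c0" "pathstart c0 = p a" "pathfinish c0 = p b" "path_image c0 = path_drawn xs0"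
    using arcs[of xs0] by auto
  obtain c1 where c1: "arc c1" "pathstart c1 = p a" "pathfinish c1 = p b" "path_image c1 = path_drawn xs1"
    using arcs[of xs1] by auto
  obtain c2 where c2: "arc c2" "pathstart c2 = p a" "pathfinish c2 = p b" "path_image c2 = path_drawn xs2"
    using arcs[of xs2] by auto
  have PI: "path_drawn xs \<inter> path_drawn ys = {p a, p b}"
    if "xs \<in> {xs0, xs1, xs2}" "ys \<in> {xs0, xs1, xs2}" "set xs \<inter> set ys = {a, b}" for xs ys
    using path_drawn_Int[of xs a b ys] paths[OF that(1)] paths[OF that(2)] that(3) by blast
  have q: "p w \<in> path_drawn xs - {p a, p b}" if "xs \<in> {xs0, xs1, xs2}" "w \<in> set xs - {a, b}" for w xs
  proof -
    have xs: "walk G xs" "3 \<le> length xs" "hd xs = a" "last xs = b" "set xs \<subseteq> verts G"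
      using paths[OF that(1)] by blast+
    have "xs \<noteq> []" using xs(2) by auto
    then have "a \<in> set xs" "b \<in> set xs" using xs(3,4) hd_in_set last_in_set by blast+
    then have "p w \<noteq> p a" "p w \<noteq> p b" using inj xs(5) that(2) by (auto simp: inj_on_def)
    then show ?thesis using vertex_in_path_drawn[of w xs] xs that(2) by auto
  qed
  have see: "connected_component (- (path_drawn xs \<union> path_drawn ys)) (p z) (p w)"
    if "conn_in G C" "z \<in> C" "w \<in> C" "C \<inter> (set xs \<union> set ys) = {}"
      "xs \<in> {xs0, xs1, xs2}" "ys \<in> {xs0, xs1, xs2}" for C w xs ys
  proof -
    have "C \<subseteq> verts G" using that(1) by (simp add: conn_in_def)
    moreover have "walk G xs" "walk G ys" "set xs \<subseteq> verts G" "set ys \<subseteq> verts G"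
      using paths[OF that(5)] paths[OF that(6)] by blast+
    ultimately have "drawn C \<inter> path_drawn xs = {}" "drawn C \<inter> path_drawn ys = {}"
      using drawn_disjoint[of C "set xs"] drawn_disjoint[of C "set ys"] that(4)
        path_drawn_subset[of xs] path_drawn_subset[of ys] by blast+
    then have "drawn C \<subseteq> - (path_drawn xs \<union> path_drawn ys)" by blast
    moreover have "p z \<in> drawn C" "p w \<in> drawn C" using that by (auto simp: drawn_def)
    ultimately show ?thesis
      using connected_drawn[OF that(1)] unfolding connected_component_def by blast
  qed
  show False
  proof (rule theta_curve_no_common_face[of c0 c1 c2 "p a" "p b" "p w0" "p w1" "p w2" "p z"])
    show "path_image c0 \<inter> path_image c1 = {p a, p b}" unfolding c0 c1 using PI int by simp
    show "path_image c0 \<inter> path_image c2 = {p a, p b}" unfolding c0 c2 using PI int by simp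
    show "path_image c1 \<inter> path_image c2 = {p a, p b}" unfolding c1 c2 using PI int by simp
    show "p w0 \<in> path_image c0 - {p a, p b}" unfolding c0 by (rule q) (use w in auto)
    show "p w1 \<in> path_image c1 - {p a, p b}" unfolding c1 by (rule q) (use w in auto)
    show "p w2 \<in> path_image c2 - {p a, p b}" unfolding c2 by (rule q) (use w in auto)
    show "connected_component (- (path_image c1 \<union> path_image c2)) (p z) (p w0)"
      unfolding c1 c2 by (rule see[OF conn(1) C(1,4) disj(1)]) auto
    show "connected_component (- (path_image c0 \<union> path_image c2)) (p z) (p w1)"
      unfolding c0 c2 by (rule see[OF conn(2) C(2,5) disj(2)]) auto
    show "connected_component (- (path_image c0 \<union> path_image c1)) (p z) (p w2)"
      unfolding c0 c1 by (rule see[OF conn(3) C(3,6) disj(3)]) auto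
  qed (use c0 c1 c2 in auto)
qed

text \<open>The adjacencies picked are those of K_{3,3} between \<open>A\<close>, \<open>A'\<close>,
  \<open>Z\<close> and \<open>B0\<close>, \<open>B1\<close>, \<open>B2\<close>. Tripods in
  \<open>A\<close> and \<open>A'\<close> supply the ends of the theta, each of \<open>B0\<close>,
  \<open>B1\<close>, \<open>B2\<close> carries one arc, and its union with \<open>Z\<close> is the
  connected set that leads from \<open>z\<close> to this arc.\<close>

lemma clique_model_le_5:
  assumes M: "clique_model G M"
  shows "card M \<le> 5"
proof (rule ccontr)
  assume "\<not> card M \<le> 5"
  then obtain N where N: "N \<subseteq> M" "card N = 6" "finite N"
    using obtain_subset_with_card_n[of 6 M] by auto
  obtain Ns where Ns: "set Ns = N" "distinct Ns" using finite_distinct_list[OF N(3)] by blast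
  then have "length Ns = 6" using N(2) distinct_card by fastforce
  then obtain A A' B0 B1 B2 Z where Ns': "Ns = [A, A', B0, B1, B2, Z]"
    by (auto simp: numeral_eq_Suc length_Suc_conv)
  have mem: "{A, A', B0, B1, B2, Z} \<subseteq> M" using Ns' Ns(1) N(1) by auto
  have ds: "distinct [A, A', B0, B1, B2, Z]" using Ns' Ns(2) by simp
  have conn: "conn_in G A" "conn_in G A'" "conn_in G B0" "conn_in G B1" "conn_in G B2" "conn_in G Z"
    using M mem by (auto simp: clique_model_def)
  have D: "X \<inter> Y = {}" "adjacent_sets G X Y" if "X \<in> M" "Y \<in> M" "X \<noteq> Y" for X Y
    using M that by (auto simp: clique_model_def)
  have dj: "A \<inter> A' = {}" "A \<inter> B0 = {}" "A \<inter> B1 = {}" "A \<inter> B2 = {}" "A \<inter> Z = {}"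
    "A' \<inter> B0 = {}" "A' \<inter> B1 = {}" "A' \<inter> B2 = {}" "A' \<inter> Z = {}"
    "B0 \<inter> B1 = {}" "B0 \<inter> B2 = {}" "B0 \<inter> Z = {}" "B1 \<inter> B2 = {}" "B1 \<inter> Z = {}" "B2 \<inter> Z = {}"
    by (rule D(1); use mem ds in simp)+
  have adj: "adjacent_sets G A B0" "adjacent_sets G A B1" "adjacent_sets G A B2"
    "adjacent_sets G A' B0" "adjacent_sets G A' B1" "adjacent_sets G A' B2"
    "adjacent_sets G Z B0" "adjacent_sets G Z B1" "adjacent_sets G Z B2"
    by (rule D(2); use mem ds in auto)+
  obtain u0 w0 where uw0: "u0 \<in> A" "w0 \<in> B0" "{u0, w0} \<in> edges G" using adj(1) by (auto simp: adjacent_sets_def)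
  obtain u1 w1 where uw1: "u1 \<in> A" "w1 \<in> B1" "{u1, w1} \<in> edges G" using adj(2) by (auto simp: adjacent_sets_def)
  obtain u2 w2 where uw2: "u2 \<in> A" "w2 \<in> B2" "{u2, w2} \<in> edges G" using adj(3) by (auto simp: adjacent_sets_def)
  obtain v0 x0 where vx0: "v0 \<in> A'" "x0 \<in> B0" "{v0, x0} \<in> edges G" using adj(4) by (auto simp: adjacent_sets_def)
  obtain v1 x1 where vx1: "v1 \<in> A'" "x1 \<in> B1" "{v1, x1} \<in> edges G" using adj(5) by (auto simp: adjacent_sets_def)
  obtain v2 x2 where vx2: "v2 \<in> A'" "x2 \<in> B2" "{v2, x2} \<in> edges G" using adj(6) by (auto simp: adjacent_sets_def)
  obtain c l0 l1 l2 where l: "\<And>l. l \<in> {l0, l1, l2} \<Longrightarrow> l \<noteq> [] \<and> hd l = c \<and> distinct l \<and> set l \<subseteq> A \<and> walk G l"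
    and ll: "last l0 = u0" "last l1 = u1" "last l2 = u2"
    and li: "set l0 \<inter> set l1 = {c}" "set l0 \<inter> set l2 = {c}" "set l1 \<inter> set l2 = {c}"
    using conn_in_tripod[OF conn(1) uw0(1) uw1(1) uw2(1)] by metis
  obtain c' k0 k1 k2 where k: "\<And>l. l \<in> {k0, k1, k2} \<Longrightarrow> l \<noteq> [] \<and> hd l = c' \<and> distinct l \<and> set l \<subseteq> A' \<and> walk G l"
    and kl: "last k0 = v0" "last k1 = v1" "last k2 = v2"
    and ki: "set k0 \<inter> set k1 = {c'}" "set k0 \<inter> set k2 = {c'}" "set k1 \<inter> set k2 = {c'}"
    using conn_in_tripod[OF conn(2) vx0(1) vx1(1) vx2(1)] by metis
  obtain b0 where b0: "b0 \<noteq> []" "hd b0 = w0" "last b0 = x0" "distinct b0" "set b0 \<subseteq> B0" "walk G b0"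
    using conn_in_path[OF conn(3) uw0(2) vx0(2)] .
  obtain b1 where b1: "b1 \<noteq> []" "hd b1 = w1" "last b1 = x1" "distinct b1" "set b1 \<subseteq> B1" "walk G b1"
    using conn_in_path[OF conn(4) uw1(2) vx1(2)] .
  obtain b2 where b2: "b2 \<noteq> []" "hd b2 = w2" "last b2 = x2" "distinct b2" "set b2 \<subseteq> B2" "walk G b2"
    using conn_in_path[OF conn(5) uw2(2) vx2(2)] .
  have l0: "l0 \<noteq> []" "hd l0 = c" "distinct l0" "set l0 \<subseteq> A" "walk G l0"
    and l1: "l1 \<noteq> []" "hd l1 = c" "distinct l1" "set l1 \<subseteq> A" "walk G l1"
    and l2: "l2 \<noteq> []" "hd l2 = c" "distinct l2" "set l2 \<subseteq> A" "walk G l2"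
    using l by blast+
  have k0: "k0 \<noteq> []" "hd k0 = c'" "distinct k0" "set k0 \<subseteq> A'" "walk G k0"
    and k1: "k1 \<noteq> []" "hd k1 = c'" "distinct k1" "set k1 \<subseteq> A'" "walk G k1"
    and k2: "k2 \<noteq> []" "hd k2 = c'" "distinct k2" "set k2 \<subseteq> A'" "walk G k2"
    using k by blast+
  obtain z where z: "z \<in> Z" using conn(6) by (auto simp: conn_in_def)
  have V: "A \<subseteq> verts G" "A' \<subseteq> verts G" "B0 \<subseteq> verts G" "B1 \<subseteq> verts G" "B2 \<subseteq> verts G"
    using conn by (auto simp: conn_in_def)
  have "c \<in> A" using l0 hd_in_set by blast
  have "c' \<in> A'" using k0 hd_in_set by blast
  \<comment> \<open>Each arc enters its middle branch set at one of these vertices, so they lie on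
    the arcs and are at the same time reachable from \<open>z\<close>.\<close>
  have wb: "w0 \<in> set b0" "w1 \<in> set b1" "w2 \<in> set b2" using b0 b1 b2 hd_in_set by blast+
  have sub: "X \<inter> Y = {}" if "X \<subseteq> C" "Y \<subseteq> C'" "C \<inter> C' = {}" for X Y C C' :: "'v set"
    using that by blast
  \<comment> \<open>Two arcs share the centre in \<open>A\<close>, the centre in \<open>A'\<close>
    and nothing else; this form serves all three pairs.\<close>
  have int: "(X \<union> Y \<union> X') \<inter> (X1 \<union> Y1 \<union> X1') = {c, c'}"
    if "X \<subseteq> A" "X1 \<subseteq> A" "X \<inter> X1 = {c}" "X' \<subseteq> A'" "X1' \<subseteq> A'" "X' \<inter> X1' = {c'}"
      "Y \<inter> Y1 = {}" "A \<inter> Y = {}" "A \<inter> Y1 = {}" "A' \<inter> Y = {}" "A' \<inter> Y1 = {}"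
    for X Y X' X1 Y1 X1'
  proof -
    note e = sub[OF that(1) order_refl that(9)] sub[OF that(1,5) dj(1)] sub[OF that(4) order_refl that(11)]
    note f = sub[OF that(2) order_refl that(8)] sub[OF that(5) order_refl that(10)] sub[OF that(2,4) dj(1)]
    have "Y \<inter> X1 = {}" "Y \<inter> X1' = {}" "X' \<inter> X1 = {}" using f by (simp_all add: Int_commute)
    then show ?thesis using e that(3,6,7) by (simp add: Int_Un_distrib Int_Un_distrib2 insert_commute)
  qed
  let ?p0 = "l0 @ b0 @ rev k0" and ?p1 = "l1 @ b1 @ rev k1" and ?p2 = "l2 @ b2 @ rev k2"
  have s: "set ?p0 = set l0 \<union> set b0 \<union> set k0" "set ?p1 = set l1 \<union> set b1 \<union> set k1"
    "set ?p2 = set l2 \<union> set b2 \<union> set k2" by auto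
  have p0: "walk G ?p0 \<and> distinct ?p0 \<and> 3 \<le> length ?p0 \<and> hd ?p0 = hd l0 \<and> last ?p0 = hd k0"
    using sub[OF l0(4) b0(5) dj(2)] sub[OF l0(4) k0(4) dj(1)] sub[OF k0(4) b0(5) dj(6)]
      ll(1) kl(1) b0(2,3) uw0(3) vx0(3)
    by (intro join_paths l0(1,3,5) b0(1,4,6) k0(1,3,5)) (simp_all add: Int_commute insert_commute)
  have p1: "walk G ?p1 \<and> distinct ?p1 \<and> 3 \<le> length ?p1 \<and> hd ?p1 = hd l1 \<and> last ?p1 = hd k1"
    using sub[OF l1(4) b1(5) dj(3)] sub[OF l1(4) k1(4) dj(1)] sub[OF k1(4) b1(5) dj(7)]
      ll(2) kl(2) b1(2,3) uw1(3) vx1(3)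
    by (intro join_paths l1(1,3,5) b1(1,4,6) k1(1,3,5)) (simp_all add: Int_commute insert_commute)
  have p2: "walk G ?p2 \<and> distinct ?p2 \<and> 3 \<le> length ?p2 \<and> hd ?p2 = hd l2 \<and> last ?p2 = hd k2"
    using sub[OF l2(4) b2(5) dj(4)] sub[OF l2(4) k2(4) dj(1)] sub[OF k2(4) b2(5) dj(8)]
      ll(3) kl(3) b2(2,3) uw2(3) vx2(3)
    by (intro join_paths l2(1,3,5) b2(1,4,6) k2(1,3,5)) (simp_all add: Int_commute insert_commute)
  show False
  proof (rule no_theta_with_apex[of ?p0 ?p1 ?p2 c c' w0 w1 w2 "Z \<union> B0" "Z \<union> B1" "Z \<union> B2" z])
    fix xs assume "xs \<in> {?p0, ?p1, ?p2}"
    then consider "xs = ?p0" | "xs = ?p1" | "xs = ?p2" by blast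
    then show "walk G xs \<and> distinct xs \<and> 3 \<le> length xs \<and> hd xs = c \<and> last xs = c' \<and> set xs \<subseteq> verts G"
    proof cases
      case 1
      have "set ?p0 \<subseteq> verts G" unfolding s using l0(4) b0(5) k0(4) V by blast
      then show ?thesis using p0 l0(2) k0(2) unfolding 1 by metis
    next
      case 2
      have "set ?p1 \<subseteq> verts G" unfolding s using l1(4) b1(5) k1(4) V by blast
      then show ?thesis using p1 l1(2) k1(2) unfolding 2 by metis
    next
      case 3
      have "set ?p2 \<subseteq> verts G" unfolding s using l2(4) b2(5) k2(4) V by blast
      then show ?thesis using p2 l2(2) k2(2) unfolding 3 by metis
    qed
  next
    show "set ?p0 \<inter> set ?p1 = {c, c'}" unfolding s
      by (rule int[OF l0(4) l1(4) li(1) k0(4) k1(4) ki(1) sub[OF b0(5) b1(5) dj(10)]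
        sub[OF order_refl b0(5) dj(2)] sub[OF order_refl b1(5) dj(3)]
        sub[OF order_refl b0(5) dj(6)] sub[OF order_refl b1(5) dj(7)]])
    show "set ?p0 \<inter> set ?p2 = {c, c'}" unfolding s
      by (rule int[OF l0(4) l2(4) li(2) k0(4) k2(4) ki(2) sub[OF b0(5) b2(5) dj(11)]
        sub[OF order_refl b0(5) dj(2)] sub[OF order_refl b2(5) dj(4)]
        sub[OF order_refl b0(5) dj(6)] sub[OF order_refl b2(5) dj(8)]])
    show "set ?p1 \<inter> set ?p2 = {c, c'}" unfolding s
      by (rule int[OF l1(4) l2(4) li(3) k1(4) k2(4) ki(3) sub[OF b1(5) b2(5) dj(13)]
        sub[OF order_refl b1(5) dj(3)] sub[OF order_refl b2(5) dj(4)]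
        sub[OF order_refl b1(5) dj(7)] sub[OF order_refl b2(5) dj(8)]])
    show "w0 \<in> set ?p0 - {c, c'}" unfolding s using wb(1) uw0(2) \<open>c \<in> A\<close> \<open>c' \<in> A'\<close> dj by blast
    show "w1 \<in> set ?p1 - {c, c'}" unfolding s using wb(2) uw1(2) \<open>c \<in> A\<close> \<open>c' \<in> A'\<close> dj by blast
    show "w2 \<in> set ?p2 - {c, c'}" unfolding s using wb(3) uw2(2) \<open>c \<in> A\<close> \<open>c' \<in> A'\<close> dj by blast
    show "conn_in G (Z \<union> B0)" by (rule conn_in_Un[OF conn(6) conn(3) adj(7)])
    show "conn_in G (Z \<union> B1)" by (rule conn_in_Un[OF conn(6) conn(4) adj(8)])
    show "conn_in G (Z \<union> B2)" by (rule conn_in_Un[OF conn(6) conn(5) adj(9)])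
    show "(Z \<union> B0) \<inter> (set ?p1 \<union> set ?p2) = {}" unfolding s
    proof (rule sub[OF order_refl])
      show "set l1 \<union> set b1 \<union> set k1 \<union> (set l2 \<union> set b2 \<union> set k2) \<subseteq> A \<union> A' \<union> B1 \<union> B2"
        using l1(4) b1(5) k1(4) l2(4) b2(5) k2(4) by blast
      show "(Z \<union> B0) \<inter> (A \<union> A' \<union> B1 \<union> B2) = {}"
        using dj by (simp add: Int_Un_distrib Int_Un_distrib2 Int_commute)
    qed
    show "(Z \<union> B1) \<inter> (set ?p0 \<union> set ?p2) = {}" unfolding s
    proof (rule sub[OF order_refl])
      show "set l0 \<union> set b0 \<union> set k0 \<union> (set l2 \<union> set b2 \<union> set k2) \<subseteq> A \<union> A' \<union> B0 \<union> B2"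
        using l0(4) b0(5) k0(4) l2(4) b2(5) k2(4) by blast
      show "(Z \<union> B1) \<inter> (A \<union> A' \<union> B0 \<union> B2) = {}"
        using dj by (simp add: Int_Un_distrib Int_Un_distrib2 Int_commute)
    qed
    show "(Z \<union> B2) \<inter> (set ?p0 \<union> set ?p1) = {}" unfolding s
    proof (rule sub[OF order_refl])
      show "set l0 \<union> set b0 \<union> set k0 \<union> (set l1 \<union> set b1 \<union> set k1) \<subseteq> A \<union> A' \<union> B0 \<union> B1"
        using l0(4) b0(5) k0(4) l1(4) b1(5) k1(4) by blast
      show "(Z \<union> B2) \<inter> (A \<union> A' \<union> B0 \<union> B1) = {}"
        using dj by (simp add: Int_Un_distrib Int_Un_distrib2 Int_commute)
    qed
  qed (use z uw0 uw1 uw2 in auto)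
qed

end

lemma planar_iff_drawing:
  fixes G :: "'v ugraph"
  assumes "simple_graph G"
  shows "planar G \<longleftrightarrow> (\<exists>p \<gamma>. drawing G p \<gamma>)"
proof
  assume "planar G"
  then obtain p :: "'v \<Rightarrow> complex" and \<gamma> :: "'v set \<Rightarrow> real \<Rightarrow> complex" where d: "inj_on p (verts G)"
    "\<forall>e\<in>edges G. arc (\<gamma> e) \<and> {pathstart (\<gamma> e), pathfinish (\<gamma> e)} = p ` e"
    "\<forall>e\<in>edges G. \<forall>v\<in>verts G. p v \<in> path_image (\<gamma> e) \<longrightarrow> v \<in> e"
    "\<forall>e\<in>edges G. \<forall>e'\<in>edges G. e \<noteq> e' \<longrightarrow> path_image (\<gamma> e) \<inter> path_image (\<gamma> e') \<subseteq> p ` (e \<inter> e')"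
    unfolding planar_def by (elim exE conjE)
  have "drawing G p \<gamma>"
  proof
    fix e e' assume "e \<in> edges G" "e' \<in> edges G" "e \<noteq> e'"
    then show "path_image (\<gamma> e) \<inter> path_image (\<gamma> e') \<subseteq> p ` (e \<inter> e')" using d(4) by simp
  qed (use assms(1) d(1-3) in simp_all)
  then show "\<exists>p \<gamma>. drawing G p \<gamma>" by blast
next
  assume "\<exists>p \<gamma>. drawing G p \<gamma>"
  then obtain p \<gamma> where "drawing G p \<gamma>" by (elim exE)
  then interpret drawing G p \<gamma> .
  show "planar G"
    unfolding planar_def
  proof (intro exI[of _ p] exI[of _ \<gamma>] conjI ballI impI)
    fix e v assume "e \<in> edges G" "v \<in> verts G" "p v \<in> path_image (\<gamma> e)"
    then show "v \<in> e" by (rule edge_vertex)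
  next
    fix e e' assume "e \<in> edges G" "e' \<in> edges G" "e \<noteq> e'"
    then show "path_image (\<gamma> e) \<inter> path_image (\<gamma> e') \<subseteq> p ` (e \<inter> e')" by (rule edge_cross)
  qed (use inj edge_arc edge_ends in simp_all)
qed

lemma planar_clique_model_le_5:
  assumes "simple_graph G" "planar G" "clique_model G M"
  shows "card M \<le> 5"
proof -
  obtain p \<gamma> where "drawing G p \<gamma>"
    using assms(2) unfolding planar_iff_drawing[OF assms(1)] by (elim exE)
  then show ?thesis using assms(3) by (rule drawing.clique_model_le_5)
qed

section \<open>Separators\<close>

lemma conn_in_from:
  assumes "x \<in> C" "C \<subseteq> verts G" "\<And>y. y \<in> C \<Longrightarrow> (x, y) \<in> (adj_rel G \<inter> C \<times> C)\<^sup>*"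
  shows "conn_in G C"
proof -
  have "sym ((adj_rel G \<inter> C \<times> C)\<^sup>*)"
    by (intro sym_rtrancl symI) (auto simp: adj_rel_sym)
  then have "(y, z) \<in> (adj_rel G \<inter> C \<times> C)\<^sup>*" if "y \<in> C" "z \<in> C" for y z
    using assms(3)[OF that(1)] assms(3)[OF that(2)] by (meson rtrancl_trans symD)
  then show ?thesis using assms(1,2) unfolding conn_in_def by auto
qed

lemma conn_in_singleton: "x \<in> verts G \<Longrightarrow> conn_in G {x}"
  by (simp add: conn_in_def)

lemma conn_in_mono:
  assumes "conn_in H C" "verts H \<subseteq> verts G" "edges H \<subseteq> edges G"
  shows "conn_in G C"
proof -
  have "adj_rel H \<inter> C \<times> C \<subseteq> adj_rel G \<inter> C \<times> C" using assms(3) by (auto simp: adj_rel_def)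
  then have "(adj_rel H \<inter> C \<times> C)\<^sup>* \<subseteq> (adj_rel G \<inter> C \<times> C)\<^sup>*" by (rule rtrancl_mono)
  then show ?thesis using assms(1,2) unfolding conn_in_def by blast
qed

text \<open>\<open>u\<close> is inserted explicitly because \<open>I\<close> may be empty: a branch
  set built while there are no others is a single vertex.\<close>

lemma conn_in_insert_UN:
  assumes "u \<in> verts G" "\<And>i. i \<in> I \<Longrightarrow> conn_in G (C i) \<and> u \<in> C i"
  shows "conn_in G (insert u (\<Union>i\<in>I. C i))"
proof (rule conn_in_from[of u])
  let ?U = "insert u (\<Union>i\<in>I. C i)"
  show "?U \<subseteq> verts G" using assms by (auto simp: conn_in_def)
  fix y assume "y \<in> ?U"
  then consider "y = u" | i where "i \<in> I" "y \<in> C i" by blast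
  then show "(u, y) \<in> (adj_rel G \<inter> ?U \<times> ?U)\<^sup>*"
  proof cases
    case 2
    then have "(u, y) \<in> (adj_rel G \<inter> C i \<times> C i)\<^sup>*" using assms(2) unfolding conn_in_def by blast
    then show ?thesis by (rule rtrancl_mono[THEN subsetD, rotated]) (use 2 in auto)
  qed auto
qed simp

text \<open>The vertices of a path from \<open>u\<close> to \<open>v\<close>; later only
  connectivity and size count, so their order is not recorded.\<close>

lemma gball_connected_subset:
  assumes "simple_graph G" "u \<in> verts G" "v \<in> gball G n u"
  shows "\<exists>C. conn_in G C \<and> u \<in> C \<and> v \<in> C \<and> card C \<le> Suc n"
  using assms(3)
proof (induction n arbitrary: v)
  case 0
  then have "v = u" using assms(2) by (simp add: gball_0)
  then show ?case using conn_in_singleton[OF assms(2)] by (intro exI[of _ "{u}"]) simp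
next
  case (Suc n)
  then consider "v \<in> gball G n u" | z where "z \<in> gball G n u" "{z, v} \<in> edges G"
    unfolding gball_Suc[OF assms(1,2)] by (auto simp: neighbors_def)
  then show ?case
  proof cases
    case 1
    then show ?thesis using Suc.IH le_SucI by blast
  next
    case 2
    then obtain C where C: "conn_in G C" "u \<in> C" "z \<in> C" "card C \<le> Suc n" using Suc.IH by blast
    have "v \<in> verts G" using simple_graph_edgeD[OF assms(1) 2(2)] by blast
    moreover have "adjacent_sets G C {v}" using 2 C by (auto simp: adjacent_sets_def)
    ultimately have "conn_in G (C \<union> {v})" by (intro conn_in_Un C conn_in_singleton)
    moreover have "card (C \<union> {v}) \<le> Suc (Suc n)" using card_Un_le[of C "{v}"] C(4) by simp
    ultimately show ?thesis using C by (intro exI[of _ "C \<union> {v}"]) auto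
  qed
qed

text \<open>Without a cheap cut, each ball of at most half the vertices grows by the factor
  \<open>1 + 1 / l\<close>, and \<open>t\<close> such steps would exceed
  \<open>card (verts H)\<close>. Cleared of fractions, the induction shows
  \<open>(l + 1) ^ i \<le> l ^ i * card (gball H i u)\<close>.\<close>

lemma gball_exceeds_half:
  assumes "simple_graph H" "u \<in> verts H" and grow: "card (verts H) * l ^ t < (l + 1) ^ t"
    and nocut: "\<And>i. 2 * card (gball H i u) \<le> card (verts H) \<Longrightarrow>
      card (gball H i u) \<le> l * card (gball H (Suc i) u - gball H i u)"
  shows "card (verts H) < 2 * card (gball H t u)"
proof (rule ccontr)
  assume "\<not> ?thesis"
  then have small: "2 * card (gball H t u) \<le> card (verts H)" by simp
  have "i \<le> t \<Longrightarrow> (l + 1) ^ i \<le> l ^ i * card (gball H i u)" for i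
  proof (induction i)
    case 0
    then show ?case using assms(2) by (simp add: gball_0)
  next
    case (Suc i)
    let ?B = "gball H i u" and ?B' = "gball H (Suc i) u"
    have "?B \<subseteq> gball H t u" using Suc.prems by (intro gball_mono) simp
    then have "card ?B \<le> card (gball H t u)" by (rule card_mono[OF finite_gball[OF assms(1)]])
    then have "card ?B \<le> l * card (?B' - ?B)" using small by (intro nocut) simp
    moreover have "card (?B' - ?B) = card ?B' - card ?B" "card ?B \<le> card ?B'"
      using gball_mono[of i "Suc i" H u] finite_gball[OF assms(1)]
      by (auto intro: card_Diff_subset card_mono)
    then have "card ?B' = card ?B + card (?B' - ?B)" by simp
    then have "l * card ?B' = l * card ?B + l * card (?B' - ?B)" by (metis distrib_left)
    ultimately have "(l + 1) * card ?B \<le> l * card ?B'" by simp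
    have "(l + 1) ^ Suc i \<le> (l + 1) * (l ^ i * card ?B)"
      unfolding power_Suc by (rule mult_le_mono2) (use Suc in simp)
    also have "\<dots> = l ^ i * ((l + 1) * card ?B)" by (simp only: mult_ac)
    also have "\<dots> \<le> l ^ i * (l * card ?B')" using \<open>(l + 1) * card ?B \<le> l * card ?B'\<close> by (rule mult_le_mono2)
    finally show ?case by (simp add: mult_ac)
  qed
  from this[of t] have "(l + 1) ^ t \<le> l ^ t * card (gball H t u)" by simp
  also have "\<dots> \<le> l ^ t * card (verts H)" using small by (intro mult_le_mono2) simp
  finally show False using grow by (simp add: mult.commute)
qed

text \<open>By Bernoulli \<open>(1 + 1 / l) ^ l\<close> is at least 2, so within radius
  \<open>l * k\<close> a ball doubles \<open>k\<close> times and outgrows \<open>n < 2 ^ k\<close>.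
  This is the origin of the radius used for branch sets.\<close>

lemma power_growth:
  fixes n k l :: nat
  assumes "n < 2 ^ k" "0 < l"
  shows "n * l ^ (l * k) < (l + 1) ^ (l * k)"
proof -
  have "2 * real l ^ l \<le> (1 + real l) ^ l"
  proof -
    have "1 + real l * (1 / l) \<le> (1 + 1 / l) ^ l" by (rule Bernoulli_inequality) (simp add: order_trans[of _ 0])
    then have "2 \<le> (1 + 1 / real l) ^ l" using assms by simp
    then have "2 * real l ^ l \<le> (1 + 1 / real l) ^ l * real l ^ l" by (intro mult_right_mono) auto
    also have "\<dots> = ((1 + 1 / real l) * real l) ^ l" by (simp only: power_mult_distrib)
    also have "(1 + 1 / real l) * real l = 1 + real l" using assms by (simp add: field_simps)
    finally show ?thesis .
  qed
  then have "real (2 * l ^ l) \<le> real ((l + 1) ^ l)" by simp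
  then have two: "2 * l ^ l \<le> (l + 1) ^ l" by linarith
  have "n * l ^ (l * k) < 2 ^ k * l ^ (l * k)" using assms by simp
  also have "\<dots> = (2 * l ^ l) ^ k" by (simp add: power_mult power_mult_distrib)
  also have "\<dots> \<le> ((l + 1) ^ l) ^ k" by (rule power_mono[OF two]) simp
  finally show ?thesis by (simp add: power_mult)
qed

text \<open>The Plotkin--Rao--Smith procedure. A state consists of a part \<open>R\<close> already cut off, a separator
  \<open>B\<close> paid for by \<open>R\<close>, the branch sets \<open>M\<close> of a clique minor, and the remaining vertices \<open>X\<close>.\<close>

definition prs_state ::
    "'v ugraph \<Rightarrow> 'v set \<Rightarrow> nat \<Rightarrow> nat \<Rightarrow> 'v set \<Rightarrow> 'v set \<Rightarrow> 'v set set \<Rightarrow> 'v set \<Rightarrow> bool" where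
  "prs_state G S l s R B M X \<longleftrightarrow>
     S = R \<union> B \<union> \<Union>M \<union> X \<and> X \<inter> (R \<union> B \<union> \<Union>M) = {} \<and> clique_model G M \<and> (\<forall>A\<in>M. card A \<le> s) \<and>
     \<not> adjacent_sets G R X \<and> l * card B \<le> card R \<and> 3 * card R \<le> 2 * card S"

text \<open>Three moves. A branch set without neighbours in \<open>X\<close> goes to
  \<open>R\<close>; a ball in \<open>X\<close> with a cheap boundary goes to \<open>R\<close> and
  its boundary to \<open>B\<close>; otherwise \<open>X\<close> has small diameter and contains a new
  branch set adjacent to all others. The last move adds one branch set but takes a vertex from
  \<open>X\<close>, which the weight 6 outweighs. The size bound is
  \<open>1 + 5 * (2 * t + 1)\<close> with \<open>t = l * k\<close>: a root and at most five
  connections.\<close>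

lemma prs_step:
  assumes sg: "simple_graph G" and S: "S \<subseteq> verts G" and k: "card S < 2 ^ k" and l: "0 < l"
    and minor: "\<And>M. clique_model G M \<Longrightarrow> card M \<le> 5"
    and st: "prs_state G S l (6 + 10 * (l * k)) R B M X" and big: "2 * card S < 3 * card X"
  shows "\<exists>R' B' M' X'. prs_state G S l (6 + 10 * (l * k)) R' B' M' X' \<and>
    6 * card X' + card M' < 6 * card X + card M"
proof -
  let ?s = "6 + 10 * (l * k)"
  have S_eq: "S = R \<union> B \<union> \<Union>M \<union> X" and disj: "X \<inter> (R \<union> B \<union> \<Union>M) = {}" and M: "clique_model G M"
    and Ms: "\<forall>A\<in>M. card A \<le> ?s" and RX: "\<not> adjacent_sets G R X" and BR: "l * card B \<le> card R"
    using st by (auto simp: prs_state_def)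
  have finS: "finite S" using S finite_verts[OF sg] by (rule finite_subset)
  have finX: "finite X" and finR: "finite R" using finS S_eq by auto
  have XV: "X \<subseteq> verts G" using S S_eq by blast
  have finM: "finite M" using M by (simp add: clique_model_def)
  have "X \<noteq> {}" using big by auto
  \<comment> \<open>As long as \<open>big\<close> holds, fewer than \<open>card S / 3\<close>
    vertices lie outside \<open>X\<close>. So \<open>R\<close> stays within two thirds even when it
    takes half of \<open>X\<close>, since \<open>card S - card X / 2\<close> is below
    \<open>2 * card S / 3\<close>.\<close>
  have rest: "card Y \<le> card S - card X + card Z" if "Y \<subseteq> (S - X) \<union> Z" "Z \<subseteq> S" for Y Z
  proof -
    have "card Y \<le> card ((S - X) \<union> Z)"
      by (rule card_mono[OF _ that(1)]) (use finS that finite_subset in blast)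
    also have "\<dots> \<le> card (S - X) + card Z" by (rule card_Un_le)
    also have "card (S - X) = card S - card X" by (rule card_Diff_subset[OF finX]) (use S_eq in blast)
    finally show ?thesis .
  qed
  show ?thesis
  proof (cases "\<exists>A\<in>M. \<not> adjacent_sets G A X")
    case True
    then obtain A where A: "A \<in> M" "\<not> adjacent_sets G A X" by blast
    have "prs_state G S l ?s (R \<union> A) B (M - {A}) X"
      unfolding prs_state_def
    proof (intro conjI)
      show "S = R \<union> A \<union> B \<union> \<Union>(M - {A}) \<union> X" using S_eq A by blast
      show "X \<inter> (R \<union> A \<union> B \<union> \<Union>(M - {A})) = {}" using disj A by blast
      show "clique_model G (M - {A})" using M by (simp add: clique_model_def)
      show "\<not> adjacent_sets G (R \<union> A) X" using RX A(2) by (auto simp: adjacent_sets_def)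
      have "card R \<le> card (R \<union> A)"
        by (rule card_mono) (use A S_eq finS in \<open>auto intro: finite_subset\<close>)
      then show "l * card B \<le> card (R \<union> A)" using BR by simp
      have "card (R \<union> A) \<le> card S - card X + card ({} :: 'a set)"
        by (rule rest) (use A S_eq disj in blast)+
      then show "3 * card (R \<union> A) \<le> 2 * card S" using big by simp
    qed (use Ms in auto)
    moreover have "card (M - {A}) < card M" by (rule card_Diff1_less[OF finM A(1)])
    ultimately show ?thesis by (intro exI conjI) (assumption, simp)
  next
    case False
    define H where "H = induced G X"
    have sH: "simple_graph H" unfolding H_def by (rule simple_graph_induced[OF sg XV \<open>X \<noteq> {}\<close>])
    have VH: "verts H = X" and EH: "edges H = {e \<in> edges G. e \<subseteq> X}" by (simp_all add: H_def induced_def)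
    have BX: "gball H i u \<subseteq> X" for i u using gball_subset_verts[of H i u] VH by simp
    have finB: "finite (gball H i u)" for i u using finite_gball[OF sH] .
    show ?thesis
    proof (cases "\<exists>u\<in>X. \<exists>i. 2 * card (gball H i u) \<le> card X \<and>
        l * card (gball H (Suc i) u - gball H i u) < card (gball H i u)")
      case True
      then obtain u i where u: "u \<in> X" "2 * card (gball H i u) \<le> card X"
        "l * card (gball H (Suc i) u - gball H i u) < card (gball H i u)" by blast
      let ?C = "gball H i u" and ?C' = "gball H (Suc i) u"
      have CC': "?C \<subseteq> ?C'" by (rule gball_mono) simp
      have "prs_state G S l ?s (R \<union> ?C) (B \<union> (?C' - ?C)) M (X - ?C')"
        unfolding prs_state_def
      proof (intro conjI)
        show "S = R \<union> ?C \<union> (B \<union> (?C' - ?C)) \<union> \<Union>M \<union> (X - ?C')" using S_eq CC' BX[of "Suc i" u] by blast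
        show "(X - ?C') \<inter> (R \<union> ?C \<union> (B \<union> (?C' - ?C)) \<union> \<Union>M) = {}" using disj CC' by blast
        show "\<not> adjacent_sets G (R \<union> ?C) (X - ?C')"
        proof
          assume "adjacent_sets G (R \<union> ?C) (X - ?C')"
          then obtain a b where ab: "a \<in> R \<union> ?C" "b \<in> X" "b \<notin> ?C'" "{a, b} \<in> edges G"
            by (auto simp: adjacent_sets_def)
          then have "a \<in> ?C" using RX by (auto simp: adjacent_sets_def)
          then have "{a, b} \<in> edges H" using ab BX[of i u] by (auto simp: EH)
          then have "b \<in> ?C'" using \<open>a \<in> ?C\<close> gball_Suc[OF sH, of u i] u(1) VH by (auto simp: neighbors_def)
          then show False using ab by simp
        qed
        have "card (R \<union> ?C) = card R + card ?C"
          by (rule card_Un_disjoint[OF finR finB]) (use disj BX[of i u] in blast)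
        moreover have "card (B \<union> (?C' - ?C)) \<le> card B + card (?C' - ?C)" by (rule card_Un_le)
        then have "l * card (B \<union> (?C' - ?C)) \<le> l * card B + l * card (?C' - ?C)"
          by (metis mult_le_mono2 distrib_left)
        ultimately show "l * card (B \<union> (?C' - ?C)) \<le> card (R \<union> ?C)" using BR u(3) by linarith
        have "card (R \<union> ?C) \<le> card S - card X + card ?C"
          by (rule rest) (use disj S_eq BX[of i u] in blast)+
        moreover have "card X \<le> card S" by (rule card_mono[OF finS]) (use S_eq in blast)
        ultimately show "3 * card (R \<union> ?C) \<le> 2 * card S" using u(2) big by linarith
      qed (use M Ms in auto)
      moreover have "card (X - ?C') < card X"
      proof (rule psubset_card_mono[OF finX])
        have "u \<in> ?C'" using u(1) VH by (simp add: center_in_gball)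
        then show "X - ?C' \<subset> X" using u(1) by blast
      qed
      ultimately show ?thesis by (intro exI conjI) (assumption, simp)
    next
      case nocut: False
      define t where "t = l * k"
      have half: "card X < 2 * card (gball H t u)" if "u \<in> X" for u
      proof -
        have "card X \<le> card S" by (rule card_mono[OF finS]) (use S_eq in blast)
        then have "card X * l ^ t < (l + 1) ^ t" unfolding t_def using power_growth[of "card X" k l] k l by simp
        then have "card (verts H) < 2 * card (gball H t u)"
        proof (intro gball_exceeds_half[OF sH])
          fix i assume "2 * card (gball H i u) \<le> card (verts H)"
          then show "card (gball H i u) \<le> l * card (gball H (Suc i) u - gball H i u)"
            using nocut that VH by (meson linorder_not_le)
        qed (use that VH in auto)
        then show ?thesis using VH by simp
      qed
      obtain u where u: "u \<in> X" using \<open>X \<noteq> {}\<close> by blast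
      \<comment> \<open>Two balls that each hold more than half of \<open>X\<close> intersect, so
        all of \<open>X\<close> lies within distance \<open>2 * t\<close> of
        \<open>u\<close>.\<close>
      have near: "v \<in> gball H (2 * t) u" if v: "v \<in> X" for v
      proof -
        have "gball H t u \<inter> gball H t v \<noteq> {}"
        proof
          assume "gball H t u \<inter> gball H t v = {}"
          then have "card (gball H t u \<union> gball H t v) = card (gball H t u) + card (gball H t v)"
            by (rule card_Un_disjoint[OF finB finB])
          moreover have "card (gball H t u \<union> gball H t v) \<le> card X"
            by (rule card_mono[OF finX]) (use BX in blast)
          ultimately show False using half[OF u] half[OF v] by linarith
        qed
        then obtain y where "y \<in> gball H t u" "y \<in> gball H t v" by blast
        then have "v \<in> gball H (t + t) u" using gball_sym gball_trans VH v by metis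
        then show ?thesis by (simp add: mult_2)
      qed
      \<comment> \<open>Every branch set has a neighbour in \<open>X\<close> by now; a short
        connected set from the root \<open>u\<close> to that neighbour will make the new branch set
        adjacent to it.\<close>
      have "\<exists>C. conn_in G C \<and> u \<in> C \<and> adjacent_sets G A C \<and> C \<subseteq> X \<and> card C \<le> Suc (2 * t)" if A: "A \<in> M" for A
      proof -
        obtain a v where av: "a \<in> A" "v \<in> X" "{a, v} \<in> edges G"
          using False A by (auto simp: adjacent_sets_def)
        obtain C where C: "conn_in H C" "u \<in> C" "v \<in> C" "card C \<le> Suc (2 * t)"
          using gball_connected_subset[OF sH _ near[OF av(2)]] u VH by auto
        have "conn_in G C" by (rule conn_in_mono[OF C(1)]) (use VH XV EH in auto)
        moreover have "C \<subseteq> X" using C(1) VH by (simp add: conn_in_def)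
        moreover have "adjacent_sets G A C" using av C by (auto simp: adjacent_sets_def)
        ultimately show ?thesis using C by blast
      qed
      then obtain C where C: "\<And>A. A \<in> M \<Longrightarrow> conn_in G (C A) \<and> u \<in> C A \<and> adjacent_sets G A (C A) \<and>
        C A \<subseteq> X \<and> card (C A) \<le> Suc (2 * t)" by metis
      define N where "N = insert u (\<Union>A\<in>M. C A)"
      have NX: "N \<subseteq> X" using C u by (auto simp: N_def)
      have Nconn: "conn_in G N" unfolding N_def by (rule conn_in_insert_UN) (use C u XV in auto)
      have Nadj: "adjacent_sets G A N" if "A \<in> M" for A
        using C[OF that] that by (fastforce simp: adjacent_sets_def N_def)
      have Nnew: "A \<inter> N = {}" if "A \<in> M" for A using NX disj that by blast
      have "u \<in> N" by (simp add: N_def)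
      have MN: "clique_model G (insert N M)"
        unfolding clique_model_def
      proof (intro conjI ballI impI)
        fix A A' assume "A \<in> insert N M" "A' \<in> insert N M" "A \<noteq> A'"
        then consider "A = N" "A' \<in> M" | "A' = N" "A \<in> M" | "A \<in> M" "A' \<in> M" "A \<noteq> A'" by blast
        then have "A \<inter> A' = {} \<and> adjacent_sets G A A'"
        proof cases
          case 1
          then show ?thesis using Nadj[of A'] Nnew[of A'] adjacent_sets_sym by blast
        next
          case 2
          then show ?thesis using Nadj[of A] Nnew[of A] by blast
        next
          case 3
          then show ?thesis using M by (simp add: clique_model_def)
        qed
        then show "A \<inter> A' = {}" "adjacent_sets G A A'" by blast+
      qed (use M Nconn in \<open>auto simp: clique_model_def\<close>)
      have "card N \<le> Suc (card (\<Union>A\<in>M. C A))" unfolding N_def by (rule card_insert_le_m1) auto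
      moreover have "card (\<Union>A\<in>M. C A) \<le> (\<Sum>A\<in>M. card (C A))" by (rule card_UN_le[OF finM])
      moreover have "(\<Sum>A\<in>M. card (C A)) \<le> (\<Sum>A\<in>M. Suc (2 * t))" by (rule sum_mono) (use C in blast)
      moreover have "(\<Sum>A\<in>M. Suc (2 * t)) \<le> 5 * Suc (2 * t)"
        using mult_le_mono1[OF minor[OF M], of "Suc (2 * t)"] by simp
      ultimately have cardN: "card N \<le> ?s" by (simp add: t_def)
      have "prs_state G S l ?s R B (insert N M) (X - N)"
        unfolding prs_state_def
      proof (intro conjI)
        show "S = R \<union> B \<union> \<Union>(insert N M) \<union> (X - N)" using S_eq NX by blast
        show "(X - N) \<inter> (R \<union> B \<union> \<Union>(insert N M)) = {}" using disj by blast
        show "\<not> adjacent_sets G R (X - N)" using RX by (auto simp: adjacent_sets_def)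
        show "3 * card R \<le> 2 * card S" using st unfolding prs_state_def by (elim conjE)
      qed (use MN Ms cardN BR in auto)
      moreover have "card (X - N) < card X"
        by (rule psubset_card_mono[OF finX]) (use u \<open>u \<in> N\<close> in blast)
      moreover have "card (insert N M) \<le> Suc (card M)" by (rule card_insert_le_m1) auto
      ultimately show ?thesis by (intro exI conjI) (assumption, simp)
    qed
  qed
qed

text \<open>A state of least measure admits no further step, so its \<open>X\<close> is small. The
  separator consists of \<open>B\<close>, with at most \<open>card R / l\<close> vertices, and of at
  most five branch sets; \<open>30 + 50 * (l * k)\<close> is five times their size bound.\<close>

lemma separator:
  assumes sg: "simple_graph G" and S: "S \<subseteq> verts G" and k: "card S < 2 ^ k" and l: "0 < l"
    and minor: "\<And>M. clique_model G M \<Longrightarrow> card M \<le> 5"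
  shows "\<exists>R Y X. S = R \<union> Y \<union> X \<and> R \<inter> X = {} \<and> \<not> adjacent_sets G R X \<and>
    3 * card R \<le> 2 * card S \<and> 3 * card X \<le> 2 * card S \<and>
    l * card Y \<le> card S + l * (30 + 50 * (l * k))"
proof -
  let ?s = "6 + 10 * (l * k)"
  let ?st = "\<lambda>(R, B, M, X). prs_state G S l ?s R B M X"
  let ?f = "\<lambda>(R, B, M, X). 6 * card X + card M"
  have "?st ({}, {}, {}, S)" by (simp add: prs_state_def clique_model_def adjacent_sets_def)
  then obtain z where z: "?st z" "\<And>y. ?st y \<Longrightarrow> ?f z \<le> ?f y"
    using ex_has_least_nat[of ?st _ ?f] by blast
  obtain R B M X where zz: "z = (R, B, M, X)" by (metis prod_cases4)
  have st: "prs_state G S l ?s R B M X" using z(1) zz by simp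
  have least: "6 * card X + card M \<le> 6 * card X' + card M'" if "prs_state G S l ?s R' B' M' X'" for R' B' M' X'
    using z(2)[of "(R', B', M', X')"] that zz by simp
  have X: "3 * card X \<le> 2 * card S"
  proof (rule ccontr)
    assume "\<not> ?thesis"
    then have "2 * card S < 3 * card X" by simp
    from prs_step[OF sg S k l minor st this] show False using least by (meson linorder_not_le)
  qed
  have finS: "finite S" using S finite_verts[OF sg] by (rule finite_subset)
  have M: "clique_model G M" and Ms: "\<forall>A\<in>M. card A \<le> ?s" and S_eq: "S = R \<union> B \<union> \<Union>M \<union> X"
    and BR: "l * card B \<le> card R"
    using st by (auto simp: prs_state_def)
  have "card (\<Union>M) \<le> (\<Sum>A\<in>M. card A)"
    using card_UN_le[of M "\<lambda>A. A"] M by (simp add: clique_model_def)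
  also have "\<dots> \<le> (\<Sum>A\<in>M. ?s)" by (rule sum_mono) (use Ms in blast)
  also have "\<dots> = card M * ?s" by simp
  also have "\<dots> \<le> 5 * ?s" by (rule mult_le_mono1) (rule minor[OF M])
  finally have cM: "card (\<Union>M) \<le> 30 + 50 * (l * k)" by simp
  have "l * card (B \<union> \<Union>M) \<le> l * (card B + card (\<Union>M))" by (rule mult_le_mono2) (rule card_Un_le)
  also have "\<dots> = l * card B + l * card (\<Union>M)" by (rule distrib_left)
  also have "\<dots> \<le> card S + l * (30 + 50 * (l * k))"
  proof (rule add_mono[OF _ mult_le_mono2[OF cM]])
    have "card R \<le> card S" by (rule card_mono[OF finS]) (use S_eq in blast)
    then show "l * card B \<le> card S" using BR by simp
  qed
  finally have "l * card (B \<union> \<Union>M) \<le> card S + l * (30 + 50 * (l * k))" .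
  moreover have "S = R \<union> (B \<union> \<Union>M) \<union> X" using S_eq by blast
  moreover have "R \<inter> X = {}" "\<not> adjacent_sets G R X" "3 * card R \<le> 2 * card S"
    using st by (auto simp: prs_state_def)
  ultimately show ?thesis using X by blast
qed

text \<open>With \<open>l\<close> about \<open>n powr (1 / 3)\<close> and \<open>k\<close> about
  \<open>log 2 n\<close>, the two terms are of order \<open>n powr (2 / 3)\<close> and
  \<open>n powr (1 / 3) * log 2 n\<close>; the exponent 3/4 absorbs the constants. What counts later
  is that it is below 1.\<close>

lemma separator_sublinear:
  "\<exists>N0. \<forall>(G :: 'v ugraph) S. simple_graph G \<longrightarrow> S \<subseteq> verts G \<longrightarrow> (\<forall>M. clique_model G M \<longrightarrow> card M \<le> 5) \<longrightarrow>
     N0 \<le> real (card S) \<longrightarrow>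
     (\<exists>R Y X. S = R \<union> Y \<union> X \<and> R \<inter> X = {} \<and> \<not> adjacent_sets G R X \<and>
        3 * card R \<le> 2 * card S \<and> 3 * card X \<le> 2 * card S \<and>
        real (card Y) \<le> real (card S) powr (3 / 4))"
proof -
  have "eventually (\<lambda>n::real. n powr (2 / 3) + (30 + 50 * ((n powr (1 / 3) + 1) * (log 2 n + 2)))
    \<le> n powr (3 / 4)) at_top"
    by real_asymp
  then obtain N1 where N1: "\<And>n::real. N1 \<le> n \<Longrightarrow>
    n powr (2 / 3) + (30 + 50 * ((n powr (1 / 3) + 1) * (log 2 n + 2))) \<le> n powr (3 / 4)"
    by (auto simp: eventually_at_top_linorder)
  show ?thesis
  proof (intro exI[of _ "max 1 N1"] allI impI)
    fix G :: "'v ugraph" and S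
    assume G: "simple_graph G" "S \<subseteq> verts G" "\<forall>M. clique_model G M \<longrightarrow> card M \<le> 5"
      and n: "max 1 N1 \<le> real (card S)"
    define n where "n = real (card S)"
    have n1: "1 \<le> n" "N1 \<le> n" using n by (simp_all add: n_def)
    define l where "l = nat \<lceil>n powr (1 / 3)\<rceil>"
    define k where "k = nat \<lfloor>log 2 n\<rfloor> + 1"
    have l_ge: "n powr (1 / 3) \<le> l" by (simp add: l_def)
    have l_le: "l \<le> n powr (1 / 3) + 1"
    proof -
      have "0 \<le> n powr (1 / 3)" by simp
      then show ?thesis unfolding l_def by linarith
    qed
    have "0 < n powr (1 / 3)" using n1 by simp
    then have lpos: "0 < l" using l_ge by linarith
    have log0: "0 \<le> log 2 n" using n1 by simp
    have k_le: "k \<le> log 2 n + 2" unfolding k_def using log0 by linarith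
    have k_ge: "log 2 n < k" unfolding k_def using log0 by linarith
    have "n < 2 powr k" using k_ge n1 by (simp add: log_less_iff)
    then have "card S < 2 ^ k" by (simp add: n_def powr_realpow)
    from separator[OF G(1,2) this lpos] G(3) obtain R Y X where
      RYX: "S = R \<union> Y \<union> X" "R \<inter> X = {}" "\<not> adjacent_sets G R X" "3 * card R \<le> 2 * card S"
        "3 * card X \<le> 2 * card S" "l * card Y \<le> card S + l * (30 + 50 * (l * k))"
      by metis
    have "real (l * card Y) \<le> real (card S + l * (30 + 50 * (l * k)))" using RYX(6) by (rule of_nat_mono)
    then have "real l * card Y \<le> n + real l * (30 + 50 * (l * k))" by (simp add: n_def)
    then have "card Y \<le> n / l + (30 + 50 * (real l * k))"
      using lpos by (simp add: field_simps)
    also have "n / l \<le> n / n powr (1 / 3)"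
      by (rule divide_left_mono[OF l_ge]) (use n1 lpos in auto)
    also have "n / n powr (1 / 3) = n powr (2 / 3)"
      using n1 powr_diff[of n 1 "1 / 3"] by simp
    also have "real l * k \<le> (n powr (1 / 3) + 1) * (log 2 n + 2)"
      by (rule mult_mono[OF l_le k_le]) auto
    finally have "card Y \<le> n powr (2 / 3) + (30 + 50 * ((n powr (1 / 3) + 1) * (log 2 n + 2)))"
      by simp
    also have "\<dots> \<le> n powr (3 / 4)" by (rule N1[OF n1(2)])
    finally have "real (card Y) \<le> real (card S) powr (3 / 4)" by (simp add: n_def)
    then show "\<exists>R Y X. S = R \<union> Y \<union> X \<and> R \<inter> X = {} \<and> \<not> adjacent_sets G R X \<and>
        3 * card R \<le> 2 * card S \<and> 3 * card X \<le> 2 * card S \<and>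
        real (card Y) \<le> real (card S) powr (3 / 4)"
      using RYX by blast
  qed
qed

section \<open>Recursive cutting into bounded pieces\<close>

lemma conn_in_split:
  assumes "conn_in G C" "C \<subseteq> R \<union> X" "\<not> adjacent_sets G R X"
  shows "C \<subseteq> R \<or> C \<subseteq> X"
proof -
  have RX: "y \<in> R \<Longrightarrow> {y, z} \<in> edges G \<Longrightarrow> z \<notin> X" and XR: "y \<in> X \<Longrightarrow> {y, z} \<in> edges G \<Longrightarrow> z \<notin> R" for y z
    using assms(3) by (auto simp: adjacent_sets_def insert_commute)
  obtain x where x: "x \<in> C" using assms(1) by (auto simp: conn_in_def)
  have reach: "(x, y) \<in> (adj_rel G \<inter> C \<times> C)\<^sup>*" if "y \<in> C" for y
    using assms(1) x that by (simp add: conn_in_def)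
  have R: "y \<in> R" if "x \<in> R" "y \<in> C" for y
    using reach[OF that(2)] by (induction rule: rtrancl_induct) (use that RX assms(2) in \<open>auto simp: adj_rel_def\<close>)
  have X: "y \<in> X" if "x \<in> X" "y \<in> C" for y
    using reach[OF that(2)] by (induction rule: rtrancl_induct) (use that XR assms(2) in \<open>auto simp: adj_rel_def\<close>)
  show ?thesis using R X x assms(2) by blast
qed

text \<open>Level \<open>i\<close> treats sets of at most \<open>K * (3 / 2) ^ i\<close> vertices.
  Both sides of a separator shrink to two thirds and so drop a level. They are disjoint, so the
  lower levels together spend no more than their rates times \<open>card S\<close>, and the rates of
  the levels simply add up.\<close>

lemma fragmentation:
  fixes G :: "'v ugraph" and \<rho> :: "nat \<Rightarrow> real"
  assumes sg: "simple_graph G" and \<rho>: "\<And>j. 0 \<le> \<rho> j"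
    and sep: "\<And>S i. S \<subseteq> verts G \<Longrightarrow> K * (3 / 2) ^ i < real (card S) \<Longrightarrow>
      \<exists>R Y X. S = R \<union> Y \<union> X \<and> R \<inter> X = {} \<and> \<not> adjacent_sets G R X \<and>
        3 * card R \<le> 2 * card S \<and> 3 * card X \<le> 2 * card S \<and> real (card Y) \<le> \<rho> i * card S"
  shows "S \<subseteq> verts G \<Longrightarrow> real (card S) \<le> K * (3 / 2) ^ i \<Longrightarrow>
    \<exists>Y\<subseteq>S. real (card Y) \<le> (\<Sum>j<i. \<rho> j) * card S \<and> (\<forall>C\<subseteq>S - Y. conn_in G C \<longrightarrow> real (card C) \<le> K)"
proof (induction i arbitrary: S)
  case 0
  have finS: "finite S" using 0(1) finite_verts[OF sg] by (rule finite_subset)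
  have "real (card C) \<le> K" if "C \<subseteq> S" for C
    using card_mono[OF finS that] 0(2) by simp
  then show ?case by (intro exI[of _ "{}"]) auto
next
  case (Suc i)
  have finS: "finite S" using Suc.prems(1) finite_verts[OF sg] by (rule finite_subset)
  show ?case
  proof (cases "real (card S) \<le> K * (3 / 2) ^ i")
    case True
    then obtain Y where Y: "Y \<subseteq> S" "real (card Y) \<le> (\<Sum>j<i. \<rho> j) * card S"
      "\<forall>C\<subseteq>S - Y. conn_in G C \<longrightarrow> real (card C) \<le> K"
      using Suc.IH[OF Suc.prems(1)] by blast
    have "(\<Sum>j<i. \<rho> j) * card S \<le> (\<Sum>j<Suc i. \<rho> j) * card S"
      by (rule mult_right_mono) (use \<rho> in auto)
    then show ?thesis using Y by (intro exI[of _ Y]) auto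
  next
    case False
    then obtain R Y X where RYX: "S = R \<union> Y \<union> X" "R \<inter> X = {}" "\<not> adjacent_sets G R X"
      "3 * card R \<le> 2 * card S" "3 * card X \<le> 2 * card S" "real (card Y) \<le> \<rho> i * card S"
      using sep[OF Suc.prems(1), of i] by (auto simp: not_le)
    have small: "real (card Z) \<le> K * (3 / 2) ^ i" if "3 * card Z \<le> 2 * card S" for Z :: "'v set"
    proof -
      have "3 * real (card Z) \<le> 2 * real (card S)" using of_nat_mono[OF that, where 'a = real] by simp
      then show ?thesis using Suc.prems(2) by simp
    qed
    obtain Y1 where Y1: "Y1 \<subseteq> R" "real (card Y1) \<le> (\<Sum>j<i. \<rho> j) * card R"
      "\<forall>C\<subseteq>R - Y1. conn_in G C \<longrightarrow> real (card C) \<le> K"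
      using Suc.IH[of R] Suc.prems(1) RYX(1) small[OF RYX(4)] by blast
    obtain Y2 where Y2: "Y2 \<subseteq> X" "real (card Y2) \<le> (\<Sum>j<i. \<rho> j) * card X"
      "\<forall>C\<subseteq>X - Y2. conn_in G C \<longrightarrow> real (card C) \<le> K"
      using Suc.IH[of X] Suc.prems(1) RYX(1) small[OF RYX(5)] by blast
    let ?Y = "Y \<union> Y1 \<union> Y2"
    have "?Y \<subseteq> S" using RYX(1) Y1(1) Y2(1) by blast
    moreover have "real (card ?Y) \<le> (\<Sum>j<Suc i. \<rho> j) * card S"
    proof -
      have "card ?Y \<le> card Y + card Y1 + card Y2"
        by (meson card_Un_le add_le_mono1 le_trans)
      then have "real (card ?Y) \<le> real (card Y) + real (card Y1) + real (card Y2)" by linarith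
      also have "\<dots> \<le> \<rho> i * card S + (\<Sum>j<i. \<rho> j) * card R + (\<Sum>j<i. \<rho> j) * card X"
        using RYX(6) Y1(2) Y2(2) by simp
      also have "\<dots> = \<rho> i * card S + (\<Sum>j<i. \<rho> j) * real (card R + card X)" by (simp add: algebra_simps)
      also have "\<dots> \<le> \<rho> i * card S + (\<Sum>j<i. \<rho> j) * real (card S)"
      proof -
        have "card R + card X = card (R \<union> X)"
          by (rule card_Un_disjoint[symmetric]) (use finS RYX(1,2) in auto)
        also have "\<dots> \<le> card S" by (rule card_mono[OF finS]) (use RYX(1) in blast)
        finally have "real (card R + card X) \<le> real (card S)" by (rule of_nat_mono)
        then have "(\<Sum>j<i. \<rho> j) * real (card R + card X) \<le> (\<Sum>j<i. \<rho> j) * real (card S)"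
          by (rule mult_left_mono) (use \<rho> in \<open>auto intro: sum_nonneg\<close>)
        then show ?thesis by simp
      qed
      finally show ?thesis by (simp add: algebra_simps)
    qed
    moreover have "real (card C) \<le> K" if C: "C \<subseteq> S - ?Y" "conn_in G C" for C
    proof -
      have "C \<subseteq> R \<union> X" using C(1) RYX(1) by blast
      then have "C \<subseteq> R \<or> C \<subseteq> X" by (rule conn_in_split[OF C(2) _ RYX(3)])
      then have "C \<subseteq> R - Y1 \<or> C \<subseteq> X - Y2" using C(1) by blast
      then show ?thesis using Y1(3) Y2(3) C(2) by blast
    qed
    ultimately show ?thesis by blast
  qed
qed

text \<open>Cutting costs \<open>card S powr (- 1 / 4)\<close> per vertex, and the sizes shrink geometrically, so the total cost
  per vertex is a convergent geometric series dominated by its term at the smallest scale \<open>K\<close>.\<close>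

lemma small_fragmentation:
  assumes "0 < (\<eta>::real)"
  shows "\<exists>K\<ge>1::nat. \<forall>(G :: 'v ugraph) S. simple_graph G \<longrightarrow> S \<subseteq> verts G \<longrightarrow>
     (\<forall>M. clique_model G M \<longrightarrow> card M \<le> 5) \<longrightarrow>
     (\<exists>Y\<subseteq>S. real (card Y) \<le> \<eta> * card S \<and> (\<forall>C\<subseteq>S - Y. conn_in G C \<longrightarrow> card C \<le> K))"
proof -
  obtain N0 :: real where N0: "\<And>(G :: 'v ugraph) S. simple_graph G \<Longrightarrow> S \<subseteq> verts G \<Longrightarrow>
     (\<forall>M. clique_model G M \<longrightarrow> card M \<le> 5) \<Longrightarrow> N0 \<le> real (card S) \<Longrightarrow>
     (\<exists>R Y X. S = R \<union> Y \<union> X \<and> R \<inter> X = {} \<and> \<not> adjacent_sets G R X \<and>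
        3 * card R \<le> 2 * card S \<and> 3 * card X \<le> 2 * card S \<and>
        real (card Y) \<le> real (card S) powr (3 / 4))"
    using separator_sublinear by blast
  \<comment> \<open>A separator of size \<open>n powr (3 / 4)\<close> costs
    \<open>n powr (- 1 / 4)\<close> per vertex, and \<open>q\<close> is the factor by which this
    drops when the size grows by 3/2.\<close>
  define q where "q = (3 / 2 :: real) powr (- 1 / 4)"
  have q: "0 < q" "q < 1" unfolding q_def using powr_less_one[of "3 / 2" "- 1 / 4"] by auto
  have "eventually (\<lambda>K::real. K powr (- 1 / 4) \<le> \<eta> * (1 - q)) at_top"
  proof -
    have "((\<lambda>K::real. K powr (- 1 / 4)) \<longlongrightarrow> 0) at_top" by real_asymp
    moreover have "0 < \<eta> * (1 - q)" using assms q by simp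
    ultimately have "eventually (\<lambda>K::real. K powr (- 1 / 4) < \<eta> * (1 - q)) at_top"
      by (rule order_tendstoD)
    then show ?thesis by eventually_elim simp
  qed
  then obtain K1 where K1: "\<And>K::real. K1 \<le> K \<Longrightarrow> K powr (- 1 / 4) \<le> \<eta> * (1 - q)"
    by (auto simp: eventually_at_top_linorder)
  \<comment> \<open>Above \<open>N0\<close> the sublinear separators exist, and above
    \<open>K1\<close> the rate at level 0 is at most \<open>\<eta> * (1 - q)\<close>, so that the
    geometric series stays below \<open>\<eta>\<close>.\<close>
  define K where "K = nat \<lceil>max 1 (max N0 K1)\<rceil>"
  have K: "1 \<le> real K" "N0 \<le> real K" "K1 \<le> real K" unfolding K_def by linarith+
  define \<rho> where "\<rho> i = real K powr (- 1 / 4) * q ^ i" for i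
  show ?thesis
  proof (intro exI[of _ K] conjI allI impI)
    show "1 \<le> K" using K(1) by simp
    fix G :: "'v ugraph" and S assume G: "simple_graph G" "S \<subseteq> verts G" "\<forall>M. clique_model G M \<longrightarrow> card M \<le> 5"
    have sep: "\<exists>R Y X. S = R \<union> Y \<union> X \<and> R \<inter> X = {} \<and> \<not> adjacent_sets G R X \<and>
        3 * card R \<le> 2 * card S \<and> 3 * card X \<le> 2 * card S \<and> real (card Y) \<le> \<rho> i * card S"
      if S: "S \<subseteq> verts G" "real K * (3 / 2) ^ i < real (card S)" for S i
    proof -
      have "real K \<le> real K * (3 / 2) ^ i" using K(1) by simp
      then have n: "real K \<le> real (card S)" using S(2) by linarith
      then have npos: "0 < real (card S)" using K(1) by linarith
      have "N0 \<le> real (card S)" using K(2) n by linarith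
      from N0[OF G(1) S(1) G(3) this] obtain R Y X where RYX: "S = R \<union> Y \<union> X" "R \<inter> X = {}"
        "\<not> adjacent_sets G R X" "3 * card R \<le> 2 * card S" "3 * card X \<le> 2 * card S"
        "real (card Y) \<le> real (card S) powr (3 / 4)" by blast
      have "real (card S) powr (3 / 4) = real (card S) powr (- 1 / 4) * real (card S)"
        using npos powr_add[of "real (card S)" "- 1 / 4" 1] by simp
      also have "real (card S) powr (- 1 / 4) \<le> (real K * (3 / 2) ^ i) powr (- 1 / 4)"
        by (rule powr_mono2') (use S(2) K(1) in auto)
      also have "(real K * (3 / 2) ^ i) powr (- 1 / 4) = \<rho> i"
        unfolding \<rho>_def q_def using K(1)
        by (simp add: powr_mult powr_powr mult.commute flip: powr_realpow)
      finally have "real (card S) powr (3 / 4) \<le> \<rho> i * card S" using npos by simp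
      then have "real (card Y) \<le> \<rho> i * card S" using RYX(6) by linarith
      then show ?thesis using RYX by blast
    qed
    have \<rho>0: "0 \<le> \<rho> j" for j unfolding \<rho>_def using q by simp
    \<comment> \<open>The number of levels depends on \<open>S\<close>; the bound on the total cost
      per vertex does not.\<close>
    obtain i where i: "real (card S) < (3 / 2) ^ i" using real_arch_pow[of "3 / 2" "real (card S)"] by auto
    have leK: "real (card S) \<le> real K * (3 / 2) ^ i"
    proof -
      have "1 * (3 / 2) ^ i \<le> real K * (3 / 2 :: real) ^ i" by (rule mult_right_mono[OF K(1)]) simp
      then show ?thesis using i by linarith
    qed
    have "\<exists>Y\<subseteq>S. real (card Y) \<le> (\<Sum>j<i. \<rho> j) * card S \<and> (\<forall>C\<subseteq>S - Y. conn_in G C \<longrightarrow> real (card C) \<le> real K)"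
      by (rule fragmentation[where \<rho> = \<rho>, OF G(1) \<rho>0 _ G(2) leK]) (rule sep)
    then obtain Y where Y: "Y \<subseteq> S" "real (card Y) \<le> (\<Sum>j<i. \<rho> j) * card S"
      "\<forall>C\<subseteq>S - Y. conn_in G C \<longrightarrow> real (card C) \<le> real K" by (elim exE conjE)
    have "(\<Sum>j<i. \<rho> j) = real K powr (- 1 / 4) * (\<Sum>j<i. q ^ j)" by (simp add: \<rho>_def sum_distrib_left)
    also have "(\<Sum>j<i. q ^ j) = (1 - q ^ i) / (1 - q)" using q by (simp add: sum_gp_strict)
    also have "real K powr (- 1 / 4) * ((1 - q ^ i) / (1 - q)) \<le> (\<eta> * (1 - q)) * (1 / (1 - q))"
      by (rule mult_mono[OF K1[OF K(3)] divide_right_mono]) (use q assms in \<open>auto simp: power_le_one\<close>)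
    also have "\<dots> = \<eta>" using q by simp
    finally have "(\<Sum>j<i. \<rho> j) * card S \<le> \<eta> * card S" by (rule mult_right_mono) simp
    then have "real (card Y) \<le> \<eta> * card S" using Y(2) by linarith
    then show "\<exists>Y\<subseteq>S. real (card Y) \<le> \<eta> * card S \<and> (\<forall>C\<subseteq>S - Y. conn_in G C \<longrightarrow> card C \<le> K)"
      using Y(1,3) by (intro exI[of _ Y]) auto
  qed
qed

section \<open>Hyperfiniteness and closure properties of planar graphs\<close>

lemma conn_in_component:
  assumes "simple_graph G" "x \<in> verts G"
  shows "conn_in G (component_of G x)"
proof (rule conn_in_from[of x])
  let ?C = "component_of G x"
  show "x \<in> ?C" using assms(2) by (rule self_in_component)
  show "?C \<subseteq> verts G" by (auto simp: component_of_def)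
  fix y assume "y \<in> ?C"
  from this assms(1) show "(x, y) \<in> (adj_rel G \<inter> ?C \<times> ?C)\<^sup>*"
  proof (induction rule: component_of_induct)
    case (step y z)
    then have "(y, z) \<in> adj_rel G \<inter> ?C \<times> ?C" by (simp add: adj_rel_def)
    then show ?case using step.IH by (meson rtrancl.rtrancl_into_rtrancl)
  qed simp
qed

lemma component_without_edge:
  assumes "simple_graph G" "\<And>y. {x, y} \<notin> edges G"
  shows "component_of G x \<subseteq> {x}"
proof
  fix y assume "y \<in> component_of G x"
  from this assms(1) show "y \<in> {x}"
    by (induction rule: component_of_induct) (use assms(2) in auto)
qed

text \<open>Hyperfiniteness measures a cut against the number of edges, so only vertices that have
  an edge are fragmented, at most \<open>2 * card (edges G)\<close> of them. Removing the edges at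
  \<open>Y\<close> costs at most \<open>d * card Y\<close>, which explains
  \<open>\<eta> = \<epsilon> / (2 * d)\<close>.\<close>

lemma planar_hyperfinite:
  assumes "0 < d"
  shows "hyperfinite {G :: 'v ugraph. G \<in> Gr d \<and> planar G}"
  unfolding hyperfinite_def
proof (intro allI impI)
  fix \<epsilon> :: real assume "0 < \<epsilon>"
  define \<eta> where "\<eta> = \<epsilon> / (2 * d)"
  have "0 < \<eta>" using \<open>0 < \<epsilon>\<close> assms by (simp add: \<eta>_def)
  from small_fragmentation[OF this] obtain K where "1 \<le> K" and
    K: "\<forall>(G :: 'v ugraph) S. simple_graph G \<longrightarrow> S \<subseteq> verts G \<longrightarrow> (\<forall>M. clique_model G M \<longrightarrow> card M \<le> 5) \<longrightarrow>
     (\<exists>Y\<subseteq>S. real (card Y) \<le> \<eta> * card S \<and> (\<forall>C\<subseteq>S - Y. conn_in G C \<longrightarrow> card C \<le> K))"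
    by (elim exE conjE)
  have "hyperfinite_graph \<epsilon> K G" if G: "G \<in> Gr d" "planar G" for G :: "'v ugraph"
  proof -
    have sg: "simple_graph G" using G GrD by blast
    let ?E = "edges G" and ?S = "\<Union>(edges G)"
    have SV: "?S \<subseteq> verts G" using sg by (auto simp: simple_graph_def)
    have finS: "finite ?S" using SV finite_verts[OF sg] by (rule finite_subset)
    have "\<forall>M. clique_model G M \<longrightarrow> card M \<le> 5" using planar_clique_model_le_5[OF sg G(2)] by blast
    then have "\<exists>Y\<subseteq>?S. real (card Y) \<le> \<eta> * card ?S \<and> (\<forall>C\<subseteq>?S - Y. conn_in G C \<longrightarrow> card C \<le> K)"
      using K sg SV by simp
    then obtain Y where Y: "Y \<subseteq> ?S" "real (card Y) \<le> \<eta> * card ?S"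
      "\<forall>C\<subseteq>?S - Y. conn_in G C \<longrightarrow> card C \<le> K" by (elim exE conjE)
    define W where "W = {e \<in> ?E. e \<inter> Y \<noteq> {}}"
    have WE: "W \<subseteq> ?E" by (auto simp: W_def)
    have "card W \<le> d * card Y"
      unfolding W_def by (rule card_incident_edges[OF G(1)]) (rule finite_subset[OF Y(1) finS])
    then have "real (card W) \<le> d * real (card Y)" by (metis of_nat_mono of_nat_mult)
    also have "\<dots> \<le> d * (\<eta> * card ?S)" by (rule mult_left_mono[OF Y(2)]) simp
    also have "\<dots> \<le> d * (\<eta> * (2 * real (card ?E)))"
    proof (intro mult_left_mono)
      show "real (card ?S) \<le> 2 * real (card ?E)" using card_Union_edges[OF sg order_refl] by linarith
    qed (use \<open>0 < \<eta>\<close> in auto)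
    also have "\<dots> = \<epsilon> * card ?E" using assms by (simp add: \<eta>_def)
    finally have cW: "real (card W) \<le> \<epsilon> * card ?E" .
    have "card (component_of (with_edges G (?E - W)) x) \<le> K" if x: "x \<in> verts G" for x
    proof -
      let ?G = "with_edges G (?E - W)"
      let ?C = "component_of ?G x"
      have sG: "simple_graph ?G" using sg by (auto simp: simple_graph_def)
      \<comment> \<open>A vertex without surviving edge, possibly in \<open>Y\<close>, is a
        component by itself, and \<open>1 \<le> K\<close> covers it. Otherwise every vertex of the
        component has a surviving edge and therefore lies outside \<open>Y\<close>.\<close>
      show ?thesis
      proof (cases "\<exists>y. {x, y} \<in> edges ?G")
        case True
        then obtain y0 where y0: "{x, y0} \<in> edges ?G" by (elim exE)
        have kept: "z \<in> ?S - Y" if "{z, y} \<in> edges ?G" for z y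
          using that by (auto simp: W_def)
        have "?C \<subseteq> ?S - Y"
        proof
          fix z assume "z \<in> ?C"
          from this sG show "z \<in> ?S - Y"
          proof (induction rule: component_of_induct)
            case base
            show ?case by (rule kept[OF y0])
          next
            case (step y z)
            then have "{z, y} \<in> edges ?G" by (simp add: insert_commute)
            then show ?case by (rule kept)
          qed
        qed
        moreover have "conn_in G ?C"
          by (rule conn_in_mono[OF conn_in_component[OF sG]]) (use x in auto)
        ultimately show ?thesis using Y(3) by simp
      next
        case False
        then have "?C \<subseteq> {x}" by (intro component_without_edge[OF sG]) blast
        then have "card ?C \<le> card {x}" by (rule card_mono[rotated]) simp
        then show ?thesis using \<open>1 \<le> K\<close> by simp
      qed
    qed
    then show ?thesis using WE cW unfolding hyperfinite_graph_def by blast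
  qed
  then show "\<exists>K\<ge>1. \<forall>G\<in>{G :: 'v ugraph. G \<in> Gr d \<and> planar G}. hyperfinite_graph \<epsilon> K G"
    using \<open>1 \<le> K\<close> by blast
qed

section \<open>Planarity under subgraphs, isomorphisms and disjoint unions\<close>

lemma drawing_subgraph:
  assumes "drawing G p \<gamma>" "subgraph H G"
  shows "drawing H p \<gamma>"
proof -
  interpret drawing G p \<gamma> by fact
  have s: "simple_graph H" "verts H \<subseteq> verts G" "edges H \<subseteq> edges G"
    using assms(2) by (auto simp: subgraph_def)
  show ?thesis
  proof
    show "inj_on p (verts H)" by (rule inj_on_subset[OF inj s(2)])
    fix e e' assume "e \<in> edges H" "e' \<in> edges H" "e \<noteq> e'"
    then show "path_image (\<gamma> e) \<inter> path_image (\<gamma> e') \<subseteq> p ` (e \<inter> e')" using s by (intro edge_cross) auto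
  qed (use s edge_arc edge_ends edge_vertex in \<open>simp_all add: subset_eq\<close>)
qed

lemma planar_monotone: "monotone_property {G. G \<in> Gr d \<and> planar G}"
  unfolding monotone_property_def
proof (intro ballI allI impI)
  fix G H :: "'v ugraph" assume "G \<in> {G. G \<in> Gr d \<and> planar G}" and H: "subgraph H G"
  then have G: "G \<in> Gr d" "planar G" by auto
  then obtain p \<gamma> where "drawing G p \<gamma>" using planar_iff_drawing[OF GrD(1)] by blast
  then have "drawing H p \<gamma>" using H by (rule drawing_subgraph)
  then have "planar H" using planar_iff_drawing drawing.simple by blast
  then show "H \<in> {G. G \<in> Gr d \<and> planar G}" using subgraph_in_Gr[OF H G(1)] by simp
qed

lemma graph_iso_Gr:
  assumes "G \<in> Gr d" "graph_iso f G H" "simple_graph H"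
  shows "H \<in> Gr d"
proof -
  have sg: "simple_graph G" using assms GrD by blast
  have f: "bij_betw f (verts G) (verts H)" "edges H = (\<lambda>e. f ` e) ` edges G"
    using assms(2) by (auto simp: graph_iso_def)
  have "vdegree H w \<le> d" if w: "w \<in> verts H" for w
  proof -
    obtain v where v: "v \<in> verts G" "w = f v" using f(1) w by (auto simp: bij_betw_def)
    have "{e \<in> edges H. w \<in> e} \<subseteq> (\<lambda>e. f ` e) ` {e \<in> edges G. v \<in> e}"
    proof
      fix e' assume "e' \<in> {e \<in> edges H. w \<in> e}"
      then obtain e where e: "e \<in> edges G" "e' = f ` e" "f v \<in> f ` e" using f(2) v by auto
      have "e \<subseteq> verts G" using sg e(1) by (auto simp: simple_graph_def)
      then have "v \<in> e" using e(3) v(1) f(1) by (auto simp: bij_betw_def inj_on_def)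
      then show "e' \<in> (\<lambda>e. f ` e) ` {e \<in> edges G. v \<in> e}" using e by blast
    qed
    then have "vdegree H w \<le> card ((\<lambda>e. f ` e) ` {e \<in> edges G. v \<in> e})"
      unfolding vdegree_def by (rule card_mono[rotated]) (use finite_edges[OF sg] in simp)
    also have "\<dots> \<le> vdegree G v"
      unfolding vdegree_def by (rule card_image_le) (use finite_edges[OF sg] in simp)
    also have "\<dots> \<le> d" using GrD(2)[OF assms(1) v(1)] .
    finally show ?thesis .
  qed
  then show ?thesis using assms(3) by (simp add: Gr_def)
qed

lemma drawing_iso:
  assumes "drawing G p \<gamma>" and sH: "simple_graph H" and iso: "graph_iso f G H"
  shows "drawing H (p \<circ> inv_into (verts G) f) (\<lambda>e. \<gamma> (inv_into (verts G) f ` e))"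
proof -
  interpret drawing G p \<gamma> by fact
  let ?g = "inv_into (verts G) f"
  have f: "bij_betw f (verts G) (verts H)" "edges H = (\<lambda>e. f ` e) ` edges G"
    using iso by (auto simp: graph_iso_def)
  have gbij: "bij_betw ?g (verts H) (verts G)" using f(1) by (rule bij_betw_inv_into)
  have fi: "inj_on f (verts G)" using f(1) by (simp add: bij_betw_def)
  have gf: "?g ` (f ` e) = e" if "e \<subseteq> verts G" for e
    using inv_into_image_cancel[OF fi that] .
  have EV: "e \<subseteq> verts G" if "e \<in> edges G" for e using simple that by (auto simp: simple_graph_def)
  have edge: "?g ` e' \<in> edges G" "e' = f ` (?g ` e')" if "e' \<in> edges H" for e'
  proof -
    from that obtain e where e: "e \<in> edges G" "e' = f ` e" unfolding f(2) by blast
    then have "?g ` e' = e" using gf EV by simp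
    then show "?g ` e' \<in> edges G" "e' = f ` (?g ` e')" using e by simp_all
  qed
  show ?thesis
  proof
    show "simple_graph H" by fact
    show "inj_on (p \<circ> ?g) (verts H)"
      using gbij inj by (auto simp: bij_betw_def intro: comp_inj_on)
    fix e assume e: "e \<in> edges H"
    show "arc (\<gamma> (?g ` e))" using edge_arc edge e by blast
    show "{pathstart (\<gamma> (?g ` e)), pathfinish (\<gamma> (?g ` e))} = (p \<circ> ?g) ` e"
      using edge_ends[OF edge(1)[OF e]] by (simp add: image_comp)
    {
      fix w assume w: "w \<in> verts H" "(p \<circ> ?g) w \<in> path_image (\<gamma> (?g ` e))"
      have "?g w \<in> verts G" using gbij w(1) by (auto simp: bij_betw_def)
      then have "?g w \<in> ?g ` e" using edge_vertex[OF edge(1)[OF e]] w(2) by simp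
      then have "f (?g w) \<in> f ` (?g ` e)" by blast
      moreover have "f (?g w) = w" using f(1) w(1) by (simp add: bij_betw_inv_into_right)
      ultimately show "w \<in> e" using edge(2)[OF e] by simp
    next
      fix e' assume e': "e' \<in> edges H" "e \<noteq> e'"
      have "?g ` e \<noteq> ?g ` e'" using edge(2)[OF e] edge(2)[OF e'(1)] e'(2) by metis
      then have "path_image (\<gamma> (?g ` e)) \<inter> path_image (\<gamma> (?g ` e')) \<subseteq> p ` (?g ` e \<inter> ?g ` e')"
        by (rule edge_cross[OF edge(1)[OF e] edge(1)[OF e'(1)]])
      also have "?g ` e \<inter> ?g ` e' = ?g ` (e \<inter> e')"
      proof (rule inj_on_image_Int[symmetric])
        show "inj_on ?g (verts H)" using gbij by (simp add: bij_betw_def)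
        show "e \<subseteq> verts H" "e' \<subseteq> verts H" using e e' sH by (auto simp: simple_graph_def)
      qed
      finally show "path_image (\<gamma> (?g ` e)) \<inter> path_image (\<gamma> (?g ` e')) \<subseteq> (p \<circ> ?g) ` (e \<inter> e')"
        by (simp add: image_comp)
    }
  qed
qed

lemma planar_graph_property: "graph_property d {G. G \<in> Gr d \<and> planar G}"
  unfolding graph_property_def
proof (intro conjI ballI allI impI)
  fix G H :: "'v ugraph" and f
  assume "G \<in> {G. G \<in> Gr d \<and> planar G}" "simple_graph H \<and> graph_iso f G H"
  then have G: "G \<in> Gr d" "planar G" "simple_graph H" "graph_iso f G H" by auto
  obtain p \<gamma> where "drawing G p \<gamma>" using planar_iff_drawing[OF GrD(1)[OF G(1)]] G(2) by blast
  from drawing_iso[OF this G(3,4)] have "planar H" using planar_iff_drawing[OF G(3)] by blast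
  then show "H \<in> {G. G \<in> Gr d \<and> planar G}" using graph_iso_Gr[OF G(1,4,3)] by simp
qed auto

lemma graph_union_Gr:
  assumes "G \<in> Gr d" "H \<in> Gr d" "verts G \<inter> verts H = {}"
  shows "graph_union G H \<in> Gr d"
proof -
  have sG: "simple_graph G" and sH: "simple_graph H" using assms GrD by auto
  have E: "e \<subseteq> verts G" if "e \<in> edges G" for e using sG that by (auto simp: simple_graph_def)
  have E': "e \<subseteq> verts H" if "e \<in> edges H" for e using sH that by (auto simp: simple_graph_def)
  have "simple_graph (graph_union G H)"
    using sG sH by (auto simp: simple_graph_def graph_union_def)
  moreover have "vdegree (graph_union G H) v \<le> d" if "v \<in> verts G" for v
  proof -
    have "{e \<in> edges G \<union> edges H. v \<in> e} = {e \<in> edges G. v \<in> e}" using that E' assms(3) by blast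
    then show ?thesis using GrD(2)[OF assms(1) that] by (simp add: vdegree_def graph_union_def)
  qed
  moreover have "vdegree (graph_union G H) v \<le> d" if "v \<in> verts H" for v
  proof -
    have "{e \<in> edges G \<union> edges H. v \<in> e} = {e \<in> edges H. v \<in> e}" using that E assms(3) by blast
    then show ?thesis using GrD(2)[OF assms(2) that] by (simp add: vdegree_def graph_union_def)
  qed
  ultimately show ?thesis by (auto simp: Gr_def graph_union_def)
qed

text \<open>Finitely many points and compact arcs fit into a disc, which leaves room for a second
  drawing beside it.\<close>

lemma (in drawing) drawing_bounded:
  "\<exists>M. (\<forall>v\<in>verts G. norm (p v) \<le> M) \<and> (\<forall>e\<in>edges G. \<forall>q\<in>path_image (\<gamma> e). norm q \<le> M)"
proof -
  have "bounded (\<Union>e\<in>edges G. path_image (\<gamma> e))"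
    using finite_edges[OF simple] edge_arc
    by (intro bounded_UN) (auto intro: compact_imp_bounded compact_arc_image)
  moreover have "bounded (p ` verts G)" using finite_verts[OF simple] by (simp add: finite_imp_bounded)
  ultimately have "bounded (p ` verts G \<union> (\<Union>e\<in>edges G. path_image (\<gamma> e)))" by simp
  then obtain M where "\<forall>q\<in>p ` verts G \<union> (\<Union>e\<in>edges G. path_image (\<gamma> e)). norm q \<le> M"
    unfolding bounded_iff by blast
  then show ?thesis by (intro exI[of _ M]) blast
qed

lemma drawing_union:
  assumes "drawing G p1 \<gamma>1" and "drawing H p2 \<gamma>2" and disj: "verts G \<inter> verts H = {}"
  shows "\<exists>p \<gamma>. drawing (graph_union G H) p \<gamma>"
proof -
  interpret d1: drawing G p1 \<gamma>1 by fact
  interpret d2: drawing H p2 \<gamma>2 by fact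
  note sG = d1.simple and sH = d2.simple
  obtain M1 where "\<forall>v\<in>verts G. norm (p1 v) \<le> M1" "\<forall>e\<in>edges G. \<forall>q\<in>path_image (\<gamma>1 e). norm q \<le> M1"
    using d1.drawing_bounded by (elim exE conjE)
  then have M1: "\<And>v. v \<in> verts G \<Longrightarrow> norm (p1 v) \<le> M1"
    "\<And>e q. e \<in> edges G \<Longrightarrow> q \<in> path_image (\<gamma>1 e) \<Longrightarrow> norm q \<le> M1" by auto
  obtain M2 where "\<forall>v\<in>verts H. norm (p2 v) \<le> M2" "\<forall>e\<in>edges H. \<forall>q\<in>path_image (\<gamma>2 e). norm q \<le> M2"
    using d2.drawing_bounded by (elim exE conjE)
  then have M2: "\<And>v. v \<in> verts H \<Longrightarrow> norm (p2 v) \<le> M2"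
    "\<And>e q. e \<in> edges H \<Longrightarrow> q \<in> path_image (\<gamma>2 e) \<Longrightarrow> norm q \<le> M2" by auto
  \<comment> \<open>A translation longer than both radii together separates the two drawings; the
    absolute values make the signs of the bounds irrelevant.\<close>
  define c :: complex where "c = of_real (\<bar>M1\<bar> + \<bar>M2\<bar> + 1)"
  have far: "x \<noteq> c + y" if "norm x \<le> M1" "norm y \<le> M2" for x y
  proof
    assume "x = c + y"
    then have "c = x - y" by simp
    then have "norm c \<le> norm x + norm y" by (simp add: norm_triangle_ineq4)
    moreover have "norm c = \<bar>M1\<bar> + \<bar>M2\<bar> + 1" unfolding c_def norm_of_real by simp
    ultimately show False using that by linarith
  qed
  define p where "p v = (if v \<in> verts G then p1 v else c + p2 v)" for v
  define \<gamma> where "\<gamma> e = (if e \<in> edges G then \<gamma>1 e else (\<lambda>x. c + x) \<circ> \<gamma>2 e)" for e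
  have E: "e \<subseteq> verts G" if "e \<in> edges G" for e using sG that by (auto simp: simple_graph_def)
  have E': "e \<subseteq> verts H" if "e \<in> edges H" for e using sH that by (auto simp: simple_graph_def)
  \<comment> \<open>Edges are nonempty, so disjoint vertex sets have disjoint edge sets and the case
    distinction in \<open>\<gamma>\<close> is unambiguous.\<close>
  have ne: "e \<notin> edges G" if eH: "e \<in> edges H" for e
  proof
    assume "e \<in> edges G"
    then have "e = {}" using E[of e] E'[OF that] disj by blast
    moreover obtain u v where "e = {u, v}" by (rule simple_graph_edgeE[OF sH eH])
    ultimately show False by simp
  qed
  have p1': "p v = p1 v" if "v \<in> verts G" for v using that by (simp add: p_def)
  have p2': "p v = c + p2 v" if "v \<in> verts H" for v using that disj by (auto simp: p_def)
  have p1i: "p ` A = p1 ` A" if "A \<subseteq> verts G" for A using that p1' by (intro image_cong) auto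
  have p2i: "p ` A = (\<lambda>x. c + x) ` p2 ` A" if "A \<subseteq> verts H" for A
    unfolding image_image using that p2' by (intro image_cong) auto
  have g1: "\<gamma> e = \<gamma>1 e" if "e \<in> edges G" for e using that by (simp add: \<gamma>_def)
  have g2: "\<gamma> e = (\<lambda>x. c + x) \<circ> \<gamma>2 e" if "e \<in> edges H" for e using ne[OF that] by (simp add: \<gamma>_def)
  have im2: "path_image (\<gamma> e) = (\<lambda>x. c + x) ` path_image (\<gamma>2 e)" if "e \<in> edges H" for e
    unfolding g2[OF that] by (rule path_image_translation)
  have apart: "path_image (\<gamma> e) \<inter> path_image (\<gamma> e') = {}" if "e \<in> edges G" "e' \<in> edges H" for e e'
    unfolding g1[OF that(1)] im2[OF that(2)] using far M1(2)[OF that(1)] M2(2)[OF that(2)] by blast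
  have "drawing (graph_union G H) p \<gamma>"
    unfolding graph_union_def
  proof (unfold_locales, unfold ugraph.select_convs)
    show "simple_graph \<lparr>verts = verts G \<union> verts H, edges = edges G \<union> edges H\<rparr>"
      using sG sH by (auto simp: simple_graph_def)
    show "inj_on p (verts G \<union> verts H)"
    proof (rule inj_onI)
      fix v w assume "v \<in> verts G \<union> verts H" "w \<in> verts G \<union> verts H" and eq: "p v = p w"
      then consider "v \<in> verts G" "w \<in> verts G" | "v \<in> verts H" "w \<in> verts H"
        | "v \<in> verts G" "w \<in> verts H" | "v \<in> verts H" "w \<in> verts G" by blast
      then show "v = w"
      proof cases
        case 1
        then show ?thesis using eq p1' inj_onD[OF d1.inj] by simp
      next
        case 2
        then show ?thesis using eq p2' inj_onD[OF d2.inj] by simp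
      next
        case 3
        then show ?thesis using eq p1'[of v] p2'[of w] far[OF M1(1) M2(1)] by simp
      next
        case 4
        then show ?thesis using eq p1'[of w] p2'[of v] far[OF M1(1) M2(1), of w v] by simp
      qed
    qed
    fix e assume e: "e \<in> edges G \<union> edges H"
    show "arc (\<gamma> e)" using e d1.edge_arc d2.edge_arc g1 g2 by (auto simp: arc_translation_eq)
    show "{pathstart (\<gamma> e), pathfinish (\<gamma> e)} = p ` e"
    proof (cases "e \<in> edges G")
      case True
      then show ?thesis using d1.edge_ends g1 p1i[OF E] by simp
    next
      case False
      then have eH: "e \<in> edges H" using e by blast
      have "p ` e = (\<lambda>x. c + x) ` {pathstart (\<gamma>2 e), pathfinish (\<gamma>2 e)}"
        unfolding p2i[OF E'[OF eH]] d2.edge_ends[OF eH] ..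
      then show ?thesis unfolding g2[OF eH] pathstart_translation pathfinish_translation by simp
    qed
    {
      fix v assume v: "v \<in> verts G \<union> verts H" "p v \<in> path_image (\<gamma> e)"
      consider "e \<in> edges G" "v \<in> verts G" | "e \<in> edges H" "v \<in> verts H"
        | "e \<in> edges G" "v \<in> verts H" | "e \<in> edges H" "v \<in> verts G" using e v(1) by blast
      then show "v \<in> e"
      proof cases
        case 1
        then show ?thesis using v(2) d1.edge_vertex g1 p1' by simp
      next
        case 2
        then have "p2 v \<in> path_image (\<gamma>2 e)" using v(2) im2 p2' by auto
        then show ?thesis using d2.edge_vertex 2 by blast
      next
        case 3
        then have "c + p2 v \<in> path_image (\<gamma>1 e)" using v(2) g1 p2' by simp
        then show ?thesis using far[OF M1(2)[OF 3(1)] M2(1)[OF 3(2)]] by blast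
      next
        case 4
        then have "p1 v \<in> (\<lambda>x. c + x) ` path_image (\<gamma>2 e)" using v(2) im2 p1' by simp
        then show ?thesis using far[OF M1(1)[OF 4(2)] M2(2)[OF 4(1)]] by blast
      qed
    next
      fix e' assume e': "e' \<in> edges G \<union> edges H" "e \<noteq> e'"
      consider "e \<in> edges G" "e' \<in> edges G" | "e \<in> edges H" "e' \<in> edges H"
        | "e \<in> edges G" "e' \<in> edges H" | "e \<in> edges H" "e' \<in> edges G" using e e'(1) by blast
      then show "path_image (\<gamma> e) \<inter> path_image (\<gamma> e') \<subseteq> p ` (e \<inter> e')"
      proof cases
        case 1
        have "p ` (e \<inter> e') = p1 ` (e \<inter> e')" by (rule p1i) (use E[OF 1(1)] in blast)
        then show ?thesis using d1.edge_cross[OF 1 e'(2)] g1 1 by simp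
      next
        case 2
        have "p ` (e \<inter> e') = (\<lambda>x. c + x) ` p2 ` (e \<inter> e')" by (rule p2i) (use E'[OF 2(1)] in blast)
        moreover have "path_image (\<gamma> e) \<inter> path_image (\<gamma> e') =
            (\<lambda>x. c + x) ` (path_image (\<gamma>2 e) \<inter> path_image (\<gamma>2 e'))"
          unfolding im2[OF 2(1)] im2[OF 2(2)] by (rule image_Int[symmetric]) simp
        ultimately show ?thesis using image_mono[OF d2.edge_cross[OF 2 e'(2)], of "\<lambda>x. c + x"] by metis
      next
        case 3
        then show ?thesis using apart[OF 3] by simp
      next
        case 4
        then show ?thesis using apart[OF 4(2,1)] by (simp add: Int_commute)
      qed
    }
  qed
  then show ?thesis by blast
qed

lemma planar_closed_under_disjoint_unions:
  "closed_under_disjoint_unions {G. G \<in> Gr d \<and> planar G}"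
  unfolding closed_under_disjoint_unions_def
proof (intro ballI impI)
  fix G H :: "'v ugraph"
  assume "G \<in> {G. G \<in> Gr d \<and> planar G}" "H \<in> {G. G \<in> Gr d \<and> planar G}" and disj: "verts G \<inter> verts H = {}"
  then have G: "G \<in> Gr d" "planar G" and H: "H \<in> Gr d" "planar H" by auto
  have "planar (graph_union G H)"
    using drawing_union[OF _ _ disj] G(2) H(2) planar_iff_drawing[OF GrD(1)[OF G(1)]]
      planar_iff_drawing[OF GrD(1)[OF H(1)]] planar_iff_drawing[OF GrD(1)[OF graph_union_Gr[OF G(1) H(1) disj]]]
    by blast
  then show "graph_union G H \<in> {G. G \<in> Gr d \<and> planar G}" using graph_union_Gr[OF G(1) H(1) disj] by simp
qed

theorem theorem2p2:
  fixes d :: nat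
  assumes "d > 1"
  shows "(\<forall>P :: nat ugraph set.
            graph_property d P \<and> monotone_property P \<and> hyperfinite P \<and>
            closed_under_disjoint_unions P \<longrightarrow> approx_verifiable d P) \<and>
         approx_verifiable d {G :: nat ugraph. G \<in> Gr d \<and> planar G}"
proof (intro conjI allI impI)
  have "0 < d" using assms by simp
  show "approx_verifiable d {G :: nat ugraph. G \<in> Gr d \<and> planar G}"
    by (rule hyperfinite_approx_verifiable[OF \<open>0 < d\<close> planar_graph_property planar_monotone
        planar_hyperfinite[OF \<open>0 < d\<close>] planar_closed_under_disjoint_unions])
  fix P :: "nat ugraph set"
  assume "graph_property d P \<and> monotone_property P \<and> hyperfinite P \<and> closed_under_disjoint_unions P"
  then show "approx_verifiable d P" using hyperfinite_approx_verifiable[OF \<open>0 < d\<close>] by blast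
qed

end
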